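(* Fix $d\in\mathbb N=\{1,2,\ldots\}$. Then for every modular ortholattice $L$ of height $d$ admitting an orthogonal $d$-diamond and for every ortholattice term $t(\bar x)$ (with $\bar y=(y_0,\ldots,y_d)$ new variables): (a) $t(\bar x)$ is weakly satisfiable in $L$ if and only if $\tilde h_d\big(t(\bar x),\bar y\big)$ is strongly satisfiable in $L$. (b) $t(\bar x)$ is strongly satisfiable in $L$ if and only if $\tilde g_d\big(t(\bar x),\bar y\big)$ is weakly satisfiable in $L$. In particular, for every $*$-subfield $\mathbb F$ of $\mathbb C$ and every finite-dimensional $\mathbb F$-unitary space $\mathcal H$, the problems $\mathrm{sat}_{\mathrm L(\mathcal H)}$ and $\mathrm{SAT}_{\mathrm L(\mathcal H)}$ are mutually polynomial-time many-one reducible: $\mathrm{sat}_{\mathrm L(\mathcal H)}\preceq\mathrm{SAT}_{\mathrm L(\mathcal H)}\preceq\mathrm{sat}_{\mathrm L(\mathcal H)}$.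
   Context: A modular ortholattice (MOL) is a modular lattice $L$ with $0,1$ and an order-reversing involution $\neg$ with $a\wedge\neg a=0$, $a\vee\neg a=1$. Its height (dimension) is the cardinality of a maximal chain minus one. An orthogonal $d$-diamond in $L$ is a system $(a_0,a_1,\ldots,a_d)$ of elements with $a_1\vee\cdots\vee a_d=1$; $a_i\le\neg a_j$ for $1\le i\ne j\le d$; and $a_0\wedge a_i=0$, $a_0\vee a_i=1$ for $1\le i\le d$. An ortholattice term is built from variables with $\wedge,\vee,\neg,0,1$; $t_L(\bar a)$ is its value. $t$ is strongly (weakly) satisfiable in $L$ if $t_L(\bar a)=1$ (resp. $t_L(\bar a)\neq0$) for some $\bar a$. $\mathrm{SAT}_L$, $\mathrm{sat}_L\subseteq\{0,1\}^*$ are the sets of (encodings of) strongly, resp. weakly, satisfiable terms. With $\bar y=(y_0,\ldots,y_d)$ define $h_d(\bar y)=\Big(\bigvee_{i=1}^d\big(y_i\wedge\bigwedge_{0<j\ne i}\neg y_j\big)\Big)\wedge\bigwedge_{i=1}^d\big((y_0\vee y_i)\wedge(\neg y_0\vee\neg y_i)\big)$, $\hat h_d(x,\bar y)=\bigvee_{i,j=1}^d\Big(\big(((x\vee\neg y_i)\wedge y_i)\vee y_0\big)\wedge y_j\Big)$, $\tilde h_d(x,\bar y)=h_d(\bar y)\wedge\hat h_d(x,\bar y)$, $g_d(\bar y)=\neg y_0\wedge\bigwedge_{i=1}^d\big(y_0\vee(y_i\wedge\bigwedge_{0<j\neq i}\neg y_j)\big)$, $\tilde g_d(x,\bar y)=g_d(\bar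 y)\wedge\bigwedge_{i=1}^d\big(y_0\vee(x\wedge y_i)\big)$. A $*$-subfield of $\mathbb C$ is a subfield closed under complex conjugation. An $\mathbb F$-unitary space is an $\mathbb F$-vector space with a map $\langle\cdot\mid\cdot\rangle$ into $\mathbb F$, linear in the right argument, with $\langle y\mid x\rangle=\overline{\langle x\mid y\rangle}$ and $\langle x\mid x\rangle\ne0$ for $x\neq0$. $\mathrm L(\mathcal H)$ is the ortholattice of linear subspaces of finite-dimensional $\mathcal H$ under $\cap$, $+$, $^\perp$, $\{\vec 0\}$, $\mathcal H$.
   Formalization: The reducibility claim is stated for nonzero finite-dimensional unitary spaces only; for the zero space sat is empty while SAT contains every term, so SAT is not many-one reducible to sat and the claim fails there. *)

theory Defs
  imports
    "HOL-Algebra.Algebra"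
    "HOL-Algebra.Algebraic_Closure_Type"
    "HOL-Computational_Algebra.Polynomial"
    Complex_Main
begin

section \<open>Modular ortholattices\<close>

record 'a ortholattice = "'a gorder" +
  ocompl :: "'a \<Rightarrow> 'a"

locale modular_ortholattice = bounded_lattice L
  for L :: "('a, 'b) ortholattice_scheme" (structure) +
  assumes modular:
      "\<lbrakk>x \<in> carrier L; y \<in> carrier L; z \<in> carrier L; x \<sqsubseteq> z\<rbrakk>
        \<Longrightarrow> x \<squnion> (y \<sqinter> z) = (x \<squnion> y) \<sqinter> z"
    and ocompl_closed: "x \<in> carrier L \<Longrightarrow> ocompl L x \<in> carrier L"
    and ocompl_antitone:
      "\<lbrakk>x \<in> carrier L; y \<in> carrier L; x \<sqsubseteq> y\<rbrakk> \<Longrightarrow> ocompl L y \<sqsubseteq> ocompl L x"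
    and ocompl_involution: "x \<in> carrier L \<Longrightarrow> ocompl L (ocompl L x) = x"
    and meet_ocompl: "x \<in> carrier L \<Longrightarrow> x \<sqinter> ocompl L x = \<bottom>"
    and join_ocompl: "x \<in> carrier L \<Longrightarrow> x \<squnion> ocompl L x = \<top>"

definition has_height :: "('a, 'b) gorder_scheme \<Rightarrow> nat \<Rightarrow> bool" where
  "has_height L d \<longleftrightarrow>
     (\<exists>C. pred_on.maxchain (carrier L) (le L) C \<and> finite C \<and> card C = d + 1)"

definition orthogonal_diamond ::
    "('a, 'b) ortholattice_scheme \<Rightarrow> nat \<Rightarrow> (nat \<Rightarrow> 'a) \<Rightarrow> bool" where
  "orthogonal_diamond L d a \<longleftrightarrow>
     (\<forall>i\<le>d. a i \<in> carrier L) \<and>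
     \<Squnion>\<^bsub>L\<^esub>(a ` {1..d}) = \<top>\<^bsub>L\<^esub> \<and>
     (\<forall>i\<in>{1..d}. \<forall>j\<in>{1..d}. i \<noteq> j \<longrightarrow> a i \<sqsubseteq>\<^bsub>L\<^esub> ocompl L (a j)) \<and>
     (\<forall>i\<in>{1..d}. a 0 \<sqinter>\<^bsub>L\<^esub> a i = \<bottom>\<^bsub>L\<^esub> \<and> a 0 \<squnion>\<^bsub>L\<^esub> a i = \<top>\<^bsub>L\<^esub>)"


section \<open>Ortholattice terms\<close>

datatype oterm =
    Var nat
  | Meet oterm oterm
  | Join oterm oterm
  | Neg oterm
  | Zero
  | One

primrec vars :: "oterm \<Rightarrow> nat set" where
  "vars (Var v) = {v}"
| "vars (Meet s t) = vars s \<union> vars t"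
| "vars (Join s t) = vars s \<union> vars t"
| "vars (Neg t) = vars t"
| "vars Zero = {}"
| "vars One = {}"

primrec oeval :: "('a, 'b) ortholattice_scheme \<Rightarrow> (nat \<Rightarrow> 'a) \<Rightarrow> oterm \<Rightarrow> 'a" where
  "oeval L \<rho> (Var v) = \<rho> v"
| "oeval L \<rho> (Meet s t) = oeval L \<rho> s \<sqinter>\<^bsub>L\<^esub> oeval L \<rho> t"
| "oeval L \<rho> (Join s t) = oeval L \<rho> s \<squnion>\<^bsub>L\<^esub> oeval L \<rho> t"
| "oeval L \<rho> (Neg t) = ocompl L (oeval L \<rho> t)"
| "oeval L \<rho> Zero = \<bottom>\<^bsub>L\<^esub>"
| "oeval L \<rho> One = \<top>\<^bsub>L\<^esub>"

definition strongly_satisfiable :: "('a, 'b) ortholattice_scheme \<Rightarrow> oterm \<Rightarrow> bool" where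
  "strongly_satisfiable L t \<longleftrightarrow>
     (\<exists>\<rho>. (\<forall>v. \<rho> v \<in> carrier L) \<and> oeval L \<rho> t = \<top>\<^bsub>L\<^esub>)"

definition weakly_satisfiable :: "('a, 'b) ortholattice_scheme \<Rightarrow> oterm \<Rightarrow> bool" where
  "weakly_satisfiable L t \<longleftrightarrow>
     (\<exists>\<rho>. (\<forall>v. \<rho> v \<in> carrier L) \<and> oeval L \<rho> t \<noteq> \<bottom>\<^bsub>L\<^esub>)"

definition Meets :: "oterm list \<Rightarrow> oterm" where
  "Meets ts = foldr Meet ts One"

definition Joins :: "oterm list \<Rightarrow> oterm" where
  "Joins ts = foldr Join ts Zero"

definition ortho_part :: "nat \<Rightarrow> (nat \<Rightarrow> oterm) \<Rightarrow> nat \<Rightarrow> oterm" where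
  "ortho_part d y i = Meet (y i) (Meets [Neg (y j). j \<leftarrow> [1..<d+1], j \<noteq> i])"

definition h_term :: "nat \<Rightarrow> (nat \<Rightarrow> oterm) \<Rightarrow> oterm" where
  "h_term d y =
     Meet (Joins [ortho_part d y i. i \<leftarrow> [1..<d+1]])
          (Meets [Meet (Join (y 0) (y i)) (Join (Neg (y 0)) (Neg (y i))). i \<leftarrow> [1..<d+1]])"

definition h_hat :: "nat \<Rightarrow> oterm \<Rightarrow> (nat \<Rightarrow> oterm) \<Rightarrow> oterm" where
  "h_hat d x y =
     Joins [Meet (Join (Meet (Join x (Neg (y i))) (y i)) (y 0)) (y j).
              i \<leftarrow> [1..<d+1], j \<leftarrow> [1..<d+1]]"

definition h_tilde :: "nat \<Rightarrow> oterm \<Rightarrow> (nat \<Rightarrow> oterm) \<Rightarrow> oterm" where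
  "h_tilde d x y = Meet (h_term d y) (h_hat d x y)"

definition g_term :: "nat \<Rightarrow> (nat \<Rightarrow> oterm) \<Rightarrow> oterm" where
  "g_term d y = Meet (Neg (y 0)) (Meets [Join (y 0) (ortho_part d y i). i \<leftarrow> [1..<d+1]])"

definition g_tilde :: "nat \<Rightarrow> oterm \<Rightarrow> (nat \<Rightarrow> oterm) \<Rightarrow> oterm" where
  "g_tilde d x y =
     Meet (g_term d y) (Meets [Join (y 0) (Meet x (y i)). i \<leftarrow> [1..<d+1]])"


section \<open>Encoding of terms and the satisfiability problems\<close>

text \<open>
  Terms are written in Polish notation.  A variable index is written in binary, least significant
  digit first; every digit is preceded by \<^const>\<open>True\<close> and the end of the number is marked by
  \<^const>\<open>False\<close>, so that the code is prefix-free.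
\<close>

fun encode_index :: "nat \<Rightarrow> bool list" where
  "encode_index n = (if n = 0 then [False] else True # odd n # encode_index (n div 2))"

declare encode_index.simps [simp del]

primrec encode :: "oterm \<Rightarrow> bool list" where
  "encode Zero = [False, False, False]"
| "encode One = [False, False, True]"
| "encode (Neg t) = [False, True, False] @ encode t"
| "encode (Meet s t) = [False, True, True] @ encode s @ encode t"
| "encode (Join s t) = [True, False, False] @ encode s @ encode t"
| "encode (Var v) = [True, False, True] @ encode_index v"

lemma encode_index_prefix_free:
  "encode_index m @ u = encode_index n @ v \<Longrightarrow> m = n \<and> u = v"
proof (induction m arbitrary: n rule: less_induct)
  case (less m)
  show ?case
  proof (cases "m = 0")
    case True
    then show ?thesis
      using less.prems encode_index.simps[of m] encode_index.simps[of n] by (auto split: if_splits)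
  next
    case False
    then have n: "n \<noteq> 0"
      using less.prems encode_index.simps[of m] encode_index.simps[of n] by (auto split: if_splits)
    have parity: "odd m = odd n"
      and rest: "encode_index (m div 2) @ u = encode_index (n div 2) @ v"
      using less.prems False n encode_index.simps[of m] encode_index.simps[of n] by auto
    have *: "m div 2 = n div 2" "u = v"
      using less.IH[OF _ rest] False by simp_all
    from *(1) parity have "m = n" by presburger
    with *(2) show ?thesis by simp
  qed
qed

lemma encode_prefix_free: "encode s @ u = encode t @ v \<Longrightarrow> s = t \<and> u = v"
proof (induction s arbitrary: t u v)
  case (Var x)
  then show ?case by (cases t) (auto dest: encode_index_prefix_free)
next
  case (Meet s1 s2)
  from Meet.prems obtain t1 t2 where t: "t = Meet t1 t2"
    and eq: "encode s1 @ (encode s2 @ u) = encode t1 @ (encode t2 @ v)"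
    by (cases t) simp_all
  from Meet.IH(1)[OF eq] have "s1 = t1" and eq2: "encode s2 @ u = encode t2 @ v" by simp_all
  with Meet.IH(2)[OF eq2] t show ?case by simp
next
  case (Join s1 s2)
  from Join.prems obtain t1 t2 where t: "t = Join t1 t2"
    and eq: "encode s1 @ (encode s2 @ u) = encode t1 @ (encode t2 @ v)"
    by (cases t) simp_all
  from Join.IH(1)[OF eq] have "s1 = t1" and eq2: "encode s2 @ u = encode t2 @ v" by simp_all
  with Join.IH(2)[OF eq2] t show ?case by simp
next
  case (Neg s)
  from Neg.prems obtain t' where t: "t = Neg t'" and eq: "encode s @ u = encode t' @ v"
    by (cases t) simp_all
  with Neg.IH[OF eq] show ?case by simp
next
  case Zero
  then show ?case by (cases t) auto
next
  case One
  then show ?case by (cases t) auto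
qed

lemma inj_encode: "inj encode"
  using encode_prefix_free[where u = "[]" and v = "[]"] by (auto intro: injI)

definition SAT_strong :: "('a, 'b) ortholattice_scheme \<Rightarrow> bool list set" where
  "SAT_strong L = encode ` {t. strongly_satisfiable L t}"

definition sat_weak :: "('a, 'b) ortholattice_scheme \<Rightarrow> bool list set" where
  "sat_weak L = encode ` {t. weakly_satisfiable L t}"


section \<open>Polynomial-time many-one reductions\<close>

text \<open>
  Deterministic multi-tape Turing machines with two-way infinite tapes.  States and tape symbols
  are initial segments of the naturals; 0 is the initial state, and the symbols 0, 1, 2
  stand for the blank and the bits \<^const>\<open>False\<close>, \<^const>\<open>True\<close>.  The transition function reads the
  symbols under the heads and returns the new state and, for each tape, the symbol to be
  written and the head move; \<^const>\<open>None\<close> means that the machine halts.  Tape 0 is the input tape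
  and the last tape is the output tape.
\<close>

datatype move = MLeft | MStay | MRight

primrec offset :: "move \<Rightarrow> int" where
  "offset MLeft = - 1"
| "offset MStay = 0"
| "offset MRight = 1"

record tm =
  tapes :: nat
  states :: nat
  symbols :: nat
  delta :: "nat \<Rightarrow> nat list \<Rightarrow> (nat \<times> (nat \<times> move) list) option"

definition wf_tm :: "tm \<Rightarrow> bool" where
  "wf_tm M \<longleftrightarrow> tapes M \<ge> 1 \<and> states M \<ge> 1 \<and> symbols M \<ge> 3 \<and>
     (\<forall>q < states M. \<forall>rs. length rs = tapes M \<and> set rs \<subseteq> {..<symbols M} \<longrightarrow>
        (case delta M q rs of
           None \<Rightarrow> True
         | Some (q', as) \<Rightarrow>
             q' < states M \<and> length as = tapes M \<and> fst ` set as \<subseteq> {..<symbols M}))"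

text \<open>A tape is given by its contents and the position of its head.\<close>

type_synonym tape = "(int \<Rightarrow> nat) \<times> int"
type_synonym config = "nat \<times> tape list"

fun read_tape :: "tape \<Rightarrow> nat" where
  "read_tape (c, p) = c p"

fun update_tape :: "nat \<times> move \<Rightarrow> tape \<Rightarrow> tape" where
  "update_tape (s, m) (c, p) = (c(p := s), p + offset m)"

fun step :: "tm \<Rightarrow> config \<Rightarrow> config option" where
  "step M (q, ts) =
     (case delta M q (map read_tape ts) of
        None \<Rightarrow> None
      | Some (q', as) \<Rightarrow> Some (q', map2 update_tape as ts))"

definition string_tape :: "bool list \<Rightarrow> int \<Rightarrow> nat" where
  "string_tape w i =
     (if 0 \<le> i \<and> i < int (length w) then if w ! nat i then 2 else 1 else 0)"

definition init_config :: "tm \<Rightarrow> bool list \<Rightarrow> config" where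
  "init_config M w = (0, (string_tape w, 0) # replicate (tapes M - 1) (string_tape [], 0))"

definition computes_within :: "tm \<Rightarrow> bool list \<Rightarrow> bool list \<Rightarrow> nat \<Rightarrow> bool" where
  "computes_within M w out n \<longleftrightarrow>
     (\<exists>k\<le>n. \<exists>q ts. (init_config M w, (q, ts)) \<in> {(c, c'). step M c = Some c'} ^^ k \<and>
        step M (q, ts) = None \<and> fst (last ts) = string_tape out)"

definition polytime_computable :: "(bool list \<Rightarrow> bool list) \<Rightarrow> bool" where
  "polytime_computable f \<longleftrightarrow>
     (\<exists>M (p :: nat poly). wf_tm M \<and> (\<forall>w. computes_within M w (f w) (poly p (length w))))"

definition polytime_reducible :: "bool list set \<Rightarrow> bool list set \<Rightarrow> bool" where
  "polytime_reducible A B \<longleftrightarrow>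
     (\<exists>f. polytime_computable f \<and> (\<forall>w. w \<in> A \<longleftrightarrow> f w \<in> B))"


section \<open>Unitary spaces and their subspace ortholattices\<close>

abbreviation complex_ring :: "complex ring" where
  "complex_ring \<equiv> ring_of_type_algebra"

definition star_subfield :: "complex set \<Rightarrow> bool" where
  "star_subfield F \<longleftrightarrow> subfield F complex_ring \<and> (\<forall>a\<in>F. cnj a \<in> F)"

abbreviation field_of :: "complex set \<Rightarrow> complex ring" where
  "field_of F \<equiv> complex_ring\<lparr>carrier := F\<rparr>"

record 'v unitary = "(complex, 'v) module" +
  form :: "'v \<Rightarrow> 'v \<Rightarrow> complex"

locale unitary_space = module "field_of F" H
  for F :: "complex set" and H :: "('v, 'b) unitary_scheme" (structure) +
  assumes scalars: "star_subfield F"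
    and form_closed: "\<lbrakk>x \<in> carrier H; y \<in> carrier H\<rbrakk> \<Longrightarrow> form H x y \<in> F"
    and form_add_right:
      "\<lbrakk>x \<in> carrier H; y \<in> carrier H; z \<in> carrier H\<rbrakk>
        \<Longrightarrow> form H x (y \<oplus>\<^bsub>H\<^esub> z) = form H x y + form H x z"
    and form_smult_right:
      "\<lbrakk>a \<in> F; x \<in> carrier H; y \<in> carrier H\<rbrakk>
        \<Longrightarrow> form H x (a \<odot>\<^bsub>H\<^esub> y) = a * form H x y"
    and form_hermitian:
      "\<lbrakk>x \<in> carrier H; y \<in> carrier H\<rbrakk> \<Longrightarrow> form H y x = cnj (form H x y)"
    and form_anisotropic:
      "\<lbrakk>x \<in> carrier H; x \<noteq> \<zero>\<^bsub>H\<^esub>\<rbrakk> \<Longrightarrow> form H x x \<noteq> 0"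

abbreviation is_subspace :: "complex set \<Rightarrow> ('v, 'b) unitary_scheme \<Rightarrow> 'v set \<Rightarrow> bool" where
  "is_subspace F H W \<equiv> submodule W (field_of F) H"

text \<open>Finite dimension: no proper subspace contains some fixed finite set of vectors.\<close>

definition finite_dim :: "complex set \<Rightarrow> ('v, 'b) unitary_scheme \<Rightarrow> bool" where
  "finite_dim F H \<longleftrightarrow>
     (\<exists>B. finite B \<and> B \<subseteq> carrier H \<and>
        (\<forall>W. is_subspace F H W \<and> B \<subseteq> W \<longrightarrow> W = carrier H))"

definition perp :: "('v, 'b) unitary_scheme \<Rightarrow> 'v set \<Rightarrow> 'v set" where
  "perp H W = {x \<in> carrier H. \<forall>w\<in>W. form H w x = 0}"

definition subspace_lattice ::
    "complex set \<Rightarrow> ('v, 'b) unitary_scheme \<Rightarrow> 'v set ortholattice" where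
  "subspace_lattice F H =
     \<lparr>carrier = {W. is_subspace F H W}, eq = (=), le = (\<subseteq>), ocompl = perp H\<rparr>"

text \<open>
  The lattice operations are given by the order; the following lemmas identify them with
  intersection, sum, the zero space and the whole space.
\<close>

context unitary_space
begin

lemma is_subspace_iff:
  "is_subspace F H W \<longleftrightarrow> W \<subseteq> carrier H \<and> \<zero>\<^bsub>H\<^esub> \<in> W \<and>
     (\<forall>x\<in>W. \<forall>y\<in>W. x \<oplus>\<^bsub>H\<^esub> y \<in> W) \<and> (\<forall>a\<in>F. \<forall>x\<in>W. a \<odot>\<^bsub>H\<^esub> x \<in> W)"
    (is "?l = ?r")
proof
  assume ?l
  then interpret W: submodule W "field_of F" H .
  show ?r
    using W.subset W.one_closed W.m_closed W.smult_closed by auto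
next
  assume r: ?r
  show ?l
  proof (rule submoduleI)
    fix a assume a: "a \<in> W"
    with r have aC: "a \<in> carrier H" by blast
    have one: "\<one>\<^bsub>field_of F\<^esub> \<in> carrier (field_of F)" by (rule R.one_closed)
    have "\<ominus>\<^bsub>H\<^esub> a = (\<ominus>\<^bsub>field_of F\<^esub> \<one>\<^bsub>field_of F\<^esub>) \<odot>\<^bsub>H\<^esub> a"
      using smult_l_minus[OF one aC] smult_one[OF aC] by (simp only:)
    moreover have "\<ominus>\<^bsub>field_of F\<^esub> \<one>\<^bsub>field_of F\<^esub> \<in> F"
      using R.a_inv_closed[OF one] by simp
    ultimately show "\<ominus>\<^bsub>H\<^esub> a \<in> W" using r a by simp
  qed (use r in auto)
qed

lemma subspace_lattice_bottom: "\<bottom>\<^bsub>subspace_lattice F H\<^esub> = {\<zero>\<^bsub>H\<^esub>}"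
proof -
  have zero: "is_subspace F H {\<zero>\<^bsub>H\<^esub>}"
    unfolding is_subspace_iff using smult_r_null by simp
  have "least (subspace_lattice F H) x (carrier (subspace_lattice F H)) \<longleftrightarrow> x = {\<zero>\<^bsub>H\<^esub>}" for x
  proof
    assume "least (subspace_lattice F H) x (carrier (subspace_lattice F H))"
    then have "is_subspace F H x" "x \<subseteq> {\<zero>\<^bsub>H\<^esub>}"
      using zero unfolding least_def subspace_lattice_def by simp_all
    then show "x = {\<zero>\<^bsub>H\<^esub>}"
      unfolding is_subspace_iff by blast
  next
    assume "x = {\<zero>\<^bsub>H\<^esub>}"
    then show "least (subspace_lattice F H) x (carrier (subspace_lattice F H))"
      using zero unfolding least_def subspace_lattice_def by (simp add: is_subspace_iff)
  qed
  then show ?thesis by (simp add: bottom_def)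
qed

lemma subspace_lattice_top: "\<top>\<^bsub>subspace_lattice F H\<^esub> = carrier H"
proof -
  have full: "is_subspace F H (carrier H)"
    unfolding is_subspace_iff by simp
  have "greatest (subspace_lattice F H) x (carrier (subspace_lattice F H)) \<longleftrightarrow> x = carrier H" for x
  proof
    assume "greatest (subspace_lattice F H) x (carrier (subspace_lattice F H))"
    then have "is_subspace F H x" "carrier H \<subseteq> x"
      using full unfolding greatest_def subspace_lattice_def by simp_all
    then show "x = carrier H"
      unfolding is_subspace_iff by blast
  next
    assume "x = carrier H"
    then show "greatest (subspace_lattice F H) x (carrier (subspace_lattice F H))"
      using full unfolding greatest_def subspace_lattice_def by (simp add: is_subspace_iff)
  qed
  then show ?thesis by (simp add: top_def)
qed

lemma subspace_lattice_meet:
  assumes "is_subspace F H V" "is_subspace F H W"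
  shows "V \<sqinter>\<^bsub>subspace_lattice F H\<^esub> W = V \<inter> W"
proof -
  have sub: "is_subspace F H (V \<inter> W)"
    using assms unfolding is_subspace_iff by blast
  have low: "Lower (subspace_lattice F H) {V, W} = {U. is_subspace F H U \<and> U \<subseteq> V \<and> U \<subseteq> W}"
    by (rule Set.set_eqI) (use assms in \<open>simp add: Lower_def subspace_lattice_def; blast\<close>)
  have "greatest (subspace_lattice F H) x (Lower (subspace_lattice F H) {V, W}) \<longleftrightarrow>
      x = V \<inter> W" for x
  proof
    assume "greatest (subspace_lattice F H) x (Lower (subspace_lattice F H) {V, W})"
    then have "x \<subseteq> V" "x \<subseteq> W" "V \<inter> W \<subseteq> x"
      using sub unfolding greatest_def low by (simp_all add: subspace_lattice_def)
    then show "x = V \<inter> W" by blast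
  next
    assume "x = V \<inter> W"
    then show "greatest (subspace_lattice F H) x (Lower (subspace_lattice F H) {V, W})"
      using sub unfolding greatest_def low by (simp add: subspace_lattice_def Collect_mono)
  qed
  then show ?thesis by (simp add: meet_def inf_def)
qed

lemma subspace_lattice_join:
  assumes V: "is_subspace F H V" and W: "is_subspace F H W"
  shows "V \<squnion>\<^bsub>subspace_lattice F H\<^esub> W = V <+>\<^bsub>H\<^esub> W"
proof -
  have mem: "x \<in> V <+>\<^bsub>H\<^esub> W \<longleftrightarrow> (\<exists>v\<in>V. \<exists>w\<in>W. x = v \<oplus>\<^bsub>H\<^esub> w)" for x
    by (auto simp: set_add_def set_mult_def)
  have sub: "V \<subseteq> carrier H" "W \<subseteq> carrier H"
    using V W by (auto simp: is_subspace_iff)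
  have zero: "\<zero>\<^bsub>H\<^esub> \<in> V" "\<zero>\<^bsub>H\<^esub> \<in> W"
    using V W by (auto simp: is_subspace_iff)
  have S: "is_subspace F H (V <+>\<^bsub>H\<^esub> W)"
    unfolding is_subspace_iff
  proof (intro conjI ballI)
    show "V <+>\<^bsub>H\<^esub> W \<subseteq> carrier H"
      using sub by (auto simp: mem subset_iff)
    show "\<zero>\<^bsub>H\<^esub> \<in> V <+>\<^bsub>H\<^esub> W"
      unfolding mem using zero M.l_zero[OF M.zero_closed] by metis
  next
    fix x y assume "x \<in> V <+>\<^bsub>H\<^esub> W" "y \<in> V <+>\<^bsub>H\<^esub> W"
    then obtain v w v' w' where *: "v \<in> V" "w \<in> W" "v' \<in> V" "w' \<in> W"
      "x = v \<oplus>\<^bsub>H\<^esub> w" "y = v' \<oplus>\<^bsub>H\<^esub> w'" by (auto simp: mem)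
    then have "x \<oplus>\<^bsub>H\<^esub> y = (v \<oplus>\<^bsub>H\<^esub> v') \<oplus>\<^bsub>H\<^esub> (w \<oplus>\<^bsub>H\<^esub> w')"
      using sub by (simp add: subset_iff M.a_ac)
    then show "x \<oplus>\<^bsub>H\<^esub> y \<in> V <+>\<^bsub>H\<^esub> W"
      using * V W unfolding mem is_subspace_iff by blast
  next
    fix a x assume a: "a \<in> F" and "x \<in> V <+>\<^bsub>H\<^esub> W"
    then obtain v w where *: "v \<in> V" "w \<in> W" "x = v \<oplus>\<^bsub>H\<^esub> w" by (auto simp: mem)
    then have "a \<odot>\<^bsub>H\<^esub> x = a \<odot>\<^bsub>H\<^esub> v \<oplus>\<^bsub>H\<^esub> a \<odot>\<^bsub>H\<^esub> w"
      using sub a smult_r_distr[of a v w] by auto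
    then show "a \<odot>\<^bsub>H\<^esub> x \<in> V <+>\<^bsub>H\<^esub> W"
      using * a V W unfolding mem is_subspace_iff by blast
  qed
  have incl1: "V \<subseteq> V <+>\<^bsub>H\<^esub> W"
  proof
    fix v assume "v \<in> V"
    moreover have "v = v \<oplus>\<^bsub>H\<^esub> \<zero>\<^bsub>H\<^esub>"
      using sub \<open>v \<in> V\<close> by auto
    ultimately show "v \<in> V <+>\<^bsub>H\<^esub> W"
      using zero unfolding mem by blast
  qed
  have incl2: "W \<subseteq> V <+>\<^bsub>H\<^esub> W"
  proof
    fix w assume "w \<in> W"
    moreover have "w = \<zero>\<^bsub>H\<^esub> \<oplus>\<^bsub>H\<^esub> w"
      using sub \<open>w \<in> W\<close> by auto
    ultimately show "w \<in> V <+>\<^bsub>H\<^esub> W"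
      using zero unfolding mem by blast
  qed
  have least: "V <+>\<^bsub>H\<^esub> W \<subseteq> U" if "is_subspace F H U" "V \<subseteq> U" "W \<subseteq> U" for U
    using that unfolding is_subspace_iff mem subset_iff by blast
  have up: "Upper (subspace_lattice F H) {V, W} =
      {U. is_subspace F H U \<and> V \<subseteq> U \<and> W \<subseteq> U}"
    by (rule Set.set_eqI) (use V W in \<open>simp add: Upper_def subspace_lattice_def; blast\<close>)
  have "least (subspace_lattice F H) x (Upper (subspace_lattice F H) {V, W}) \<longleftrightarrow>
      x = V <+>\<^bsub>H\<^esub> W" for x
  proof
    assume "least (subspace_lattice F H) x (Upper (subspace_lattice F H) {V, W})"
    then have "is_subspace F H x" "V \<subseteq> x" "W \<subseteq> x"
      and "\<And>U. is_subspace F H U \<Longrightarrow> V \<subseteq> U \<Longrightarrow> W \<subseteq> U \<Longrightarrow> x \<subseteq> U"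
      unfolding least_def up by (auto simp: subspace_lattice_def)
    then show "x = V <+>\<^bsub>H\<^esub> W"
      using S incl1 incl2 least by (intro Set.equalityI) simp_all
  next
    assume "x = V <+>\<^bsub>H\<^esub> W"
    then show "least (subspace_lattice F H) x (Upper (subspace_lattice F H) {V, W})"
      using S incl1 incl2 least unfolding least_def up by (simp add: subspace_lattice_def Collect_mono)
  qed
  then show ?thesis by (simp add: join_def sup_def)
qed

end

end

theory Submission
  imports Defs
begin

text \<open>
  In a modular ortholattice of height \<open>d\<close>, any \<open>d\<close> pairwise orthogonal non-zero elements are atoms
  with join \<open>1\<close>.  Hence in an orthogonal diamond \<open>(x \<or> \<not>a\<^sub>i) \<and> a\<^sub>i\<close> is \<open>a\<^sub>i\<close> or \<open>0\<close>, and \<open>a\<^sub>0\<close> spreads a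
  single such atom to all \<open>a\<^sub>j\<close>; this is what \<open>h_tilde\<close> expresses.  Conversely, a non-zero value of
  \<open>g_tilde\<close> forces the \<open>y\<^sub>i\<close> to be \<open>d\<close> such atoms, all of them below \<open>x\<close>.

  Gram-Schmidt orthogonalisation yields an orthogonal basis \<open>e\<^sub>1, \<dots>, e\<^sub>d\<close> of \<open>H\<close>; the lines spanned by
  the \<open>e\<^sub>i\<close> together with the hyperplane orthogonal to \<open>e\<^sub>1 + \<dots> + e\<^sub>d\<close> form an orthogonal diamond.

  For fixed \<open>d\<close> both reductions substitute the term into a fixed template.  Fresh variables need not
  be searched for: the term's variables are moved to the odd indices, which is a finite-state
  transduction of the encoding, and the variables \<open>y\<^sub>i\<close> get the even ones.  Inputs that do not encode
  a term are detected by counting the terms still to be read.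
\<close>

section \<open>Orthogonal families in modular ortholattices\<close>

text \<open>Height is given by a single maximal chain, so all counting rests on one strictly
  monotone rank bounded by \<open>d\<close>. Each member of an orthogonal family raises the rank of
  the join by at least one; \<open>d\<close> members use up the whole budget, which leaves no room
  for an element strictly below a member or for a join short of 1. In \<open>g_tilde\<close> the
  disjunct \<open>y 0\<close> couples the conjuncts: one non-zero element below
  \<open>Neg (y 0)\<close> and below every join of \<open>y 0\<close> with a part forces all parts
  to be non-zero at once, although weak satisfiability is a single inequality. For spaces the
  obstacle is that the scalars may lack square roots and the form is only anisotropic, not assumed
  positive: there is neither normalisation nor a nearest point, and the decomposition of
  \<open>H\<close> along a subspace has to come out of the induction that builds the basis. The
  hyperplane still works, since \<open>e i\<close> pairs with the sum of the basis to the non-zero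
  value \<open>form H (e i) (e i)\<close>. For fixed dimension the term occurs a constant number of
  times in either formula, so a finite control that rereads its input works in linear time.\<close>

context modular_ortholattice
begin

section \<open>Order calculus in a modular ortholattice\<close>

lemma le_meet_iff:
  "\<lbrakk>x \<in> carrier L; y \<in> carrier L; z \<in> carrier L\<rbrakk> \<Longrightarrow> z \<sqsubseteq> x \<sqinter> y \<longleftrightarrow> z \<sqsubseteq> x \<and> z \<sqsubseteq> y"
  by (meson le_trans meet_closed meet_left meet_right meet_le)

lemma join_le_iff:
  "\<lbrakk>x \<in> carrier L; y \<in> carrier L; z \<in> carrier L\<rbrakk> \<Longrightarrow> x \<squnion> y \<sqsubseteq> z \<longleftrightarrow> x \<sqsubseteq> z \<and> y \<sqsubseteq> z"
  by (meson le_trans join_closed join_left join_right join_le)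

lemma meet_mono:
  assumes "x \<in> carrier L" "x' \<in> carrier L" "y \<in> carrier L" "y' \<in> carrier L" "x \<sqsubseteq> x'" "y \<sqsubseteq> y'"
  shows "x \<sqinter> y \<sqsubseteq> x' \<sqinter> y'"
  using le_trans[OF meet_left[of x y], of x'] le_trans[OF meet_right[of x y], of y'] assms
  by (simp add: le_meet_iff)

lemma top_le_iff: "x \<in> carrier L \<Longrightarrow> \<top> \<sqsubseteq> x \<longleftrightarrow> x = \<top>"
  by (meson le_antisym top_closed top_higher le_refl)

lemma le_bottom_iff: "x \<in> carrier L \<Longrightarrow> x \<sqsubseteq> \<bottom> \<longleftrightarrow> x = \<bottom>"
  by (meson le_antisym bottom_closed bottom_lower le_refl)

lemma meet_units:
  "x \<in> carrier L \<Longrightarrow> \<top> \<sqinter> x = x" "x \<in> carrier L \<Longrightarrow> x \<sqinter> \<top> = x"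
  "x \<in> carrier L \<Longrightarrow> \<bottom> \<sqinter> x = \<bottom>" "x \<in> carrier L \<Longrightarrow> x \<sqinter> \<bottom> = \<bottom>"
  using top_meet bottom_meet by (simp_all add: eq_is_equal meet_comm)

lemma join_units:
  "x \<in> carrier L \<Longrightarrow> \<bottom> \<squnion> x = x" "x \<in> carrier L \<Longrightarrow> x \<squnion> \<bottom> = x"
  using bottom_join by (simp_all add: eq_is_equal join_comm)

lemma le_ocompl_iff:
  "\<lbrakk>x \<in> carrier L; y \<in> carrier L\<rbrakk> \<Longrightarrow> x \<sqsubseteq> ocompl L y \<longleftrightarrow> y \<sqsubseteq> ocompl L x"
  by (metis ocompl_antitone ocompl_closed ocompl_involution)

lemma le_and_ocompl_imp_bottom:
  "\<lbrakk>x \<in> carrier L; y \<in> carrier L; x \<sqsubseteq> y; x \<sqsubseteq> ocompl L y\<rbrakk> \<Longrightarrow> x = \<bottom>"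
  by (metis le_meet_iff le_bottom_iff meet_ocompl ocompl_closed)

lemma ocompl_bottom: "ocompl L \<bottom> = \<top>"
  by (metis bottom_closed bottom_lower le_ocompl_iff ocompl_closed top_closed top_le_iff)

lemma ocompl_top: "ocompl L \<top> = \<bottom>"
  by (metis ocompl_bottom ocompl_involution bottom_closed)

text \<open>Together with the next lemma this is De Morgan in the form used by
  \<open>h_term\<close>: strong satisfiability can only demand the value 1, so disjointness of
  \<open>y 0\<close> and \<open>y i\<close> is expressed by the join of their complements.\<close>

lemma join_ocompl_top_imp:
  assumes "x \<in> carrier L" "y \<in> carrier L" "ocompl L x \<squnion> ocompl L y = \<top>"
  shows "x \<sqinter> y = \<bottom>"
proof -
  have "\<top> \<sqsubseteq> ocompl L (x \<sqinter> y)"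
    using assms by (metis join_le_iff le_meet_iff le_refl meet_closed ocompl_antitone ocompl_closed)
  then show ?thesis
    by (metis assms(1,2) bottom_closed meet_closed ocompl_closed ocompl_involution ocompl_top top_le_iff)
qed

lemma meet_bottom_imp:
  assumes "x \<in> carrier L" "y \<in> carrier L" "x \<sqinter> y = \<bottom>"
  shows "ocompl L x \<squnion> ocompl L y = \<top>"
proof -
  let ?j = "ocompl L x \<squnion> ocompl L y"
  have j: "?j \<in> carrier L" using assms by (simp add: ocompl_closed)
  have "ocompl L ?j \<sqsubseteq> x" "ocompl L ?j \<sqsubseteq> y"
    using assms by (metis j join_left join_right ocompl_antitone ocompl_closed ocompl_involution)+
  then have "ocompl L ?j = \<bottom>"
    using assms j by (metis le_meet_iff le_bottom_iff ocompl_closed)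
  then show ?thesis by (metis j ocompl_bottom ocompl_involution)
qed

section \<open>A rank function from one maximal chain\<close>

lemma finite_chain_has_greatest:
  assumes "finite P" "P \<noteq> {}" "P \<subseteq> carrier L" "\<forall>x\<in>P. \<forall>y\<in>P. x \<sqsubseteq> y \<or> y \<sqsubseteq> x"
  shows "\<exists>p\<in>P. \<forall>x\<in>P. x \<sqsubseteq> p"
  using assms
proof (induction P rule: finite_ne_induct)
  case (singleton x)
  then show ?case by simp
next
  case (insert x P)
  then obtain p where p: "p \<in> P" "\<forall>x\<in>P. x \<sqsubseteq> p" by auto
  show ?case
  proof (cases "x \<sqsubseteq> p")
    case True
    with p show ?thesis by auto
  next
    case False
    then have "p \<sqsubseteq> x" using insert.prems p by auto
    then have "\<forall>z\<in>P. z \<sqsubseteq> x"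
      using p insert.prems by (meson insert_subset le_trans subsetD)
    then show ?thesis using insert.prems by auto
  qed
qed

text \<open>The number of jumps is a rank function: by modularity \<open>x\<close> can be recovered from its traces on
  a maximal chain, and the trace in each covering step has only two possible values.\<close>

definition jumps :: "'a set \<Rightarrow> 'a \<Rightarrow> 'a set" where
  "jumps C x = {c \<in> C - {\<bottom>}. \<forall>c'\<in>C. c' \<sqsubseteq> c \<and> c' \<noteq> c \<longrightarrow> \<not> x \<sqinter> c \<sqsubseteq> c'}"

lemma jumps_mono:
  assumes "x \<in> carrier L" "y \<in> carrier L" "x \<sqsubseteq> y" "C \<subseteq> carrier L"
  shows "jumps C x \<subseteq> jumps C y"
proof -
  have "x \<sqinter> c \<sqsubseteq> y \<sqinter> c" if "c \<in> C" for c
    using that assms by (auto intro: meet_mono)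
  then have "\<not> x \<sqinter> c \<sqsubseteq> c' \<Longrightarrow> \<not> y \<sqinter> c \<sqsubseteq> c'" if "c \<in> C" "c' \<in> C" for c c'
    using that assms le_trans[of "x \<sqinter> c" "y \<sqinter> c" c'] by (auto simp: subset_iff)
  then show ?thesis unfolding jumps_def by blast
qed

text \<open>The traces agree by induction along the chain. If \<open>c\<close> is no jump, both
  traces lie below the predecessor \<open>p\<close> of \<open>c\<close>; if it is one,
  \<open>c\<close> is the join of \<open>p\<close> with the trace of \<open>x\<close>, and
  modularity shows that the trace of \<open>y\<close> adds nothing.\<close>

lemma jumps_inj:
  assumes max: "pred_on.maxchain (carrier L) (le L) C" and fin: "finite C"
    and x: "x \<in> carrier L" and y: "y \<in> carrier L" and xy: "x \<sqsubseteq> y"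
    and eq: "jumps C x = jumps C y"
  shows "x = y"
proof -
  have chain: "C \<subseteq> carrier L" "\<And>c c'. c \<in> C \<Longrightarrow> c' \<in> C \<Longrightarrow> c \<sqsubseteq> c' \<or> c' \<sqsubseteq> c"
    using max le_refl unfolding pred_on.maxchain_def pred_on.chain_def by blast+
  \<comment> \<open>Maximality in usable form: an element comparable with all of \<open>C\<close>
    could be adjoined, so it already lies in \<open>C\<close>.\<close>
  have maximal: "z \<in> C" if z: "z \<in> carrier L" and "\<And>c. c \<in> C \<Longrightarrow> c \<sqsubseteq> z \<or> z \<sqsubseteq> c" for z
  proof (rule ccontr)
    assume "z \<notin> C"
    moreover have "pred_on.chain (carrier L) (le L) (insert z C)"
      unfolding pred_on.chain_def
    proof (intro conjI ballI)
      fix x y assume "x \<in> insert z C" "y \<in> insert z C"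
      then show "(le L)\<^sup>=\<^sup>= x y \<or> (le L)\<^sup>=\<^sup>= y x"
        using that(2)[of x] that(2)[of y] chain(2)[of x y] by blast
    qed (use z chain(1) in blast)
    ultimately show False using max unfolding pred_on.maxchain_def by blast
  qed
  have bot: "\<bottom> \<in> C" and top: "\<top> \<in> C"
    using maximal chain(1) by (auto dest: subsetD)
  have "x \<sqinter> c = y \<sqinter> c" if "c \<in> C" for c
    using that
  proof (induction "card {c' \<in> C. c' \<sqsubseteq> c \<and> c' \<noteq> c}" arbitrary: c rule: less_induct)
    case less
    have c: "c \<in> carrier L" using less.prems chain by blast
    show ?case
    proof (cases "c = \<bottom>")
      case True
      then show ?thesis using x y by (simp add: meet_units)
    next
      case False
      let ?P = "{c' \<in> C. c' \<sqsubseteq> c \<and> c' \<noteq> c}"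
      have "\<exists>p\<in>?P. \<forall>c'\<in>?P. c' \<sqsubseteq> p"
      proof (rule finite_chain_has_greatest)
        show "?P \<noteq> {}" using bot False c by auto
      qed (use fin chain in auto)
      then obtain p where p: "p \<in> C" "p \<sqsubseteq> c" "p \<noteq> c"
        and pmax: "\<And>c'. c' \<in> C \<Longrightarrow> c' \<sqsubseteq> c \<Longrightarrow> c' \<noteq> c \<Longrightarrow> c' \<sqsubseteq> p" by blast
      have pC: "p \<in> carrier L" using p chain by blast
      \<comment> \<open>\<open>p\<close> is the predecessor of \<open>c\<close> in the chain; an
        element strictly between them would be comparable with every chain member.\<close>
      have cover: "z = p \<or> z = c" if z: "z \<in> carrier L" "p \<sqsubseteq> z" "z \<sqsubseteq> c" for z
      proof -
        have "c' \<sqsubseteq> z \<or> z \<sqsubseteq> c'" if c': "c' \<in> C" for c'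
        proof (cases "c' \<sqsubseteq> c \<and> c' \<noteq> c")
          case True
          then show ?thesis using pmax[OF c'] z pC c' chain(1) le_trans by blast
        next
          case False
          then have "c \<sqsubseteq> c'" using chain(2)[OF c' less.prems] c by auto
          then show ?thesis using z c c' chain(1) le_trans by blast
        qed
        then have "z \<in> C" using maximal z by blast
        then show ?thesis using pmax[of z] z pC le_antisym by blast
      qed
      have "{c' \<in> C. c' \<sqsubseteq> p \<and> c' \<noteq> p} \<subset> ?P"
        using p pC c chain(1) by (auto dest: le_trans le_antisym)
      then have IH: "x \<sqinter> p = y \<sqinter> p"
        using less.hyps[of p] p(1) fin by (simp add: psubset_card_mono)
      have below: "u \<sqinter> c = u \<sqinter> p" if u: "u \<in> carrier L" "u \<sqinter> c \<sqsubseteq> p" for u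
        by (rule le_antisym) (use u c pC p in \<open>auto simp: le_meet_iff intro: meet_left le_trans[OF meet_right]\<close>)
      have jump_iff: "c \<in> jumps C u \<longleftrightarrow> \<not> u \<sqinter> c \<sqsubseteq> p" if u: "u \<in> carrier L" for u
        unfolding jumps_def using u c pC p pmax less.prems False chain(1)
        by (auto dest: le_trans[OF _ pmax])
      show ?thesis
      proof (cases "x \<sqinter> c \<sqsubseteq> p")
        case True
        then have "y \<sqinter> c \<sqsubseteq> p" using jump_iff x y eq by blast
        then show ?thesis using True below x y IH by simp
      next
        case False
        have xc: "x \<sqinter> c \<in> carrier L" and yc: "y \<sqinter> c \<in> carrier L" using x y c by auto
        have "p \<squnion> (x \<sqinter> c) \<noteq> p" using False pC xc by (metis join_right)
        moreover have "p \<squnion> (x \<sqinter> c) \<sqsubseteq> c" using p pC xc x c by (simp add: join_le_iff meet_right)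
        ultimately have j: "p \<squnion> (x \<sqinter> c) = c"
          using cover[of "p \<squnion> (x \<sqinter> c)"] pC xc join_left by auto
        \<comment> \<open>This is the order hypothesis of the modular law; what remains afterwards
          is a meet with \<open>p\<close>, settled by the induction hypothesis.\<close>
        have le: "x \<sqinter> c \<sqsubseteq> y \<sqinter> c" using x y c xy by (simp add: meet_mono)
        have "y \<sqinter> c = c \<sqinter> (y \<sqinter> c)"
          using meet_right[OF c yc] meet_right[OF y c] le_meet_iff[OF c yc yc] y c yc
          by (intro le_antisym) simp_all
        also have "\<dots> = ((x \<sqinter> c) \<squnion> p) \<sqinter> (y \<sqinter> c)"
          using j by (simp add: join_comm)
        also have "\<dots> = (x \<sqinter> c) \<squnion> (p \<sqinter> (y \<sqinter> c))"
          using modular[OF xc pC yc le] by simp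
        also have "\<dots> = x \<sqinter> c"
        proof -
          have "p \<sqinter> (y \<sqinter> c) \<sqsubseteq> y \<sqinter> p"
            using pC y c yc le_trans[OF meet_right[OF pC yc] meet_left[OF y c]]
            by (simp add: le_meet_iff meet_left)
          then have "p \<sqinter> (y \<sqinter> c) \<sqsubseteq> x \<sqinter> p" by (simp add: IH)
          moreover have "x \<sqinter> p \<sqsubseteq> x \<sqinter> c" using pC x c p by (simp add: meet_mono)
          ultimately have "p \<sqinter> (y \<sqinter> c) \<sqsubseteq> x \<sqinter> c"
            using le_trans[of "p \<sqinter> (y \<sqinter> c)" "x \<sqinter> p" "x \<sqinter> c"] pC x yc c by simp
          then have "(x \<sqinter> c) \<squnion> (p \<sqinter> (y \<sqinter> c)) \<sqsubseteq> x \<sqinter> c"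
            using pC xc yc by (simp add: join_le_iff)
          then show ?thesis using pC xc yc by (simp add: le_antisym join_left)
        qed
        finally show ?thesis by simp
      qed
    qed
  qed
  then have "x \<sqinter> \<top> = y \<sqinter> \<top>" using top by blast
  then show ?thesis using x y by (simp add: meet_units)
qed

text \<open>The chain has \<open>d + 1\<close> members, but \<open>\<bottom>\<close> never counts as
  a jump, hence the bound \<open>d\<close>. The counting arguments below use the height only through
  this rank.\<close>

lemma has_height_rank:
  assumes "has_height L d"
  obtains r :: "'a \<Rightarrow> nat" where
    "\<And>x. x \<in> carrier L \<Longrightarrow> r x \<le> d"
    "\<And>x y. \<lbrakk>x \<in> carrier L; y \<in> carrier L; x \<sqsubseteq> y; x \<noteq> y\<rbrakk> \<Longrightarrow> r x < r y"
proof -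
  obtain C where C: "pred_on.maxchain (carrier L) (le L) C" "finite C" "card C = d + 1"
    using assms unfolding has_height_def by blast
  have sub: "C \<subseteq> carrier L" using C unfolding pred_on.maxchain_def pred_on.chain_def by blast
  have bot: "\<bottom> \<in> C"
  proof (rule ccontr)
    assume "\<bottom> \<notin> C"
    moreover have "pred_on.chain (carrier L) (le L) (insert \<bottom> C)"
      using C sub unfolding pred_on.maxchain_def pred_on.chain_def by (auto dest: subsetD)
    ultimately show False using C unfolding pred_on.maxchain_def by blast
  qed
  have J: "jumps C x \<subseteq> C - {\<bottom>}" for x unfolding jumps_def by blast
  show ?thesis
  proof (rule that[of "\<lambda>x. card (jumps C x)"])
    fix x assume "x \<in> carrier L"
    have "card (jumps C x) \<le> card (C - {\<bottom>})" using J C by (intro card_mono) auto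
    then show "card (jumps C x) \<le> d" using C bot by simp
  next
    fix x y assume xy: "x \<in> carrier L" "y \<in> carrier L" "x \<sqsubseteq> y" "x \<noteq> y"
    then have "jumps C x \<subset> jumps C y"
      using jumps_mono[OF xy(1-3) sub] jumps_inj[OF C(1,2) xy(1-3)] by blast
    then show "card (jumps C x) < card (jumps C y)"
      using finite_subset[OF J] C by (intro psubset_card_mono) auto
  qed
qed

section \<open>Orthogonal families and diamonds\<close>

definition orthogonal_family :: "nat set \<Rightarrow> (nat \<Rightarrow> 'a) \<Rightarrow> bool" where
  "orthogonal_family I a \<longleftrightarrow>
     (\<forall>i\<in>I. a i \<in> carrier L \<and> a i \<noteq> \<bottom>) \<and> (\<forall>i\<in>I. \<forall>j\<in>I. i \<noteq> j \<longrightarrow> a i \<sqsubseteq> ocompl L (a j))"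

text \<open>Joining the members one at a time yields a strictly increasing chain, because each new member
  is orthogonal to the join so far.\<close>

lemma orthogonal_family_rank:
  fixes r :: "'a \<Rightarrow> nat"
  assumes r: "\<And>x y. \<lbrakk>x \<in> carrier L; y \<in> carrier L; x \<sqsubseteq> y; x \<noteq> y\<rbrakk> \<Longrightarrow> r x < r y"
    and b: "b \<in> carrier L"
  shows "\<lbrakk>finite I; orthogonal_family I a; \<forall>i\<in>I. b \<sqsubseteq> ocompl L (a i)\<rbrakk> \<Longrightarrow>
    \<exists>z\<in>carrier L. r b + card I \<le> r z \<and>
      (\<forall>w\<in>carrier L. b \<sqsubseteq> w \<longrightarrow> (\<forall>i\<in>I. a i \<sqsubseteq> w) \<longrightarrow> z \<sqsubseteq> w)"
proof (induction I rule: finite_induct)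
  case empty
  then show ?case using b by auto
next
  case (insert k I)
  have ak: "a k \<in> carrier L" "a k \<noteq> \<bottom>" using insert.prems unfolding orthogonal_family_def by auto
  obtain z where z: "z \<in> carrier L" "r b + card I \<le> r z"
    and least: "\<And>w. \<lbrakk>w\<in>carrier L; b \<sqsubseteq> w; \<forall>i\<in>I. a i \<sqsubseteq> w\<rbrakk> \<Longrightarrow> z \<sqsubseteq> w"
    using insert unfolding orthogonal_family_def by auto
  \<comment> \<open>\<open>z\<close> is the join so far, known only through its minimality; testing
    that with the complement of \<open>a k\<close> gives orthogonality.\<close>
  have "z \<sqsubseteq> ocompl L (a k)"
    using insert.prems insert.hyps ocompl_closed[OF ak(1)] unfolding orthogonal_family_def
    by (intro least) auto
  then have "\<not> a k \<sqsubseteq> z"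
    using le_and_ocompl_imp_bottom[of "a k" z] ak z le_ocompl_iff by blast
  then have "z \<squnion> a k \<noteq> z" using z ak by (metis join_right)
  then have "r z < r (z \<squnion> a k)" using z ak by (intro r) (auto intro: join_left)
  moreover have "z \<squnion> a k \<sqsubseteq> w" if "w\<in>carrier L" "b \<sqsubseteq> w" "\<forall>i\<in>insert k I. a i \<sqsubseteq> w" for w
    using that z ak least by (simp add: join_le_iff)
  ultimately show ?case
    using z ak insert.hyps by (intro bexI[of _ "z \<squnion> a k"]) auto
qed

text \<open>Something strictly between \<open>\<bottom>\<close> and \<open>a i\<close> would give
  \<open>a i\<close> rank at least 2, and joining the other \<open>d - 1\<close> members to it would
  exceed the bound \<open>d\<close>.\<close>

lemma orthogonal_family_atom:
  assumes h: "has_height L d" and a: "orthogonal_family {1..d} a"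
    and i: "i \<in> {1..d}" and b: "b \<in> carrier L" "b \<sqsubseteq> a i"
  shows "b = \<bottom> \<or> b = a i"
proof (rule ccontr)
  assume contra: "\<not> ?thesis"
  obtain r where r: "\<And>x. x \<in> carrier L \<Longrightarrow> r x \<le> d"
    "\<And>x y. \<lbrakk>x \<in> carrier L; y \<in> carrier L; x \<sqsubseteq> y; x \<noteq> y\<rbrakk> \<Longrightarrow> r x < r y"
    using has_height_rank[OF h] by blast
  have ai: "a i \<in> carrier L" using a i unfolding orthogonal_family_def by auto
  have "r \<bottom> < r b" "r b < r (a i)" using b contra r ai by auto
  then have 2: "2 \<le> r (a i)" by simp
  have "orthogonal_family ({1..d} - {i}) a" "\<forall>j\<in>{1..d} - {i}. a i \<sqsubseteq> ocompl L (a j)"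
    using a i unfolding orthogonal_family_def by auto
  then obtain z where "z \<in> carrier L" "r (a i) + card ({1..d} - {i}) \<le> r z"
    using orthogonal_family_rank[of r "a i" "{1..d} - {i}" a] r ai by auto
  then show False using r(1)[of z] 2 i by simp
qed

text \<open>The join of all members already has rank at least \<open>d\<close>; if it lay below some
  \<open>z\<close> other than \<open>\<top>\<close>, the rank of \<open>\<top>\<close> would exceed
  \<open>d\<close>.\<close>

lemma orthogonal_family_spans:
  assumes h: "has_height L d" and a: "orthogonal_family {1..d} a"
    and z: "z \<in> carrier L" "\<forall>i\<in>{1..d}. a i \<sqsubseteq> z"
  shows "z = \<top>"
proof (rule ccontr)
  assume contra: "z \<noteq> \<top>"
  obtain r where r: "\<And>x. x \<in> carrier L \<Longrightarrow> r x \<le> d"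
    "\<And>x y. \<lbrakk>x \<in> carrier L; y \<in> carrier L; x \<sqsubseteq> y; x \<noteq> y\<rbrakk> \<Longrightarrow> r x < r y"
    using has_height_rank[OF h] by blast
  have "\<forall>j\<in>{1..d}. \<bottom> \<sqsubseteq> ocompl L (a j)"
    using a unfolding orthogonal_family_def by (auto intro: ocompl_closed)
  then obtain u where u: "u \<in> carrier L" "r \<bottom> + card {1..d} \<le> r u" "u \<sqsubseteq> z"
    using orthogonal_family_rank[of r "\<bottom>" "{1..d}" a] r(2) a z by auto
  have "r u \<le> r z" using r(2)[of u z] u z by (cases "u = z") auto
  moreover have "r z < r \<top>" using r(2) z contra by auto
  ultimately show False using r(1)[of \<top>] u by simp
qed

lemma top_neq_bottom:
  assumes "has_height L d" "d \<ge> 1"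
  shows "\<top> \<noteq> \<bottom>"
proof
  assume "\<top> = \<bottom>"
  then have 1: "x = \<bottom>" if "x \<in> carrier L" for x
    using that by (metis le_bottom_iff top_higher)
  obtain C where C: "C \<subseteq> carrier L" "card C = d + 1"
    using assms unfolding has_height_def pred_on.maxchain_def pred_on.chain_def by blast
  then have "C \<subseteq> {\<bottom>}" using 1 by blast
  then have "card C \<le> 1" using card_mono[of "{\<bottom>}" C] by simp
  then show False using C assms by simp
qed

text \<open>Trades the spanning clause for non-vanishing of the members. A member equal to
  \<open>\<bottom>\<close> would make \<open>a 0 = \<top>\<close>, hence all members and their join
  \<open>\<bottom>\<close>; conversely, \<open>d\<close> non-zero orthogonal members span by
  rank.\<close>

lemma orthogonal_diamond_iff:
  assumes d: "d \<ge> 1" and h: "has_height L d"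
  shows "orthogonal_diamond L d a \<longleftrightarrow>
    a 0 \<in> carrier L \<and> orthogonal_family {1..d} a \<and>
    (\<forall>i\<in>{1..d}. a 0 \<sqinter> a i = \<bottom> \<and> a 0 \<squnion> a i = \<top>)" (is "?l \<longleftrightarrow> ?r")
proof
  assume l: ?l
  then have closed: "\<And>i. i \<le> d \<Longrightarrow> a i \<in> carrier L"
    and ortho: "\<And>i j. \<lbrakk>i \<in> {1..d}; j \<in> {1..d}; i \<noteq> j\<rbrakk> \<Longrightarrow> a i \<sqsubseteq> ocompl L (a j)"
    and compl: "\<And>i. i \<in> {1..d} \<Longrightarrow> a 0 \<sqinter> a i = \<bottom> \<and> a 0 \<squnion> a i = \<top>"
    and span: "\<Squnion>(a ` {1..d}) = \<top>"
    unfolding orthogonal_diamond_def by auto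
  have "a i \<noteq> \<bottom>" if i: "i \<in> {1..d}" for i
  proof
    assume "a i = \<bottom>"
    then have "a 0 = \<top>" using compl[OF i] closed[of 0] by (simp add: join_units)
    then have "a j = \<bottom>" if "j \<in> {1..d}" for j
      using compl[OF that] closed[of j] that \<open>a 0 = \<top>\<close> by (simp add: meet_units)
    then have "a ` {1..d} = {\<bottom>}" using i by auto
    then have "least L \<top> (Upper L {\<bottom>})"
      using finite_sup_least[of "{\<bottom>}"] span by simp
    then have "\<top> \<sqsubseteq> \<bottom>" by (rule least_le) (auto intro: Upper_memI)
    then have "\<top> = \<bottom>" by (simp add: le_bottom_iff)
    then show False using top_neq_bottom[OF h d] by simp
  qed
  then show ?r using closed ortho compl unfolding orthogonal_family_def by auto
next
  assume r: ?r
  then have closed: "\<And>i. i \<le> d \<Longrightarrow> a i \<in> carrier L"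
    unfolding orthogonal_family_def by (metis Suc_leI atLeastAtMost_iff not_gr0 One_nat_def)
  have "least L (\<Squnion>(a ` {1..d})) (Upper L (a ` {1..d}))"
    using closed d by (intro finite_sup_least) auto
  moreover have "a ` {1..d} \<subseteq> carrier L" using closed by auto
  ultimately have "\<Squnion>(a ` {1..d}) = \<top>"
    using r by (intro orthogonal_family_spans[OF h]) (auto dest: least_Upper_above)
  then show ?l using r closed unfolding orthogonal_diamond_def orthogonal_family_def by auto
qed

lemma orthogonal_familyD:
  assumes "orthogonal_family I a"
  shows "\<And>i. i \<in> I \<Longrightarrow> a i \<in> carrier L" "\<And>i. i \<in> I \<Longrightarrow> a i \<noteq> \<bottom>"
    "\<And>i j. \<lbrakk>i \<in> I; j \<in> I; i \<noteq> j\<rbrakk> \<Longrightarrow> a i \<sqsubseteq> ocompl L (a j)"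
  using assms unfolding orthogonal_family_def by auto

section \<open>Values of the terms \<open>h_tilde\<close> and \<open>g_tilde\<close>\<close>

lemma oeval_closed: "\<forall>v. \<rho> v \<in> carrier L \<Longrightarrow> oeval L \<rho> t \<in> carrier L"
  by (induction t) (auto intro: ocompl_closed)

lemma le_Meets_iff:
  assumes "\<forall>v. \<rho> v \<in> carrier L" "z \<in> carrier L"
  shows "z \<sqsubseteq> oeval L \<rho> (Meets ts) \<longleftrightarrow> (\<forall>t\<in>set ts. z \<sqsubseteq> oeval L \<rho> t)"
  unfolding Meets_def using assms(2) oeval_closed[OF assms(1)]
  by (induction ts) (auto simp: le_meet_iff)

lemma Joins_le_iff:
  assumes "\<forall>v. \<rho> v \<in> carrier L" "z \<in> carrier L"
  shows "oeval L \<rho> (Joins ts) \<sqsubseteq> z \<longleftrightarrow> (\<forall>t\<in>set ts. oeval L \<rho> t \<sqsubseteq> z)"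
  unfolding Joins_def using assms(2) oeval_closed[OF assms(1)]
  by (induction ts) (auto simp: join_le_iff)

lemma le_ortho_part_iff:
  assumes "\<forall>v. \<rho> v \<in> carrier L" "z \<in> carrier L"
  shows "z \<sqsubseteq> oeval L \<rho> (ortho_part d y i) \<longleftrightarrow>
    z \<sqsubseteq> oeval L \<rho> (y i) \<and> (\<forall>j\<in>{1..d} - {i}. z \<sqsubseteq> ocompl L (oeval L \<rho> (y j)))"
  unfolding ortho_part_def using assms oeval_closed[OF assms(1)]
  by (auto simp: le_meet_iff le_Meets_iff simp del: upt_Suc)

text \<open>A non-zero element is not below every \<open>\<not>a\<^sub>i\<close>, and
  perspectivity through \<open>a\<^sub>0\<close> moves a single atom \<open>a\<^sub>i\<close> to all others.\<close>

lemma oeval_h_tilde_top: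
  assumes d: "d \<ge> 1" and h: "has_height L d" and diamond: "orthogonal_diamond L d a"
    and \<rho>: "\<forall>v. \<rho> v \<in> carrier L" and y: "\<And>i. i \<le> d \<Longrightarrow> oeval L \<rho> (y i) = a i"
    and x: "oeval L \<rho> x \<noteq> \<bottom>"
  shows "oeval L \<rho> (h_tilde d x y) = \<top>"
proof -
  let ?e = "oeval L \<rho>"
  have a0: "a 0 \<in> carrier L" and fam: "orthogonal_family {1..d} a"
    and compl: "\<And>i. i \<in> {1..d} \<Longrightarrow> a 0 \<sqinter> a i = \<bottom> \<and> a 0 \<squnion> a i = \<top>"
    using diamond unfolding orthogonal_diamond_iff[OF d h] by auto
  note fam' = orthogonal_familyD[OF fam]
  note [simp] = oeval_closed[OF \<rho>]
  have span: "z = \<top>" if "z \<in> carrier L" "\<forall>i\<in>{1..d}. a i \<sqsubseteq> z" for z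
    using orthogonal_family_spans[OF h fam] that by blast
  have "?e (Joins (map (ortho_part d y) [1..<d + 1])) = \<top>" (is "?J = _")
  proof (rule span)
    show "\<forall>i\<in>{1..d}. a i \<sqsubseteq> ?J"
    proof
      fix i assume i: "i \<in> {1..d}"
      then have "a i \<sqsubseteq> ?e (ortho_part d y i)"
        using fam'(1,3) y le_ortho_part_iff[OF \<rho>] by auto
      moreover have "\<forall>t\<in>set (map (ortho_part d y) [1..<d + 1]). ?e t \<sqsubseteq> ?J"
        using iffD1[OF Joins_le_iff[OF \<rho>] le_refl] oeval_closed[OF \<rho>] by blast
      ultimately show "a i \<sqsubseteq> ?J" using i fam'(1)
        by (auto intro!: le_trans[of "a i" "?e (ortho_part d y i)"] simp del: upt_Suc)
    qed
  qed simp
  moreover have "\<top> \<sqsubseteq> ?e (Meets [Meet (Join (y 0) (y i)) (Join (Neg (y 0)) (Neg (y i))). i \<leftarrow> [1..<d+1]])"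
    using y compl a0 fam'(1)
    by (auto simp: le_Meets_iff[OF \<rho>] le_meet_iff meet_bottom_imp ocompl_closed simp del: upt_Suc)
  moreover have "?e (h_hat d x y) = \<top>" (is "?H = _")
  proof (rule span)
    have Hle: "\<forall>i\<in>{1..d}. \<forall>j\<in>{1..d}. ((?e x \<squnion> ocompl L (a i)) \<sqinter> a i \<squnion> a 0) \<sqinter> a j \<sqsubseteq> ?H"
      using Joins_le_iff[OF \<rho>, of ?H "[Meet (Join (Meet (Join x (Neg (y i))) (y i)) (y 0)) (y j).
              i \<leftarrow> [1..<d+1], j \<leftarrow> [1..<d+1]]"] y
      unfolding h_hat_def[symmetric] by (auto simp del: upt_Suc)
    \<comment> \<open>Otherwise all \<open>a i\<close> lie below the complement of the value of
      \<open>x\<close>, which would then be \<open>\<top>\<close>.\<close>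
    have "\<exists>i\<in>{1..d}. \<not> ?e x \<sqsubseteq> ocompl L (a i)"
    proof (rule ccontr)
      assume "\<not> ?thesis"
      then have "\<forall>i\<in>{1..d}. a i \<sqsubseteq> ocompl L (?e x)"
        using fam'(1) le_ocompl_iff by auto
      then have "ocompl L (?e x) = \<top>" by (intro span) (auto intro: ocompl_closed)
      then show False using x ocompl_involution[of "?e x"] ocompl_top by simp
    qed
    then obtain i where i: "i \<in> {1..d}" "\<not> ?e x \<sqsubseteq> ocompl L (a i)" by blast
    \<comment> \<open>The complement of \<open>?q\<close> is the part of \<open>a i\<close>
      orthogonal to \<open>x\<close>. It is not all of the atom \<open>a i\<close>, so it vanishes,
      and the disjunct built from \<open>i\<close> starts with the whole of
      \<open>a i\<close>.\<close>
    let ?q = "?e x \<squnion> ocompl L (a i)"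
    have q: "?q \<in> carrier L" using fam'(1)[OF i(1)] by (simp add: ocompl_closed)
    have ai: "a i \<in> carrier L" "ocompl L (a i) \<in> carrier L"
      using fam'(1)[OF i(1)] by (simp_all add: ocompl_closed)
    have "ocompl L (a i) \<sqsubseteq> ?q" using ai by (simp add: join_right)
    then have "ocompl L ?q \<sqsubseteq> a i"
      using ocompl_antitone[OF ai(2) q] ocompl_involution[OF ai(1)] by simp
    moreover have "ocompl L ?q \<noteq> a i"
    proof
      assume "ocompl L ?q = a i"
      then have "?q = ocompl L (a i)" using ocompl_involution[OF q] by simp
      then show False using i(2) join_left[of "?e x" "ocompl L (a i)"] ai by simp
    qed
    ultimately have "ocompl L ?q = \<bottom>"
      using orthogonal_family_atom[OF h fam i(1)] q ocompl_closed by blast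
    then have "?q = \<top>" using q ocompl_involution[of ?q] ocompl_bottom by simp
    then have "?q \<sqinter> a i = a i" using fam'(1)[OF i(1)] by (simp add: meet_units)
    then have 1: "?q \<sqinter> a i \<squnion> a 0 = \<top>" using compl[OF i(1)] by (simp add: join_comm)
    show "\<forall>j\<in>{1..d}. a j \<sqsubseteq> ?H"
    proof
      fix j assume j: "j \<in> {1..d}"
      have "\<top> \<sqinter> a j = a j" using fam'(1)[OF j] by (simp add: meet_units)
      then show "a j \<sqsubseteq> ?H" using Hle[rule_format, OF i(1) j] 1 by simp
    qed
  qed simp
  ultimately show ?thesis
    unfolding h_tilde_def h_term_def by (simp add: top_le_iff meet_units del: upt_Suc)
qed

text \<open>If \<open>x\<close> has value \<open>\<bottom>\<close>, each disjunct of
  \<open>h_hat\<close> collapses to the meet of \<open>y 0\<close> and \<open>y j\<close>, and the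
  value 1 of \<open>h_term\<close> makes that meet \<open>\<bottom>\<close>. A join of zeros is not
  \<open>\<top>\<close>.\<close>

lemma oeval_h_tilde_top_imp:
  assumes nontrivial: "\<top> \<noteq> \<bottom>" and \<rho>: "\<forall>v. \<rho> v \<in> carrier L"
    and top: "oeval L \<rho> (h_tilde d x y) = \<top>"
  shows "oeval L \<rho> x \<noteq> \<bottom>"
proof
  let ?e = "oeval L \<rho>"
  assume x: "?e x = \<bottom>"
  note [simp] = oeval_closed[OF \<rho>] ocompl_closed
  have "\<top> \<sqsubseteq> ?e (h_tilde d x y)" by (simp add: top)
  then have M: "\<top> \<sqsubseteq> ?e (Meets [Meet (Join (y 0) (y i)) (Join (Neg (y 0)) (Neg (y i))). i \<leftarrow> [1..<d+1]])"
    and H: "\<top> \<sqsubseteq> ?e (h_hat d x y)"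
    unfolding h_tilde_def h_term_def by (simp_all add: le_meet_iff)
  have disj: "?e (y 0) \<sqinter> ?e (y j) = \<bottom>" if "j \<in> {1..d}" for j
  proof -
    have "\<top> \<sqsubseteq> ocompl L (?e (y 0)) \<squnion> ocompl L (?e (y j))"
      using M that by (auto simp: le_Meets_iff[OF \<rho>] le_meet_iff simp del: upt_Suc)
    then show ?thesis by (intro join_ocompl_top_imp) (simp_all add: top_le_iff)
  qed
  have "((\<bottom> \<squnion> ocompl L (?e (y i))) \<sqinter> ?e (y i) \<squnion> ?e (y 0)) \<sqinter> ?e (y j) \<sqsubseteq> \<bottom>"
    if "j \<in> {1..d}" for i j
  proof -
    have "\<bottom> \<squnion> ocompl L (?e (y i)) = ocompl L (?e (y i))"
      by (simp add: join_units)
    then have "(\<bottom> \<squnion> ocompl L (?e (y i))) \<sqinter> ?e (y i) = \<bottom>"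
      by (metis meet_comm meet_ocompl oeval_closed[OF \<rho>])
    moreover have "\<bottom> \<squnion> ?e (y 0) = ?e (y 0)"
      by (simp add: join_units)
    ultimately show ?thesis using disj[OF that] by simp
  qed
  then have "?e (h_hat d x y) \<sqsubseteq> \<bottom>"
    unfolding h_hat_def by (auto simp: Joins_le_iff[OF \<rho>] x simp del: upt_Suc)
  then show False using H nontrivial by (simp add: top_le_iff le_bottom_iff)
qed

text \<open>On the diamond all conjuncts other than \<open>Neg (y 0)\<close> evaluate to
  \<open>\<top>\<close>, so the value is at least the complement of \<open>a 0\<close>; this is
  non-zero because \<open>a 0 = \<top>\<close> would force \<open>a 1 = \<bottom>\<close>.\<close>

lemma oeval_g_tilde_neq_bottom:
  assumes d: "d \<ge> 1" and h: "has_height L d" and diamond: "orthogonal_diamond L d a"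
    and \<rho>: "\<forall>v. \<rho> v \<in> carrier L" and y: "\<And>i. i \<le> d \<Longrightarrow> oeval L \<rho> (y i) = a i"
    and x: "oeval L \<rho> x = \<top>"
  shows "oeval L \<rho> (g_tilde d x y) \<noteq> \<bottom>"
proof -
  let ?e = "oeval L \<rho>"
  have a0: "a 0 \<in> carrier L" and fam: "orthogonal_family {1..d} a"
    and compl: "\<And>i. i \<in> {1..d} \<Longrightarrow> a 0 \<sqinter> a i = \<bottom> \<and> a 0 \<squnion> a i = \<top>"
    using diamond unfolding orthogonal_diamond_iff[OF d h] by auto
  note fam' = orthogonal_familyD[OF fam]
  note [simp] = oeval_closed[OF \<rho>] ocompl_closed
  have 1: "?e (Join (y 0) (ortho_part d y i)) = \<top>" if i: "i \<in> {1..d}" for i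
  proof -
    have "a i \<sqsubseteq> ?e (ortho_part d y i)"
      using fam'(1,3) i y by (auto simp: le_ortho_part_iff[OF \<rho>])
    then have "a 0 \<squnion> a i \<sqsubseteq> ?e (Join (y 0) (ortho_part d y i))"
      using i a0 fam'(1) y oeval_closed[OF \<rho>, of "ortho_part d y i"]
      by (auto simp: join_le_iff join_left intro: le_trans[OF _ join_right])
    then show ?thesis using compl[OF i] oeval_closed[OF \<rho>] by (metis top_le_iff)
  qed
  have 2: "?e (Join (y 0) (Meet x (y i))) = \<top>" if i: "i \<in> {1..d}" for i
  proof -
    have "\<top> \<sqinter> a i = a i" using fam'(1)[OF i] by (simp add: meet_units)
    then show ?thesis using i x y compl[OF i] by simp
  qed
  have "ocompl L (a 0) \<sqsubseteq> ?e (g_tilde d x y)"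
    unfolding g_tilde_def g_term_def using a0 y 1 2
    by (auto simp: le_meet_iff le_Meets_iff[OF \<rho>] simp del: oeval.simps(3) upt_Suc)
  moreover have "ocompl L (a 0) \<noteq> \<bottom>"
  proof
    assume "ocompl L (a 0) = \<bottom>"
    then have "a 0 = \<top>" by (metis a0 ocompl_bottom ocompl_involution)
    then have "a 1 = \<bottom>" using compl[of 1] d fam'(1)[of 1] by (simp add: meet_units)
    then show False using fam'(2)[of 1] d by simp
  qed
  ultimately show ?thesis using a0 by (metis le_bottom_iff ocompl_closed)
qed

lemma oeval_g_tilde_neq_bottom_imp:
  assumes h: "has_height L d" and \<rho>: "\<forall>v. \<rho> v \<in> carrier L"
    and neq: "oeval L \<rho> (g_tilde d x y) \<noteq> \<bottom>"
  shows "oeval L \<rho> x = \<top>"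
proof -
  let ?e = "oeval L \<rho>"
  define e c where "e = ?e (g_tilde d x y)" and "c = (\<lambda>i. ?e (ortho_part d y i))"
  note [simp] = oeval_closed[OF \<rho>] ocompl_closed
  have e: "e \<in> carrier L" "e \<noteq> \<bottom>" and c: "\<And>i. c i \<in> carrier L"
    using neq unfolding e_def c_def by simp_all
  have "e \<sqsubseteq> ?e (g_tilde d x y)" unfolding e_def by simp
  then have e0: "e \<sqsubseteq> ocompl L (?e (y 0))"
    and ec: "\<And>i. i \<in> {1..d} \<Longrightarrow> e \<sqsubseteq> ?e (y 0) \<squnion> c i"
    and ex: "\<And>i. i \<in> {1..d} \<Longrightarrow> e \<sqsubseteq> ?e (y 0) \<squnion> (?e x \<sqinter> ?e (y i))"
    unfolding g_tilde_def g_term_def using e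
    by (auto simp: le_meet_iff le_Meets_iff[OF \<rho>] c_def simp del: upt_Suc)
  \<comment> \<open>The coupling through \<open>y 0\<close>: \<open>e\<close> is non-zero and lies
    below the complement of \<open>y 0\<close>, so whatever is joined to \<open>y 0\<close> to get
    above \<open>e\<close> cannot vanish.\<close>
  have nonzero: "z \<noteq> \<bottom>" if "e \<sqsubseteq> ?e (y 0) \<squnion> z" for z
  proof
    assume "z = \<bottom>"
    then have "e \<sqsubseteq> ?e (y 0)"
      using that by (simp add: join_units)
    then show False using e e0 le_and_ocompl_imp_bottom by (metis oeval_closed[OF \<rho>])
  qed
  have cy: "c i \<sqsubseteq> ?e (y i)" and c_orth: "j \<in> {1..d} \<Longrightarrow> j \<noteq> i \<Longrightarrow> c i \<sqsubseteq> ocompl L (?e (y j))" for i j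
    using le_ortho_part_iff[OF \<rho> c[of i], of d y i] c[of i] unfolding c_def by auto
  have fam: "orthogonal_family {1..d} c"
    unfolding orthogonal_family_def
  proof (intro conjI ballI impI)
    fix i j assume ij: "i \<in> {1..d}" "j \<in> {1..d}" "i \<noteq> j"
    have "?e (y j) \<sqsubseteq> ocompl L (c i)"
      using c_orth[of j i] ij c le_ocompl_iff by simp
    then have "c j \<sqsubseteq> ocompl L (c i)" using cy[of j] c le_trans by (meson oeval_closed[OF \<rho>] ocompl_closed)
    then show "c i \<sqsubseteq> ocompl L (c j)" using c le_ocompl_iff by blast
  qed (use c nonzero ec in auto)
  show ?thesis
  proof (rule orthogonal_family_spans[OF h fam])
    show "\<forall>i\<in>{1..d}. c i \<sqsubseteq> ?e x"
    proof
      fix i assume i: "i \<in> {1..d}"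
      \<comment> \<open>The aim is \<open>y i = c i\<close>. Every \<open>c j\<close> lies below
        this join, so it is \<open>\<top>\<close>; meeting it with \<open>y i\<close> and applying
        the modular law to \<open>c i\<close> below \<open>y i\<close> gives the equality.\<close>
      have "c i \<squnion> ocompl L (?e (y i)) = \<top>"
      proof (rule orthogonal_family_spans[OF h fam])
        show "\<forall>j\<in>{1..d}. c j \<sqsubseteq> c i \<squnion> ocompl L (?e (y i))"
        proof
          fix j assume "j \<in> {1..d}"
          show "c j \<sqsubseteq> c i \<squnion> ocompl L (?e (y i))"
          proof (cases "j = i")
            case False
            then have "c j \<sqsubseteq> ocompl L (?e (y i))" using c_orth i by simp
            then show ?thesis using c by (auto intro: le_trans[OF _ join_right])
          qed (use c in \<open>simp add: join_left\<close>)
        qed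
      qed (use c in simp)
      then have "(c i \<squnion> ocompl L (?e (y i))) \<sqinter> ?e (y i) = ?e (y i)"
        by (simp add: meet_units)
      moreover have "(c i \<squnion> ocompl L (?e (y i))) \<sqinter> ?e (y i) = c i \<squnion> (ocompl L (?e (y i)) \<sqinter> ?e (y i))"
        using modular[OF c _ _ cy] by simp
      moreover have "ocompl L (?e (y i)) \<sqinter> ?e (y i) = \<bottom>"
        by (metis meet_comm meet_ocompl oeval_closed[OF \<rho>])
      moreover have "c i \<squnion> \<bottom> = c i"
        using c by (simp add: join_units)
      ultimately have yc: "?e (y i) = c i" by simp
      \<comment> \<open>\<open>ex\<close> speaks about \<open>y i\<close>; after the identification
        it concerns the atom \<open>c i\<close>, and a non-zero meet with an atom is the
        atom.\<close>
      have "?e x \<sqinter> c i \<noteq> \<bottom>" using nonzero[OF ex[OF i]] yc by simp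
      moreover have "?e x \<sqinter> c i \<sqsubseteq> c i" using c by (simp add: meet_right)
      ultimately have "?e x \<sqinter> c i = c i"
        using orthogonal_family_atom[OF h fam i, of "?e x \<sqinter> c i"] c by auto
      then show "c i \<sqsubseteq> ?e x" using c by (metis meet_left oeval_closed[OF \<rho>])
    qed
  qed simp
qed

end

section \<open>Assigning the diamond to fresh variables; the two equivalences\<close>

lemma oeval_cong: "(\<And>v. v \<in> vars t \<Longrightarrow> \<rho> v = \<rho>' v) \<Longrightarrow> oeval L \<rho> t = oeval L \<rho>' t"
  by (induction t) auto

text \<open>Overwrites a valuation by the diamond on the variables \<open>y i\<close>. Injectivity
  makes the index recoverable by \<open>the_inv_into\<close>, and freshness leaves the value of
  \<open>t\<close> unchanged.\<close>

lemma extend_valuation: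
  fixes y :: "nat \<Rightarrow> nat"
  assumes "inj_on y {0..d}" "y ` {0..d} \<inter> vars t = {}"
    and "\<forall>v. \<rho> v \<in> carrier L" "\<And>i. i \<le> d \<Longrightarrow> a i \<in> carrier L"
  obtains \<rho>' where "\<forall>v. \<rho>' v \<in> carrier L" "\<And>i. i \<le> d \<Longrightarrow> \<rho>' (y i) = a i"
    "oeval L \<rho>' t = oeval L \<rho> t"
proof
  define \<rho>' where "\<rho>' v = (if v \<in> y ` {0..d} then a (the_inv_into {0..d} y v) else \<rho> v)" for v
  show y: "\<rho>' (y i) = a i" if i: "i \<le> d" for i
  proof -
    have "i \<in> {0..d}" using i by simp
    then show ?thesis using the_inv_into_f_f[OF assms(1)] unfolding \<rho>'_def by simp
  qed
  show "\<forall>v. \<rho>' v \<in> carrier L"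
  proof
    fix v show "\<rho>' v \<in> carrier L"
    proof (cases "v \<in> y ` {0..d}")
      case True
      then show ?thesis using y assms(4) by auto
    next
      case False
      then show ?thesis using assms(3) unfolding \<rho>'_def by simp
    qed
  qed
  show "oeval L \<rho>' t = oeval L \<rho> t"
    by (rule oeval_cong) (use assms(2) in \<open>auto simp: \<rho>'_def\<close>)
qed

lemma satisfiability_equivalences:
  assumes d: "d \<ge> 1" and L: "modular_ortholattice L" and h: "has_height L d"
    and a: "orthogonal_diamond L d a"
    and y: "inj_on y {0..d}" "y ` {0..d} \<inter> vars t = {}"
  shows "weakly_satisfiable L t \<longleftrightarrow> strongly_satisfiable L (h_tilde d t (\<lambda>i. Var (y i)))"
    and "strongly_satisfiable L t \<longleftrightarrow> weakly_satisfiable L (g_tilde d t (\<lambda>i. Var (y i)))"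
proof -
  interpret modular_ortholattice L by fact
  have closed: "\<And>i. i \<le> d \<Longrightarrow> a i \<in> carrier L" using a unfolding orthogonal_diamond_def by blast
  note extend = extend_valuation[where a = a, OF y _ closed]
  note nontrivial = top_neq_bottom[OF h d]
  let ?y = "\<lambda>i. Var (y i)"
  show "weakly_satisfiable L t \<longleftrightarrow> strongly_satisfiable L (h_tilde d t ?y)"
  proof
    assume "weakly_satisfiable L t"
    then obtain \<rho> where \<rho>: "\<forall>v. \<rho> v \<in> carrier L" "oeval L \<rho> t \<noteq> \<bottom>\<^bsub>L\<^esub>"
      unfolding weakly_satisfiable_def by blast
    from extend[OF \<rho>(1)] obtain \<rho>' where \<rho>': "\<forall>v. \<rho>' v \<in> carrier L"
      "\<And>i. i \<le> d \<Longrightarrow> \<rho>' (y i) = a i" "oeval L \<rho>' t = oeval L \<rho> t" by blast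
    with \<rho>(2) have "oeval L \<rho>' (h_tilde d t ?y) = \<top>\<^bsub>L\<^esub>"
      by (intro oeval_h_tilde_top[OF d h a]) auto
    with \<rho>' show "strongly_satisfiable L (h_tilde d t ?y)"
      unfolding strongly_satisfiable_def by blast
  next
    assume "strongly_satisfiable L (h_tilde d t ?y)"
    then show "weakly_satisfiable L t"
      using oeval_h_tilde_top_imp[OF nontrivial]
      unfolding strongly_satisfiable_def weakly_satisfiable_def by blast
  qed
  show "strongly_satisfiable L t \<longleftrightarrow> weakly_satisfiable L (g_tilde d t ?y)"
  proof
    assume "strongly_satisfiable L t"
    then obtain \<rho> where \<rho>: "\<forall>v. \<rho> v \<in> carrier L" "oeval L \<rho> t = \<top>\<^bsub>L\<^esub>"
      unfolding strongly_satisfiable_def by blast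
    from extend[OF \<rho>(1)] obtain \<rho>' where \<rho>': "\<forall>v. \<rho>' v \<in> carrier L"
      "\<And>i. i \<le> d \<Longrightarrow> \<rho>' (y i) = a i" "oeval L \<rho>' t = oeval L \<rho> t" by blast
    with \<rho>(2) have "oeval L \<rho>' (g_tilde d t ?y) \<noteq> \<bottom>\<^bsub>L\<^esub>"
      by (intro oeval_g_tilde_neq_bottom[OF d h a]) auto
    with \<rho>' show "weakly_satisfiable L (g_tilde d t ?y)"
      unfolding weakly_satisfiable_def by blast
  next
    assume "weakly_satisfiable L (g_tilde d t ?y)"
    then show "strongly_satisfiable L t"
      using oeval_g_tilde_neq_bottom_imp[OF h]
      unfolding strongly_satisfiable_def weakly_satisfiable_def by blast
  qed
qed

section \<open>The subspace lattice of a unitary space\<close>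

context modular_ortholattice
begin

text \<open>The partial joins of the family form a chain of \<open>d + 1\<close> elements, and
  modularity makes each step a covering, so the chain cannot be refined. This supplies the height of
  the subspace lattice, where the atoms are lines.\<close>

lemma has_height_if_orthogonal_atoms:
  assumes fam: "orthogonal_family {1..d} a"
    and atom: "\<And>i b. \<lbrakk>i \<in> {1..d}; b \<in> carrier L; b \<sqsubseteq> a i\<rbrakk> \<Longrightarrow> b = \<bottom> \<or> b = a i"
    and span: "\<And>z. \<lbrakk>z \<in> carrier L; \<forall>i\<in>{1..d}. a i \<sqsubseteq> z\<rbrakk> \<Longrightarrow> z = \<top>"
  shows "has_height L d"
proof -
  note fam' = orthogonal_familyD[OF fam]
  define c where "c = rec_nat \<bottom> (\<lambda>k x. x \<squnion> a (Suc k))"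
  have c0: "c 0 = \<bottom>" and cSuc: "c (Suc k) = c k \<squnion> a (Suc k)" for k
    unfolding c_def by simp_all
  have aS: "a (Suc k) \<in> carrier L" if "k < d" for k using fam'(1)[of "Suc k"] that by simp
  have closed: "c k \<in> carrier L" if "k \<le> d" for k
    using that by (induction k) (auto simp: c0 cSuc aS)
  have orth: "c k \<sqsubseteq> ocompl L (a j)" if "k < j" "j \<le> d" for j k
    using that
  proof (induction k)
    case 0
    then show ?case using fam'(1)[of j] by (simp add: c0 ocompl_closed)
  next
    case (Suc k)
    then show ?case
      using fam'(1)[of j] fam'(3)[of "Suc k" j] closed[of k] aS[of k]
      by (simp add: cSuc join_le_iff ocompl_closed)
  qed
  have le_Suc: "c k \<sqsubseteq> c (Suc k)" "a (Suc k) \<sqsubseteq> c (Suc k)" if "k < d" for k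
    using closed[of k] aS[OF that] that by (simp_all add: cSuc join_left join_right)
  have mono: "c i \<sqsubseteq> c j" if "i \<le> j" "j \<le> d" for i j
    using that
  proof (induction j rule: dec_induct)
    case base
    then show ?case using closed by simp
  next
    case (step n)
    then show ?case using le_trans[of "c i" "c n" "c (Suc n)"] closed le_Suc by simp
  qed
  have neq: "c i \<noteq> c j" if "i < j" "j \<le> d" for i j
  proof
    assume eq: "c i = c j"
    have "a (Suc i) \<sqsubseteq> c j"
      using le_trans[OF le_Suc(2)[of i] mono[of "Suc i" j]] closed aS that by simp
    then have "a (Suc i) = \<bottom>"
      using le_and_ocompl_imp_bottom[of "a (Suc i)" "c i"] orth[of i "Suc i"] eq aS[of i] closed[of i]
        le_ocompl_iff[of "c i" "a (Suc i)"] that by simp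
    then show False using fam'(2)[of "Suc i"] that by simp
  qed
  have ctop: "c d = \<top>"
  proof (rule span)
    show "\<forall>i\<in>{1..d}. a i \<sqsubseteq> c d"
    proof
      fix i assume i: "i \<in> {1..d}"
      then obtain k where k: "i = Suc k" "k < d" by (cases i) auto
      then show "a i \<sqsubseteq> c d"
        using le_trans[OF le_Suc(2)[of k] mono[of "Suc k" d]] closed aS by simp
    qed
  qed (use closed in simp)
  have cover: "x = c k \<or> x = c (Suc k)"
    if x: "x \<in> carrier L" "c k \<sqsubseteq> x" "x \<sqsubseteq> c (Suc k)" and k: "k < d" for x k
  proof -
    \<comment> \<open>An intermediate \<open>x\<close> is \<open>c k\<close> joined with its trace
      on the atom \<open>a (Suc k)\<close>, and that trace is \<open>\<bottom>\<close> or the whole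
      atom.\<close>
    have "c k \<squnion> (a (Suc k) \<sqinter> x) = c (Suc k) \<sqinter> x"
      using modular[of "c k" "a (Suc k)" x] x k closed[of k] aS[OF k] by (simp add: cSuc)
    also have "\<dots> = x"
      using x k closed[of "Suc k"] by (intro le_antisym) (simp_all add: le_meet_iff meet_right)
    finally have eq: "c k \<squnion> (a (Suc k) \<sqinter> x) = x" .
    have "a (Suc k) \<sqinter> x = \<bottom> \<or> a (Suc k) \<sqinter> x = a (Suc k)"
      using atom[of "Suc k" "a (Suc k) \<sqinter> x"] x k aS[OF k] by (simp add: meet_left)
    then show ?thesis using eq closed[of k] k by (auto simp: join_units cSuc)
  qed
  have "pred_on.maxchain (carrier L) (le L) (c ` {0..d})"
    unfolding pred_on.maxchain_def
  proof (intro conjI notI)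
    show "pred_on.chain (carrier L) (le L) (c ` {0..d})"
      unfolding pred_on.chain_def
    proof (intro conjI ballI)
      fix x y assume "x \<in> c ` {0..d}" "y \<in> c ` {0..d}"
      then obtain i j where "i \<le> d" "j \<le> d" "x = c i" "y = c j" by auto
      then show "(le L)\<^sup>=\<^sup>= x y \<or> (le L)\<^sup>=\<^sup>= y x"
        using mono[of i j] mono[of j i] by (cases "i \<le> j") auto
    qed (use closed in auto)
  next
    assume "\<exists>S. pred_on.chain (carrier L) (le L) S \<and> c ` {0..d} \<subset> S"
    then obtain S x where S: "pred_on.chain (carrier L) (le L) S" "c ` {0..d} \<subseteq> S"
      and x: "x \<in> S" "x \<notin> c ` {0..d}" by blast
    have xL: "x \<in> carrier L" using S x unfolding pred_on.chain_def by blast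
    have comp: "c k \<sqsubseteq> x \<or> x \<sqsubseteq> c k" if "k \<le> d" for k
    proof -
      have "c k \<in> S" using S that by auto
      then have "(le L)\<^sup>=\<^sup>= (c k) x \<or> (le L)\<^sup>=\<^sup>= x (c k)"
        using S(1) x(1) unfolding pred_on.chain_def by blast
      then show ?thesis using xL by auto
    qed
    \<comment> \<open>A comparable \<open>x\<close> outside the chain climbs past every
      \<open>c k\<close>: lying below \<open>c (Suc k)\<close> would, by \<open>cover\<close>, place
      it in the chain.\<close>
    have "c k \<sqsubseteq> x" if "k \<le> d" for k
      using that
    proof (induction k)
      case 0
      then show ?case using xL by (simp add: c0)
    next
      case (Suc k)
      then show ?case using comp[of "Suc k"] cover[OF xL, of k] x(2) by auto
    qed
    from this[of d] have "x = c d" using ctop top_le_iff[OF xL] by simp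
    then show False using x by auto
  qed
  moreover have "inj_on c {0..d}"
    by (rule linorder_inj_onI) (use neq in auto)
  then have "card (c ` {0..d}) = d + 1" by (simp add: card_image)
  ultimately show ?thesis unfolding has_height_def by blast
qed

end

section \<open>Scalars, form and sums of subspaces\<close>

context unitary_space
begin

text \<open>Turns closure in the structure \<open>field_of F\<close> into closure under the ordinary
  complex operations. The quotient by zero is 0 and so also lies in \<open>F\<close>.\<close>

lemma scalar_closed:
  "\<lbrakk>a \<in> F; b \<in> F\<rbrakk> \<Longrightarrow> a + b \<in> F" "\<lbrakk>a \<in> F; b \<in> F\<rbrakk> \<Longrightarrow> a * b \<in> F"
  "a \<in> F \<Longrightarrow> - a \<in> F" "0 \<in> F" "1 \<in> F" "a \<in> F \<Longrightarrow> cnj a \<in> F"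
  "\<lbrakk>a \<in> F; b \<in> F\<rbrakk> \<Longrightarrow> a / b \<in> F"
proof -
  have simps: "a \<oplus>\<^bsub>complex_ring\<^esub> b = a + b" "a \<otimes>\<^bsub>complex_ring\<^esub> b = a * b"
    "\<zero>\<^bsub>complex_ring\<^esub> = 0" "\<one>\<^bsub>complex_ring\<^esub> = 1" for a b
    by (simp_all add: ring_of_type_algebra_def)
  show add: "a + b \<in> F" and mult: "a * b \<in> F" if "a \<in> F" "b \<in> F" for a b
    using that R.a_closed[of a b] R.m_closed[of a b] by (simp_all add: simps)
  show "0 \<in> F" "1 \<in> F" using R.zero_closed R.one_closed by (simp_all add: simps)
  show "- a \<in> F" if a: "a \<in> F" for a
  proof -
    obtain b where "b \<in> F" "b + a = 0"
      using a R.a_inv_closed[of a] R.l_neg[of a] by (auto simp: simps)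
    then have "b = - a" by (simp only: eq_neg_iff_add_eq_0)
    then show ?thesis using \<open>b \<in> F\<close> by simp
  qed
  show "cnj a \<in> F" if "a \<in> F" using that scalars unfolding star_subfield_def by blast
  show "a / b \<in> F" if a: "a \<in> F" and b: "b \<in> F" for a b
  proof (cases "b = 0")
    case False
    have "subfield F complex_ring" using scalars unfolding star_subfield_def by blast
    then have "Units (field_of F) = F - {0}"
      using subfield.subfield_Units by (fastforce simp: ring_of_type_algebra_def)
    then have "b \<in> Units (field_of F)" using b False by blast
    then obtain c where c: "c \<in> F" "c * b = 1" unfolding Units_def by (auto simp: simps)
    then have "c = 1 / b" using False by (simp add: field_simps)
    then show ?thesis using mult[OF a c(1)] by simp
  qed (use \<open>0 \<in> F\<close> in simp)
qed

lemma smult_laws: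
  "\<lbrakk>a \<in> F; b \<in> F; x \<in> carrier H\<rbrakk> \<Longrightarrow> (a + b) \<odot>\<^bsub>H\<^esub> x = a \<odot>\<^bsub>H\<^esub> x \<oplus>\<^bsub>H\<^esub> b \<odot>\<^bsub>H\<^esub> x"
  "\<lbrakk>a \<in> F; b \<in> F; x \<in> carrier H\<rbrakk> \<Longrightarrow> (a * b) \<odot>\<^bsub>H\<^esub> x = a \<odot>\<^bsub>H\<^esub> (b \<odot>\<^bsub>H\<^esub> x)"
  "x \<in> carrier H \<Longrightarrow> 1 \<odot>\<^bsub>H\<^esub> x = x" "x \<in> carrier H \<Longrightarrow> 0 \<odot>\<^bsub>H\<^esub> x = \<zero>\<^bsub>H\<^esub>"
  using smult_l_distr[of a b x] smult_assoc1[of a b x] smult_one[of x] smult_l_null[of x]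
  by (simp_all add: ring_of_type_algebra_def)

lemma vec_closed [simp]:
  "\<lbrakk>a \<in> F; x \<in> carrier H\<rbrakk> \<Longrightarrow> a \<odot>\<^bsub>H\<^esub> x \<in> carrier H"
  using smult_closed[of a x] by simp

lemma smult_add_right:
  "\<lbrakk>a \<in> F; x \<in> carrier H; y \<in> carrier H\<rbrakk> \<Longrightarrow> a \<odot>\<^bsub>H\<^esub> (x \<oplus>\<^bsub>H\<^esub> y) = a \<odot>\<^bsub>H\<^esub> x \<oplus>\<^bsub>H\<^esub> a \<odot>\<^bsub>H\<^esub> y"
  using smult_r_distr[of a x y] by simp

text \<open>Differences of vectors are written with the scalar \<open>- a\<close>, so this takes the
  place of a subtraction law in the later rearrangements.\<close>

lemma smult_cancel:
  assumes "a \<in> F" "x \<in> carrier H"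
  shows "a \<odot>\<^bsub>H\<^esub> x \<oplus>\<^bsub>H\<^esub> (- a) \<odot>\<^bsub>H\<^esub> x = \<zero>\<^bsub>H\<^esub>"
  using smult_laws(1)[of a "- a" x] smult_laws(4)[of x] assms scalar_closed(3) by simp

lemma form_zero_right: "x \<in> carrier H \<Longrightarrow> form H x \<zero>\<^bsub>H\<^esub> = 0"
  using form_smult_right[of 0 x x] smult_laws(4)[of x] scalar_closed(4) by simp

lemma form_left:
  "\<lbrakk>x \<in> carrier H; y \<in> carrier H; z \<in> carrier H\<rbrakk> \<Longrightarrow> form H (x \<oplus>\<^bsub>H\<^esub> y) z = form H x z + form H y z"
  "\<lbrakk>a \<in> F; x \<in> carrier H; z \<in> carrier H\<rbrakk> \<Longrightarrow> form H (a \<odot>\<^bsub>H\<^esub> x) z = cnj a * form H x z"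
  "z \<in> carrier H \<Longrightarrow> form H \<zero>\<^bsub>H\<^esub> z = 0"
proof -
  show "form H (x \<oplus>\<^bsub>H\<^esub> y) z = form H x z + form H y z"
    if "x \<in> carrier H" "y \<in> carrier H" "z \<in> carrier H"
    using form_hermitian[of z "x \<oplus>\<^bsub>H\<^esub> y"] form_hermitian[of z x] form_hermitian[of z y]
      form_add_right[of z x y] that by simp
  show "form H (a \<odot>\<^bsub>H\<^esub> x) z = cnj a * form H x z"
    if "a \<in> F" "x \<in> carrier H" "z \<in> carrier H"
    using form_hermitian[of z "a \<odot>\<^bsub>H\<^esub> x"] form_hermitian[of z x]
      form_smult_right[of a z x] that by simp
  show "form H \<zero>\<^bsub>H\<^esub> z = 0" if "z \<in> carrier H"
    using form_hermitian[of z "\<zero>\<^bsub>H\<^esub>"] form_zero_right[of z] that by simp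
qed

lemma form_eq_zero_commute:
  "\<lbrakk>x \<in> carrier H; y \<in> carrier H\<rbrakk> \<Longrightarrow> form H x y = 0 \<longleftrightarrow> form H y x = 0"
  using form_hermitian[of x y] by simp

lemma subspaceD:
  assumes "is_subspace F H W"
  shows "x \<in> W \<Longrightarrow> x \<in> carrier H" "\<zero>\<^bsub>H\<^esub> \<in> W" "\<lbrakk>x \<in> W; y \<in> W\<rbrakk> \<Longrightarrow> x \<oplus>\<^bsub>H\<^esub> y \<in> W"
    "\<lbrakk>a \<in> F; x \<in> W\<rbrakk> \<Longrightarrow> a \<odot>\<^bsub>H\<^esub> x \<in> W"
  using assms unfolding is_subspace_iff by blast+

lemma mem_sum_iff: "x \<in> V <+>\<^bsub>H\<^esub> W \<longleftrightarrow> (\<exists>v\<in>V. \<exists>w\<in>W. x = v \<oplus>\<^bsub>H\<^esub> w)"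
  by (auto simp: set_add_def set_mult_def)

text \<open>The last part is the universal property of the sum: it lets the sum serve as a join and
  reduces containments to the two summands.\<close>

lemma subspace_sum:
  assumes V: "is_subspace F H V" and W: "is_subspace F H W"
  shows "is_subspace F H (V <+>\<^bsub>H\<^esub> W)" "V \<subseteq> V <+>\<^bsub>H\<^esub> W" "W \<subseteq> V <+>\<^bsub>H\<^esub> W"
    "\<lbrakk>is_subspace F H U; V \<subseteq> U; W \<subseteq> U\<rbrakk> \<Longrightarrow> V <+>\<^bsub>H\<^esub> W \<subseteq> U"
proof -
  note V' = subspaceD[OF V] and W' = subspaceD[OF W]
  show "is_subspace F H (V <+>\<^bsub>H\<^esub> W)"
    unfolding is_subspace_iff
  proof (intro conjI ballI)
    show "V <+>\<^bsub>H\<^esub> W \<subseteq> carrier H" using V' W' by (auto simp: mem_sum_iff)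
    have "\<zero>\<^bsub>H\<^esub> = \<zero>\<^bsub>H\<^esub> \<oplus>\<^bsub>H\<^esub> \<zero>\<^bsub>H\<^esub>" by simp
    then show "\<zero>\<^bsub>H\<^esub> \<in> V <+>\<^bsub>H\<^esub> W" using V'(2) W'(2) unfolding mem_sum_iff by blast
  next
    fix x y assume "x \<in> V <+>\<^bsub>H\<^esub> W" "y \<in> V <+>\<^bsub>H\<^esub> W"
    then obtain v w v' w' where *: "v \<in> V" "w \<in> W" "v' \<in> V" "w' \<in> W"
      "x = v \<oplus>\<^bsub>H\<^esub> w" "y = v' \<oplus>\<^bsub>H\<^esub> w'" by (auto simp: mem_sum_iff)
    then have "x \<oplus>\<^bsub>H\<^esub> y = (v \<oplus>\<^bsub>H\<^esub> v') \<oplus>\<^bsub>H\<^esub> (w \<oplus>\<^bsub>H\<^esub> w')"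
      using V'(1) W'(1) by (simp add: M.a_ac)
    then show "x \<oplus>\<^bsub>H\<^esub> y \<in> V <+>\<^bsub>H\<^esub> W"
      using * V'(3) W'(3) unfolding mem_sum_iff by blast
  next
    fix a x assume a: "a \<in> F" and "x \<in> V <+>\<^bsub>H\<^esub> W"
    then obtain v w where *: "v \<in> V" "w \<in> W" "x = v \<oplus>\<^bsub>H\<^esub> w" by (auto simp: mem_sum_iff)
    then have "a \<odot>\<^bsub>H\<^esub> x = a \<odot>\<^bsub>H\<^esub> v \<oplus>\<^bsub>H\<^esub> a \<odot>\<^bsub>H\<^esub> w"
      using V'(1) W'(1) a by (simp add: smult_add_right)
    then show "a \<odot>\<^bsub>H\<^esub> x \<in> V <+>\<^bsub>H\<^esub> W"
      using * a V'(4) W'(4) unfolding mem_sum_iff by blast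
  qed
  show "V \<subseteq> V <+>\<^bsub>H\<^esub> W"
  proof
    fix v assume "v \<in> V"
    then show "v \<in> V <+>\<^bsub>H\<^esub> W"
      unfolding mem_sum_iff using V'(1) W'(2) M.r_zero[of v] by metis
  qed
  show "W \<subseteq> V <+>\<^bsub>H\<^esub> W"
  proof
    fix w assume "w \<in> W"
    then show "w \<in> V <+>\<^bsub>H\<^esub> W"
      unfolding mem_sum_iff using V'(2) W'(1) M.l_zero[of w] by metis
  qed
  show "V <+>\<^bsub>H\<^esub> W \<subseteq> U" if "is_subspace F H U" "V \<subseteq> U" "W \<subseteq> U"
    using subspaceD(3)[OF that(1)] that(2,3) unfolding subset_iff mem_sum_iff by blast
qed

definition line :: "'v \<Rightarrow> 'v set" where
  "line v = {a \<odot>\<^bsub>H\<^esub> v |a. a \<in> F}"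

lemma line_subspace: "v \<in> carrier H \<Longrightarrow> is_subspace F H (line v)"
  unfolding is_subspace_iff line_def
proof (intro conjI ballI)
  assume v: "v \<in> carrier H"
  show "{a \<odot>\<^bsub>H\<^esub> v |a. a \<in> F} \<subseteq> carrier H" using v by auto
  have "\<zero>\<^bsub>H\<^esub> = 0 \<odot>\<^bsub>H\<^esub> v" using v smult_laws(4) scalar_closed(4) by simp
  then show "\<zero>\<^bsub>H\<^esub> \<in> {a \<odot>\<^bsub>H\<^esub> v |a. a \<in> F}" using scalar_closed(4) by blast
  show "x \<oplus>\<^bsub>H\<^esub> y \<in> {a \<odot>\<^bsub>H\<^esub> v |a. a \<in> F}"
    if "x \<in> {a \<odot>\<^bsub>H\<^esub> v |a. a \<in> F}" "y \<in> {a \<odot>\<^bsub>H\<^esub> v |a. a \<in> F}" for x y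
    using that v smult_laws(1)[symmetric] scalar_closed(1) by blast
  show "b \<odot>\<^bsub>H\<^esub> x \<in> {a \<odot>\<^bsub>H\<^esub> v |a. a \<in> F}" if "b \<in> F" "x \<in> {a \<odot>\<^bsub>H\<^esub> v |a. a \<in> F}" for b x
    using that v smult_laws(2)[symmetric] scalar_closed(2) by blast
qed

lemma mem_line: "v \<in> carrier H \<Longrightarrow> v \<in> line v"
  unfolding line_def using smult_laws(3)[of v, symmetric] scalar_closed(5) by blast

lemma line_least: "\<lbrakk>is_subspace F H W; v \<in> W\<rbrakk> \<Longrightarrow> line v \<subseteq> W"
  unfolding line_def using subspaceD(4) by blast

text \<open>A non-zero vector of \<open>W\<close> is a multiple of \<open>v\<close> with non-zero
  coefficient; dividing by that coefficient puts \<open>v\<close> into \<open>W\<close>.\<close>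

lemma line_atom:
  assumes W: "is_subspace F H W" and v: "v \<in> carrier H" and sub: "W \<subseteq> line v"
  shows "W = {\<zero>\<^bsub>H\<^esub>} \<or> W = line v"
proof (cases "W \<subseteq> {\<zero>\<^bsub>H\<^esub>}")
  case True
  then show ?thesis using subspaceD(2)[OF W] by blast
next
  case False
  then obtain a where a: "a \<in> F" "a \<odot>\<^bsub>H\<^esub> v \<in> W" "a \<odot>\<^bsub>H\<^esub> v \<noteq> \<zero>\<^bsub>H\<^esub>"
    using sub unfolding line_def by blast
  then have "a \<noteq> 0" using smult_laws(4)[of v] v by auto
  then have "v = (1 / a) \<odot>\<^bsub>H\<^esub> (a \<odot>\<^bsub>H\<^esub> v)"
    using smult_laws(2)[of "1 / a" a v] smult_laws(3)[of v] a v scalar_closed(5,7) by simp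
  then have "v \<in> W" using subspaceD(4)[OF W _ a(2)] scalar_closed(5,7) a(1) by metis
  then show ?thesis using line_least[OF W] sub by blast
qed

section \<open>Orthogonal complements and Gram-Schmidt\<close>

lemma perp_subspace: "W \<subseteq> carrier H \<Longrightarrow> is_subspace F H (perp H W)"
  unfolding is_subspace_iff perp_def
  by (auto simp: form_zero_right form_add_right form_smult_right subset_iff)

text \<open>Orthogonal decomposition of \<open>H\<close> along \<open>W\<close>, kept as a property
  of its own because anisotropy alone gives no metric projection. It later yields both the join law
  and the involution law for \<open>perp\<close>.\<close>

definition splitting :: "'v set \<Rightarrow> bool" where
  "splitting W \<longleftrightarrow> (\<forall>x\<in>carrier H. \<exists>v\<in>W. \<exists>u\<in>perp H W. x = v \<oplus>\<^bsub>H\<^esub> u)"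

text \<open>One Gram-Schmidt step: the component \<open>u\<close> of \<open>v\<close> orthogonal to
  \<open>S\<close> spans together with \<open>S\<close> the same subspace as \<open>v\<close> does,
  and the residue of each vector is corrected by its projection onto \<open>u\<close>.\<close>

lemma splitting_adjoin:
  assumes S: "is_subspace F H S" and split: "splitting S" and v: "v \<in> carrier H"
  shows "splitting (S <+>\<^bsub>H\<^esub> line v)"
  unfolding splitting_def
proof
  note S' = subspaceD[OF S]
  let ?T = "S <+>\<^bsub>H\<^esub> line v"
  obtain s u where su: "s \<in> S" "u \<in> perp H S" "v = s \<oplus>\<^bsub>H\<^esub> u"
    using split v unfolding splitting_def by blast
  fix x assume "x \<in> carrier H"
  then obtain t w where tw: "t \<in> S" "w \<in> perp H S" "x = t \<oplus>\<^bsub>H\<^esub> w"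
    using split unfolding splitting_def by blast
  have c: "s \<in> carrier H" "u \<in> carrier H" "t \<in> carrier H" "w \<in> carrier H"
    using su tw S'(1) unfolding perp_def by auto
  show "\<exists>v\<in>?T. \<exists>u\<in>perp H ?T. x = v \<oplus>\<^bsub>H\<^esub> u"
  proof -
    \<comment> \<open>The projection coefficient of \<open>w\<close> on \<open>u\<close>. If
      \<open>u\<close> is zero, then \<open>v\<close> already lies in \<open>S\<close> and nothing
      is to be subtracted.\<close>
    define a where "a = (if u = \<zero>\<^bsub>H\<^esub> then 0 else form H u w / form H u u)"
    have aF: "a \<in> F" "- a \<in> F" using c scalar_closed form_closed unfolding a_def by auto
    let ?w = "w \<oplus>\<^bsub>H\<^esub> (- a) \<odot>\<^bsub>H\<^esub> u"
    have "form H u ?w = form H u w - a * form H u u"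
      using c aF by (simp add: form_add_right form_smult_right)
    also have "\<dots> = 0"
      using form_anisotropic[of u] c form_left(3)[of w] by (simp add: a_def)
    finally have uw: "form H u ?w = 0" .
    have Sw: "form H r ?w = 0" if "r \<in> S" for r
      using that su(2) tw(2) c aF S'(1)[OF that] unfolding perp_def
      by (simp add: form_add_right form_smult_right)
    have "?w \<in> perp H ?T"
      unfolding perp_def
    proof (intro CollectI conjI ballI)
      show "?w \<in> carrier H" using c aF by simp
      fix r assume "r \<in> ?T"
      then obtain p b where r: "p \<in> S" "b \<in> F" "r = p \<oplus>\<^bsub>H\<^esub> b \<odot>\<^bsub>H\<^esub> v"
        unfolding mem_sum_iff line_def by blast
      have "form H v ?w = 0" using su c aF Sw[OF su(1)] uw by (simp add: form_left)
      then show "form H r ?w = 0"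
        using r c aF v S'(1)[OF r(1)] Sw[OF r(1)] by (simp add: form_left)
    qed
    moreover have "t \<oplus>\<^bsub>H\<^esub> a \<odot>\<^bsub>H\<^esub> u \<in> ?T"
    proof -
      \<comment> \<open>Since \<open>u\<close> is \<open>v\<close> minus \<open>s\<close>, a
        multiple of \<open>u\<close> is traded for a multiple of \<open>v\<close> at the cost of an
        element of \<open>S\<close>.\<close>
      have "t \<oplus>\<^bsub>H\<^esub> a \<odot>\<^bsub>H\<^esub> u = (t \<oplus>\<^bsub>H\<^esub> (- a) \<odot>\<^bsub>H\<^esub> s) \<oplus>\<^bsub>H\<^esub> a \<odot>\<^bsub>H\<^esub> v"
      proof -
        have "(t \<oplus>\<^bsub>H\<^esub> (- a) \<odot>\<^bsub>H\<^esub> s) \<oplus>\<^bsub>H\<^esub> a \<odot>\<^bsub>H\<^esub> v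
          = t \<oplus>\<^bsub>H\<^esub> a \<odot>\<^bsub>H\<^esub> u \<oplus>\<^bsub>H\<^esub> (a \<odot>\<^bsub>H\<^esub> s \<oplus>\<^bsub>H\<^esub> (- a) \<odot>\<^bsub>H\<^esub> s)"
          using c aF by (simp add: su(3) smult_add_right M.a_ac)
        then show ?thesis using c aF by (simp add: smult_cancel)
      qed
      moreover have "t \<oplus>\<^bsub>H\<^esub> (- a) \<odot>\<^bsub>H\<^esub> s \<in> S" using S'(3,4) tw(1) su(1) aF by blast
      moreover have "a \<odot>\<^bsub>H\<^esub> v \<in> line v" using aF unfolding line_def by blast
      ultimately show ?thesis unfolding mem_sum_iff by blast
    qed
    moreover have "x = (t \<oplus>\<^bsub>H\<^esub> a \<odot>\<^bsub>H\<^esub> u) \<oplus>\<^bsub>H\<^esub> ?w"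
    proof -
      have "(t \<oplus>\<^bsub>H\<^esub> a \<odot>\<^bsub>H\<^esub> u) \<oplus>\<^bsub>H\<^esub> ?w = t \<oplus>\<^bsub>H\<^esub> w \<oplus>\<^bsub>H\<^esub> (a \<odot>\<^bsub>H\<^esub> u \<oplus>\<^bsub>H\<^esub> (- a) \<odot>\<^bsub>H\<^esub> u)"
        using c aF by (simp add: M.a_ac)
      then show ?thesis using c aF tw(3) by (simp add: smult_cancel)
    qed
    ultimately show ?thesis by blast
  qed
qed

text \<open>The vector \<open>s\<close> is the sum of the orthogonal basis \<open>e\<close>; its orthogonal complement will serve as
  \<open>a\<^sub>0\<close>.\<close>

definition orthogonal_frame :: "nat \<Rightarrow> (nat \<Rightarrow> 'v) \<Rightarrow> 'v \<Rightarrow> 'v set \<Rightarrow> bool" where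
  "orthogonal_frame d e s S \<longleftrightarrow> is_subspace F H S \<and> s \<in> S \<and>
     (\<forall>i\<in>{1..d}. e i \<in> S \<and> e i \<noteq> \<zero>\<^bsub>H\<^esub> \<and> form H s (e i) \<noteq> 0) \<and>
     (\<forall>i\<in>{1..d}. \<forall>j\<in>{1..d}. i \<noteq> j \<longrightarrow> form H (e i) (e j) = 0) \<and>
     (\<forall>W. is_subspace F H W \<and> e ` {1..d} \<subseteq> W \<longrightarrow> S \<subseteq> W) \<and>
     (\<forall>W. is_subspace F H W \<and> W \<subseteq> S \<longrightarrow> splitting W)"

text \<open>As \<open>u\<close> is orthogonal to \<open>S\<close>, the sum vector pairs with the old
  \<open>e i\<close> as before and with \<open>u\<close> to \<open>form H u u\<close>, non-zero by
  anisotropy. For the splitting clause, a subspace \<open>W\<close> not inside \<open>S\<close> is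
  \<open>W \<inter> S\<close> enlarged by one vector, so \<open>splitting_adjoin\<close> applies;
  this is why the frame demands splitting of all subspaces of \<open>S\<close>.\<close>

lemma orthogonal_frame_adjoin:
  assumes frame: "orthogonal_frame d e s S" and u: "u \<in> perp H S" "u \<noteq> \<zero>\<^bsub>H\<^esub>"
  shows "orthogonal_frame (Suc d) (e(Suc d := u)) (s \<oplus>\<^bsub>H\<^esub> u) (S <+>\<^bsub>H\<^esub> line u)"
proof -
  have S: "is_subspace F H S" and s: "s \<in> S"
    and e: "\<And>i. i \<in> {1..d} \<Longrightarrow> e i \<in> S" "\<And>i. i \<in> {1..d} \<Longrightarrow> e i \<noteq> \<zero>\<^bsub>H\<^esub>"
      "\<And>i. i \<in> {1..d} \<Longrightarrow> form H s (e i) \<noteq> 0"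
    and orth: "\<And>i j. \<lbrakk>i \<in> {1..d}; j \<in> {1..d}; i \<noteq> j\<rbrakk> \<Longrightarrow> form H (e i) (e j) = 0"
    and gen: "\<And>W. \<lbrakk>is_subspace F H W; e ` {1..d} \<subseteq> W\<rbrakk> \<Longrightarrow> S \<subseteq> W"
    and split: "\<And>W. \<lbrakk>is_subspace F H W; W \<subseteq> S\<rbrakk> \<Longrightarrow> splitting W"
    using frame unfolding orthogonal_frame_def by blast+
  note S' = subspaceD[OF S]
  have uH: "u \<in> carrier H" using u unfolding perp_def by blast
  have Su: "form H r u = 0" "form H u r = 0" if "r \<in> S" for r
    using that u(1) form_eq_zero_commute[OF S'(1)[OF that] uH] unfolding perp_def by auto
  note lu = line_subspace[OF uH]
  note T = subspace_sum[OF S lu]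
  have index: "i \<in> {1..d} \<or> i = Suc d" if "i \<in> {1..Suc d}" for i using that by auto
  show ?thesis
    unfolding orthogonal_frame_def
  proof (intro conjI allI impI ballI)
    show "is_subspace F H (S <+>\<^bsub>H\<^esub> line u)" by (rule T(1))
    show "s \<oplus>\<^bsub>H\<^esub> u \<in> S <+>\<^bsub>H\<^esub> line u" using s mem_line[OF uH] unfolding mem_sum_iff by blast
  next
    fix i assume i: "i \<in> {1..Suc d}"
    show "(e(Suc d := u)) i \<in> S <+>\<^bsub>H\<^esub> line u"
      using index[OF i] e(1)[of i] T(2,3) mem_line[OF uH] by auto
    show "(e(Suc d := u)) i \<noteq> \<zero>\<^bsub>H\<^esub>" using index[OF i] e(2)[of i] u(2) by auto
    show "form H (s \<oplus>\<^bsub>H\<^esub> u) ((e(Suc d := u)) i) \<noteq> 0"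
      using index[OF i] e(1,3)[of i] S'(1) s uH Su form_anisotropic[OF uH u(2)]
      by (auto simp: form_left)
    fix j assume j: "j \<in> {1..Suc d}" "i \<noteq> j"
    show "form H ((e(Suc d := u)) i) ((e(Suc d := u)) j) = 0"
      using index[OF i] index[OF j(1)] j(2) orth[of i j] Su e(1) by auto
  next
    fix W assume W: "is_subspace F H W \<and> (e(Suc d := u)) ` {1..Suc d} \<subseteq> W"
    have *: "(e(Suc d := u)) i \<in> W" if "i \<in> {1..Suc d}" for i using W that by blast
    have "u \<in> W" using *[of "Suc d"] by simp
    moreover have "e i \<in> W" if "i \<in> {1..d}" for i using *[of i] that by (simp split: if_splits)
    ultimately have "u \<in> W" "e ` {1..d} \<subseteq> W" by blast+
    then show "S <+>\<^bsub>H\<^esub> line u \<subseteq> W" using T(4)[of W] W gen[of W] line_least[of W u] by simp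
  next
    fix W assume W: "is_subspace F H W \<and> W \<subseteq> S <+>\<^bsub>H\<^esub> line u"
    then have WI: "is_subspace F H (W \<inter> S)" using S unfolding is_subspace_iff by blast
    note W' = subspaceD[OF conjunct1[OF W]]
    show "splitting W"
    proof (cases "W \<subseteq> S")
      case True
      then show ?thesis using W split by blast
    next
      case False
      then obtain v where v: "v \<in> W" "v \<notin> S" by blast
      then have "v \<in> S <+>\<^bsub>H\<^esub> line u" using W by blast
      then obtain p a where p: "p \<in> S" "a \<in> F" "v = p \<oplus>\<^bsub>H\<^esub> a \<odot>\<^bsub>H\<^esub> u"
        unfolding mem_sum_iff line_def by blast
      have a0: "a \<noteq> 0"
        using v(2) p smult_laws(4)[OF uH] S'(1)[OF p(1)] by auto
      have vH: "v \<in> carrier H" using W' v by blast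
      have "W \<subseteq> (W \<inter> S) <+>\<^bsub>H\<^esub> line v"
      proof
        fix x assume x: "x \<in> W"
        then have "x \<in> S <+>\<^bsub>H\<^esub> line u" using W by blast
        then obtain q b where q: "q \<in> S" "b \<in> F" "x = q \<oplus>\<^bsub>H\<^esub> b \<odot>\<^bsub>H\<^esub> u"
          unfolding mem_sum_iff line_def by blast
        \<comment> \<open>With this ratio \<open>x\<close> minus \<open>c\<close> times
          \<open>v\<close> loses its \<open>u\<close> component and falls into
          \<open>S\<close>.\<close>
        define c where "c = b / a"
        have cF: "c \<in> F" "- c \<in> F" using q p scalar_closed unfolding c_def by auto
        have H: "q \<in> carrier H" "p \<in> carrier H" "x \<in> carrier H" using q p x S'(1) W' by auto
        have bu: "c \<odot>\<^bsub>H\<^esub> (a \<odot>\<^bsub>H\<^esub> u) = b \<odot>\<^bsub>H\<^esub> u"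
          using smult_laws(2)[OF cF(1) p(2) uH] a0 unfolding c_def by simp
        have mbu: "(- c) \<odot>\<^bsub>H\<^esub> (a \<odot>\<^bsub>H\<^esub> u) = (- b) \<odot>\<^bsub>H\<^esub> u"
          using smult_laws(2)[OF cF(2) p(2) uH] a0 unfolding c_def by simp
        have "x \<oplus>\<^bsub>H\<^esub> (- c) \<odot>\<^bsub>H\<^esub> v
          = q \<oplus>\<^bsub>H\<^esub> (- c) \<odot>\<^bsub>H\<^esub> p \<oplus>\<^bsub>H\<^esub> (b \<odot>\<^bsub>H\<^esub> u \<oplus>\<^bsub>H\<^esub> (- b) \<odot>\<^bsub>H\<^esub> u)"
          using H cF p q uH scalar_closed(3)[of b]
          by (simp add: smult_add_right mbu M.a_ac)
        also have "\<dots> = q \<oplus>\<^bsub>H\<^esub> (- c) \<odot>\<^bsub>H\<^esub> p" using H cF q uH by (simp add: smult_cancel)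
        also have "\<dots> \<in> S" using S'(3,4) q p cF by blast
        finally have "x \<oplus>\<^bsub>H\<^esub> (- c) \<odot>\<^bsub>H\<^esub> v \<in> W \<inter> S" using W'(3,4) x v cF by blast
        moreover have "x = (x \<oplus>\<^bsub>H\<^esub> (- c) \<odot>\<^bsub>H\<^esub> v) \<oplus>\<^bsub>H\<^esub> c \<odot>\<^bsub>H\<^esub> v"
        proof -
          have "(x \<oplus>\<^bsub>H\<^esub> (- c) \<odot>\<^bsub>H\<^esub> v) \<oplus>\<^bsub>H\<^esub> c \<odot>\<^bsub>H\<^esub> v = x \<oplus>\<^bsub>H\<^esub> (c \<odot>\<^bsub>H\<^esub> v \<oplus>\<^bsub>H\<^esub> (- c) \<odot>\<^bsub>H\<^esub> v)"
            using H cF vH by (simp add: M.a_ac)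
          then show ?thesis using H cF vH by (simp add: smult_cancel)
        qed
        moreover have "c \<odot>\<^bsub>H\<^esub> v \<in> line v" using cF unfolding line_def by blast
        ultimately show "x \<in> (W \<inter> S) <+>\<^bsub>H\<^esub> line v" unfolding mem_sum_iff by blast
      qed
      moreover have "(W \<inter> S) <+>\<^bsub>H\<^esub> line v \<subseteq> W"
        using subspace_sum(4)[OF WI line_subspace[OF vH]] W line_least v by blast
      ultimately have "W = (W \<inter> S) <+>\<^bsub>H\<^esub> line v" by blast
      then show ?thesis using splitting_adjoin[OF WI split vH] WI by simp
    qed
  qed
qed

text \<open>The frame grows by the component of each new vector orthogonal to what is already
  spanned; \<open>d\<close> counts the vectors for which that component is non-zero.\<close>

lemma orthogonal_frame_exists:
  "\<lbrakk>finite B; B \<subseteq> carrier H\<rbrakk> \<Longrightarrow> \<exists>d e s S. orthogonal_frame d e s S \<and> B \<subseteq> S"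
proof (induction B rule: finite_induct)
  case empty
  have zero: "is_subspace F H {\<zero>\<^bsub>H\<^esub>}"
    unfolding is_subspace_iff using smult_r_null by simp
  have "splitting W" if W: "is_subspace F H W" "W \<subseteq> {\<zero>\<^bsub>H\<^esub>}" for W
    unfolding splitting_def
  proof
    fix x assume x: "x \<in> carrier H"
    have "x \<in> perp H W" using x W form_left(3)[OF x] unfolding perp_def by auto
    moreover have "x = \<zero>\<^bsub>H\<^esub> \<oplus>\<^bsub>H\<^esub> x" using x by simp
    ultimately show "\<exists>v\<in>W. \<exists>u\<in>perp H W. x = v \<oplus>\<^bsub>H\<^esub> u" using subspaceD(2)[OF W(1)] by blast
  qed
  then have "orthogonal_frame 0 (\<lambda>_. \<zero>\<^bsub>H\<^esub>) \<zero>\<^bsub>H\<^esub> {\<zero>\<^bsub>H\<^esub>}"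
    unfolding orthogonal_frame_def using zero subspaceD(2) by auto
  then show ?case by blast
next
  case (insert b B)
  then obtain d e s S where frame: "orthogonal_frame d e s S" and B: "B \<subseteq> S" by auto
  then have S: "is_subspace F H S" "splitting S" unfolding orthogonal_frame_def by auto
  obtain p u where b: "p \<in> S" "u \<in> perp H S" "b = p \<oplus>\<^bsub>H\<^esub> u"
    using S(2) insert.prems unfolding splitting_def by blast
  have uH: "u \<in> carrier H" using b unfolding perp_def by blast
  show ?case
  proof (cases "u = \<zero>\<^bsub>H\<^esub>")
    case True
    then have "b \<in> S" using b subspaceD(1)[OF S(1)] by simp
    then show ?thesis using frame B by blast
  next
    case False
    have "b \<in> S <+>\<^bsub>H\<^esub> line u" using b mem_line[OF uH] unfolding mem_sum_iff by blast
    moreover have "B \<subseteq> S <+>\<^bsub>H\<^esub> line u" using B subspace_sum(2)[OF S(1) line_subspace[OF uH]] by blast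
    ultimately show ?thesis using orthogonal_frame_adjoin[OF frame b(2) False] by blast
  qed
qed

lemma full_orthogonal_frame:
  assumes "finite_dim F H"
  obtains d e s where "orthogonal_frame d e s (carrier H)"
proof -
  obtain B where B: "finite B" "B \<subseteq> carrier H"
    and gen: "\<And>W. \<lbrakk>is_subspace F H W; B \<subseteq> W\<rbrakk> \<Longrightarrow> W = carrier H"
    using assms unfolding finite_dim_def by blast
  obtain d e s S where frame: "orthogonal_frame d e s S" and S: "B \<subseteq> S"
    using orthogonal_frame_exists[OF B] by blast
  have "is_subspace F H S" using frame unfolding orthogonal_frame_def by simp
  then have "S = carrier H" using gen[of S] S by simp
  then show ?thesis using that[of d e s] frame by simp
qed

section \<open>The subspace lattice as a modular ortholattice with a diamond\<close>

lemma subspace_lattice_simps: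
  "carrier (subspace_lattice F H) = {W. is_subspace F H W}"
  "le (subspace_lattice F H) = (\<subseteq>)" "eq (subspace_lattice F H) = (=)"
  "ocompl (subspace_lattice F H) = perp H"
  unfolding subspace_lattice_def by simp_all

lemma sum_perp:
  assumes fin: "finite_dim F H" and W: "is_subspace F H W"
  shows "W <+>\<^bsub>H\<^esub> perp H W = carrier H"
proof (rule Set.equalityI; rule subsetI)
  have sub: "W \<subseteq> carrier H" using subspaceD(1)[OF W] by blast
  show "x \<in> carrier H" if "x \<in> W <+>\<^bsub>H\<^esub> perp H W" for x
    using subspaceD(1)[OF subspace_sum(1)[OF W perp_subspace[OF sub]] that] .
  obtain d e s where frame: "orthogonal_frame d e s (carrier H)" by (rule full_orthogonal_frame[OF fin])
  then have "splitting W" using W sub unfolding orthogonal_frame_def by simp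
  then show "x \<in> W <+>\<^bsub>H\<^esub> perp H W" if "x \<in> carrier H" for x
    using that unfolding splitting_def mem_sum_iff by simp
qed

text \<open>Splitting writes \<open>x\<close> as an element of \<open>W\<close> plus some
  \<open>u\<close> orthogonal to \<open>W\<close>; pairing with \<open>u\<close> gives
  \<open>form H u u = 0\<close>, so anisotropy removes \<open>u\<close>.\<close>

lemma perp_perp:
  assumes fin: "finite_dim F H" and W: "is_subspace F H W"
  shows "perp H (perp H W) = W"
proof
  note W' = subspaceD[OF W]
  show "W \<subseteq> perp H (perp H W)"
    using W'(1) form_eq_zero_commute unfolding perp_def by auto
  show "perp H (perp H W) \<subseteq> W"
  proof
    fix x assume x: "x \<in> perp H (perp H W)"
    then have "x \<in> W <+>\<^bsub>H\<^esub> perp H W" using sum_perp[OF fin W] unfolding perp_def by blast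
    then obtain w u where *: "w \<in> W" "u \<in> perp H W" "x = w \<oplus>\<^bsub>H\<^esub> u" unfolding mem_sum_iff by blast
    have c: "w \<in> carrier H" "u \<in> carrier H" using * W'(1) unfolding perp_def by auto
    have "form H u x = 0" using x *(2) unfolding perp_def by blast
    moreover have "form H u w = 0" using * c form_eq_zero_commute unfolding perp_def by blast
    ultimately have "form H u u = 0" using form_add_right[of u w u] c * by simp
    then have "u = \<zero>\<^bsub>H\<^esub>" using form_anisotropic c by blast
    then show "x \<in> W" using * c by simp
  qed
qed

lemma modular_ortholattice_subspace_lattice:
  assumes fin: "finite_dim F H"
  shows "modular_ortholattice (subspace_lattice F H)"
proof -
  let ?L = "subspace_lattice F H"
  have zero: "is_subspace F H {\<zero>\<^bsub>H\<^esub>}" and full: "is_subspace F H (carrier H)"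
    unfolding is_subspace_iff using smult_r_null by auto
  have perp: "is_subspace F H (perp H W)" if "is_subspace F H W" for W
    using perp_subspace subspaceD(1)[OF that] by blast
  show ?thesis
  proof
    fix x y assume "x \<in> carrier ?L" "y \<in> carrier ?L"
    then have xy: "is_subspace F H x" "is_subspace F H y" by (simp_all add: subspace_lattice_simps)
    have "least ?L (x <+>\<^bsub>H\<^esub> y) (Upper ?L {x, y})"
      using subspace_sum[OF xy] xy
      by (intro least_UpperI) (auto simp: subspace_lattice_simps Upper_def)
    then show "\<exists>s. least ?L s (Upper ?L {x, y})" by blast
    have "is_subspace F H (x \<inter> y)" using xy unfolding is_subspace_iff by blast
    then have "greatest ?L (x \<inter> y) (Lower ?L {x, y})"
      using xy by (intro greatest_LowerI) (auto simp: subspace_lattice_simps Lower_def)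
    then show "\<exists>s. greatest ?L s (Lower ?L {x, y})" by blast
  next
    have "least ?L {\<zero>\<^bsub>H\<^esub>} (carrier ?L)"
      using zero subspaceD(2) by (auto simp: least_def subspace_lattice_simps)
    then show "\<exists>x. least ?L x (carrier ?L)" by blast
    have "greatest ?L (carrier H) (carrier ?L)"
      using full subspaceD(1) by (auto simp: greatest_def subspace_lattice_simps)
    then show "\<exists>x. greatest ?L x (carrier ?L)" by blast
  next
    fix x y z assume "x \<in> carrier ?L" "y \<in> carrier ?L" "z \<in> carrier ?L" and "x \<sqsubseteq>\<^bsub>?L\<^esub> z"
    then have xyz: "is_subspace F H x" "is_subspace F H y" "is_subspace F H z" and le: "x \<subseteq> z"
      by (simp_all add: subspace_lattice_simps)
    have yz: "is_subspace F H (y \<inter> z)" using xyz unfolding is_subspace_iff by blast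
    have "x <+>\<^bsub>H\<^esub> (y \<inter> z) = (x <+>\<^bsub>H\<^esub> y) \<inter> z"
    proof
      show "x <+>\<^bsub>H\<^esub> (y \<inter> z) \<subseteq> (x <+>\<^bsub>H\<^esub> y) \<inter> z"
        using le subspaceD(3)[OF xyz(3)] unfolding subset_iff Int_iff mem_sum_iff by blast
      show "(x <+>\<^bsub>H\<^esub> y) \<inter> z \<subseteq> x <+>\<^bsub>H\<^esub> (y \<inter> z)"
      proof
        fix v assume "v \<in> (x <+>\<^bsub>H\<^esub> y) \<inter> z"
        then obtain p q where *: "p \<in> x" "q \<in> y" "v = p \<oplus>\<^bsub>H\<^esub> q" "v \<in> z" unfolding Int_iff mem_sum_iff by blast
        have c: "p \<in> carrier H" "q \<in> carrier H" using * xyz subspaceD(1) by blast+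
        have m1: "- 1 \<in> F" using scalar_closed(3,5) by blast
        \<comment> \<open>\<open>q\<close> is \<open>v\<close> minus \<open>p\<close>, and
          \<open>p\<close> lies in \<open>z\<close> because \<open>x\<close> is contained in
          \<open>z\<close>.\<close>
        have "q = (1 \<odot>\<^bsub>H\<^esub> p \<oplus>\<^bsub>H\<^esub> (- 1) \<odot>\<^bsub>H\<^esub> p) \<oplus>\<^bsub>H\<^esub> q"
          using c smult_cancel[OF scalar_closed(5) c(1)] by simp
        also have "\<dots> = v \<oplus>\<^bsub>H\<^esub> (- 1) \<odot>\<^bsub>H\<^esub> p"
          using c m1 *(3) smult_laws(3)[OF c(1)] by (simp add: M.a_ac)
        also have "\<dots> \<in> z" using subspaceD(3,4)[OF xyz(3)] * le m1 by blast
        finally show "v \<in> x <+>\<^bsub>H\<^esub> (y \<inter> z)" using * unfolding mem_sum_iff by blast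
      qed
    qed
    then show "x \<squnion>\<^bsub>?L\<^esub> (y \<sqinter>\<^bsub>?L\<^esub> z) = (x \<squnion>\<^bsub>?L\<^esub> y) \<sqinter>\<^bsub>?L\<^esub> z"
      using xyz yz subspace_sum(1)[OF xyz(1,2)]
      by (simp add: subspace_lattice_meet subspace_lattice_join)
  next
    fix x assume "x \<in> carrier ?L"
    then have x: "is_subspace F H x" by (simp add: subspace_lattice_simps)
    show "ocompl ?L x \<in> carrier ?L" using perp[OF x] by (simp add: subspace_lattice_simps)
    show "ocompl ?L (ocompl ?L x) = x" using perp_perp[OF fin x] by (simp add: subspace_lattice_simps)
    have "x \<inter> perp H x = {\<zero>\<^bsub>H\<^esub>}"
      using subspaceD(1,2)[OF x] subspaceD(2)[OF perp[OF x]] form_anisotropic unfolding perp_def by blast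
    then show "x \<sqinter>\<^bsub>?L\<^esub> ocompl ?L x = \<bottom>\<^bsub>?L\<^esub>"
      using subspace_lattice_meet[OF x perp[OF x]] subspace_lattice_bottom by (simp add: subspace_lattice_simps)
    show "x \<squnion>\<^bsub>?L\<^esub> ocompl ?L x = \<top>\<^bsub>?L\<^esub>"
      using subspace_lattice_join[OF x perp[OF x]] subspace_lattice_top sum_perp[OF fin x]
      by (simp add: subspace_lattice_simps)
  qed (auto simp: subspace_lattice_simps perp_def)
qed

text \<open>The hyperplane \<open>perp H {s}\<close> complements each line because \<open>s\<close>
  is not orthogonal to \<open>e i\<close>: a multiple of \<open>e i\<close> inside it has
  coefficient 0, and every vector can be moved into it along \<open>e i\<close>. With
  \<open>d = 0\<close> the zero space would contain the empty basis and so be all of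
  \<open>H\<close>.\<close>

lemma subspace_lattice_diamond:
  assumes fin: "finite_dim F H" and nontrivial: "carrier H \<noteq> {\<zero>\<^bsub>H\<^esub>}"
  obtains d a where "d \<ge> 1" "has_height (subspace_lattice F H) d"
    "orthogonal_diamond (subspace_lattice F H) d a"
proof -
  let ?L = "subspace_lattice F H"
  interpret L: modular_ortholattice ?L by (rule modular_ortholattice_subspace_lattice[OF fin])
  obtain d e s where frame: "orthogonal_frame d e s (carrier H)" by (rule full_orthogonal_frame[OF fin])
  then have s: "s \<in> carrier H"
    and e: "\<And>i. i \<in> {1..d} \<Longrightarrow> e i \<in> carrier H" "\<And>i. i \<in> {1..d} \<Longrightarrow> e i \<noteq> \<zero>\<^bsub>H\<^esub>"
      "\<And>i. i \<in> {1..d} \<Longrightarrow> form H s (e i) \<noteq> 0"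
    and orth: "\<And>i j. \<lbrakk>i \<in> {1..d}; j \<in> {1..d}; i \<noteq> j\<rbrakk> \<Longrightarrow> form H (e i) (e j) = 0"
    and gen: "\<And>W. \<lbrakk>is_subspace F H W; e ` {1..d} \<subseteq> W\<rbrakk> \<Longrightarrow> carrier H \<subseteq> W"
    unfolding orthogonal_frame_def by blast+
  define a where "a i = (if i = 0 then perp H {s} else line (e i))" for i :: nat
  have a0: "is_subspace F H (a 0)" using s perp_subspace[of "{s}"] unfolding a_def by simp
  have a: "is_subspace F H (a i)" "a i = line (e i)" if "i \<in> {1..d}" for i
    using that e(1) line_subspace unfolding a_def by auto
  have "d \<ge> 1"
  proof (rule ccontr)
    assume "\<not> d \<ge> 1"
    moreover have "is_subspace F H {\<zero>\<^bsub>H\<^esub>}"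
      unfolding is_subspace_iff using smult_r_null by simp
    ultimately have "carrier H \<subseteq> {\<zero>\<^bsub>H\<^esub>}" using gen by simp
    then show False using nontrivial by blast
  qed
  have fam: "L.orthogonal_family {1..d} a"
    unfolding L.orthogonal_family_def
  proof (intro conjI ballI impI)
    fix i assume i: "i \<in> {1..d}"
    show "a i \<in> carrier ?L" using a(1)[OF i] by (simp add: subspace_lattice_simps)
    show "a i \<noteq> \<bottom>\<^bsub>?L\<^esub>" using mem_line[OF e(1)[OF i]] e(2)[OF i] a(2)[OF i] by (auto simp: subspace_lattice_bottom)
    fix j assume j: "j \<in> {1..d}" "i \<noteq> j"
    have "form H w (e i) = 0" if w: "w \<in> line (e j)" for w
      using w orth[of j i] i j e(1) unfolding line_def by (auto simp: form_left(2))
    then have "e i \<in> perp H (a j)" using e(1)[OF i] a(2)[OF j(1)] unfolding perp_def by simp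
    then have "a i \<subseteq> perp H (a j)"
      using line_least[OF perp_subspace] a(2)[OF i] subspaceD(1)[OF a(1)[OF j(1)]] by blast
    then show "a i \<sqsubseteq>\<^bsub>?L\<^esub> ocompl ?L (a j)" by (simp add: subspace_lattice_simps)
  qed
  have h: "has_height ?L d"
  proof (rule L.has_height_if_orthogonal_atoms[OF fam])
    fix i b assume i: "i \<in> {1..d}" and b: "b \<in> carrier ?L" "b \<sqsubseteq>\<^bsub>?L\<^esub> a i"
    then show "b = \<bottom>\<^bsub>?L\<^esub> \<or> b = a i"
      using line_atom[of b "e i"] e(1)[OF i] a(2)[OF i]
      by (simp add: subspace_lattice_simps subspace_lattice_bottom)
  next
    fix z assume z: "z \<in> carrier ?L" "\<forall>i\<in>{1..d}. a i \<sqsubseteq>\<^bsub>?L\<^esub> z"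
    then have "is_subspace F H z" "e ` {1..d} \<subseteq> z"
      using mem_line e(1) a(2) by (auto simp: subspace_lattice_simps subset_iff)
    then show "z = \<top>\<^bsub>?L\<^esub>"
      using gen[of z] subspaceD(1)[of z] unfolding subspace_lattice_top by blast
  qed
  moreover have "orthogonal_diamond ?L d a"
    unfolding L.orthogonal_diamond_iff[OF \<open>d \<ge> 1\<close> h]
  proof (intro conjI ballI)
    show "a 0 \<in> carrier ?L" using a0 by (simp add: subspace_lattice_simps)
    show "L.orthogonal_family {1..d} a" by (rule fam)
    fix i assume i: "i \<in> {1..d}"
    note ei = e(1,3)[OF i]
    have "a 0 \<inter> a i = {\<zero>\<^bsub>H\<^esub>}"
    proof
      show "a 0 \<inter> a i \<subseteq> {\<zero>\<^bsub>H\<^esub>}"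
      proof
        fix x assume "x \<in> a 0 \<inter> a i"
        then obtain b where b: "b \<in> F" "x = b \<odot>\<^bsub>H\<^esub> e i" "form H s x = 0"
          using a(2)[OF i] unfolding a_def line_def perp_def by auto
        then have "b = 0" using ei s form_smult_right[of b s "e i"] by simp
        then show "x \<in> {\<zero>\<^bsub>H\<^esub>}" using b smult_laws(4)[of "e i"] ei by simp
      qed
    qed (use subspaceD(2)[OF a0] subspaceD(2)[OF a(1)[OF i]] in blast)
    then show "a 0 \<sqinter>\<^bsub>?L\<^esub> a i = \<bottom>\<^bsub>?L\<^esub>"
      using subspace_lattice_meet[OF a0 a(1)[OF i]] by (simp add: subspace_lattice_bottom)
    have "carrier H \<subseteq> a 0 <+>\<^bsub>H\<^esub> a i"
    proof
      fix x assume x: "x \<in> carrier H"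
      \<comment> \<open>The coefficient for which \<open>x\<close> minus \<open>c\<close> times
        \<open>e i\<close> is orthogonal to \<open>s\<close>.\<close>
      define c where "c = form H s x / form H s (e i)"
      have cF: "c \<in> F" "- c \<in> F" using scalar_closed form_closed s x ei unfolding c_def by auto
      have "form H s (x \<oplus>\<^bsub>H\<^esub> (- c) \<odot>\<^bsub>H\<^esub> e i) = 0"
        using s x ei cF by (simp add: form_add_right form_smult_right c_def)
      then have "x \<oplus>\<^bsub>H\<^esub> (- c) \<odot>\<^bsub>H\<^esub> e i \<in> a 0" using x ei cF unfolding a_def perp_def by simp
      moreover have "c \<odot>\<^bsub>H\<^esub> e i \<in> a i" using cF a(2)[OF i] unfolding line_def by blast
      moreover have "x = (x \<oplus>\<^bsub>H\<^esub> (- c) \<odot>\<^bsub>H\<^esub> e i) \<oplus>\<^bsub>H\<^esub> c \<odot>\<^bsub>H\<^esub> e i"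
      proof -
        have "(x \<oplus>\<^bsub>H\<^esub> (- c) \<odot>\<^bsub>H\<^esub> e i) \<oplus>\<^bsub>H\<^esub> c \<odot>\<^bsub>H\<^esub> e i = x \<oplus>\<^bsub>H\<^esub> (c \<odot>\<^bsub>H\<^esub> e i \<oplus>\<^bsub>H\<^esub> (- c) \<odot>\<^bsub>H\<^esub> e i)"
          using x ei cF by (simp add: M.a_ac)
        then show ?thesis using x ei cF by (simp add: smult_cancel)
      qed
      ultimately show "x \<in> a 0 <+>\<^bsub>H\<^esub> a i" unfolding mem_sum_iff by blast
    qed
    then have "a 0 <+>\<^bsub>H\<^esub> a i = carrier H"
      using subspaceD(1)[OF subspace_sum(1)[OF a0 a(1)[OF i]]] by blast
    then show "a 0 \<squnion>\<^bsub>?L\<^esub> a i = \<top>\<^bsub>?L\<^esub>"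
      using subspace_lattice_join[OF a0 a(1)[OF i]] by (simp add: subspace_lattice_top)
  qed
  ultimately show ?thesis using that \<open>d \<ge> 1\<close> by blast
qed

end

section \<open>A polynomial-time transducer\<close>

type_synonym 's control = "'s \<Rightarrow> nat list \<Rightarrow> ('s \<times> (nat \<times> move) list) option"

definition control_step :: "'s control \<Rightarrow> 's \<times> tape list \<Rightarrow> ('s \<times> tape list) option" where
  "control_step \<delta> c = (case \<delta> (fst c) (map read_tape (snd c)) of
     None \<Rightarrow> None
   | Some (q', as) \<Rightarrow> Some (q', map2 update_tape as (snd c)))"

definition reaches :: "'s control \<Rightarrow> nat \<Rightarrow> 's \<times> tape list \<Rightarrow> 's \<times> tape list \<Rightarrow> bool" where
  "reaches \<delta> n c c' \<longleftrightarrow> (\<exists>k\<le>n. (c, c') \<in> {(c, c'). control_step \<delta> c = Some c'} ^^ k)"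

lemma reaches_refl: "reaches \<delta> n c c"
  unfolding reaches_def by (rule exI[of _ 0]) simp

lemma reaches_trans:
  assumes "reaches \<delta> m a b" "reaches \<delta> n b c" "m + n \<le> l"
  shows "reaches \<delta> l a c"
proof -
  obtain i j where "i \<le> m" "j \<le> n" "(a, b) \<in> {(c, c'). control_step \<delta> c = Some c'} ^^ i"
    "(b, c) \<in> {(c, c'). control_step \<delta> c = Some c'} ^^ j"
    using assms unfolding reaches_def by blast
  then have "(a, c) \<in> {(c, c'). control_step \<delta> c = Some c'} ^^ (i + j)" "i + j \<le> l"
    using assms(3) unfolding relpow_add by auto
  then show ?thesis unfolding reaches_def by blast
qed

lemma reaches_step:
  assumes "control_step \<delta> a = Some b" "reaches \<delta> n b c" "Suc n \<le> l"
  shows "reaches \<delta> l a c"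
proof -
  have "reaches \<delta> 1 a b" unfolding reaches_def using assms(1) by (intro exI[of _ 1]) simp
  then show ?thesis using reaches_trans assms(2,3) by fastforce
qed

text \<open>Programs are written over a datatype of states and numbered only here, by enumerating
  the finite set \<open>Q\<close> of states that can occur.\<close>

lemma polytime_computable_if_control:
  fixes \<delta> :: "'s control" and p :: "nat poly"
  assumes fin: "finite Q" and start: "q0 \<in> Q"
    and tapes: "k \<ge> 1" and symbols: "g \<ge> 3"
    and closed: "\<And>q rs q' as. \<lbrakk>q \<in> Q; \<delta> q rs = Some (q', as)\<rbrakk> \<Longrightarrow> q' \<in> Q"
    and actions: "\<And>q rs q' as. \<lbrakk>q \<in> Q; length rs = k; set rs \<subseteq> {..<g}; \<delta> q rs = Some (q', as)\<rbrakk>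
      \<Longrightarrow> length as = k \<and> fst ` set as \<subseteq> {..<g}"
    and run: "\<And>w. \<exists>c. reaches \<delta> (poly p (length w))
        (q0, (string_tape w, 0) # replicate (k - 1) (string_tape [], 0)) c \<and>
      control_step \<delta> c = None \<and> fst (last (snd c)) = string_tape (f w)"
  shows "polytime_computable f"
proof -
  obtain qs where qs: "set qs = Q" using fin finite_list by blast
  \<comment> \<open>The start state heads the list and so gets number 0. It occurs again in
    \<open>qs\<close>, so positions are not unique and \<open>enc\<close> merely chooses
    one.\<close>
  define L where "L = q0 # qs"
  have L: "set L = Q" using qs start unfolding L_def by auto
  define enc where "enc q = (SOME i. i < length L \<and> L ! i = q)" for q
  have enc: "enc q < length L" "L ! enc q = q" if "q \<in> Q" for q
    using someI_ex[of "\<lambda>i. i < length L \<and> L ! i = q"] that L unfolding enc_def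
    by (auto simp: in_set_conv_nth)
  define M where "M = \<lparr>tapes = k, states = length L, symbols = g,
    delta = \<lambda>i rs. map_option (map_prod enc id) (\<delta> (L ! i) rs)\<rparr>"
  have wf: "wf_tm M"
    unfolding wf_tm_def
  proof (intro conjI allI impI)
    fix i rs assume i: "i < states M" and rs: "length rs = tapes M \<and> set rs \<subseteq> {..<symbols M}"
    then have Q: "L ! i \<in> Q" using L nth_mem[of i L] unfolding M_def by simp
    show "case delta M i rs of None \<Rightarrow> True | Some (q', as) \<Rightarrow>
      q' < states M \<and> length as = tapes M \<and> fst ` set as \<subseteq> {..<symbols M}"
    proof (cases "\<delta> (L ! i) rs")
      case None
      then show ?thesis by (simp add: M_def)
    next
      case (Some r)
      obtain q' as where r: "r = (q', as)" by (cases r)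
      then show ?thesis
        using Some enc(1)[OF closed[OF Q, of rs q' as]] actions[OF Q, of rs q' as] rs
        by (simp add: M_def)
    qed
  qed (use tapes symbols in \<open>auto simp: M_def L_def\<close>)
  have sim_step: "step M (i, ts) = map_option (map_prod enc id) (control_step \<delta> (L ! i, ts))" for i ts
    by (auto simp: control_step_def M_def split: option.splits)
  \<comment> \<open>The simulation keeps \<open>L ! j\<close> equal to the state rather than
    \<open>j\<close> equal to its \<open>enc\<close>, because the run starts at 0, which may differ
    from \<open>enc q0\<close>.\<close>
  have simulate: "\<exists>j. j < length L \<and> L ! j = fst d \<and>
      ((i, snd c), (j, snd d)) \<in> {(c, c'). step M c = Some c'} ^^ n"
    if "(c, d) \<in> {(c, c'). control_step \<delta> c = Some c'} ^^ n" "i < length L" "L ! i = fst c"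
    for i c d n
    using that
  proof (induction n arbitrary: d)
    case 0
    then show ?case by auto
  next
    case (Suc n)
    then obtain e where e: "(c, e) \<in> {(c, c'). control_step \<delta> c = Some c'} ^^ n"
      "control_step \<delta> e = Some d" by auto
    then obtain j where j: "j < length L" "L ! j = fst e"
      "((i, snd c), (j, snd e)) \<in> {(c, c'). step M c = Some c'} ^^ n" using Suc by blast
    have "fst e \<in> Q" using j L nth_mem by metis
    then have Q: "fst d \<in> Q"
      using e(2) closed by (auto simp: control_step_def split: option.splits prod.splits)
    have "step M (j, snd e) = Some (enc (fst d), snd d)"
      using sim_step[of j "snd e"] j(2) e(2) by (cases d) simp
    then have "((i, snd c), (enc (fst d), snd d)) \<in> {(c, c'). step M c = Some c'} ^^ Suc n"
      using j(3) by auto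
    then show ?case using enc[OF Q] by blast
  qed
  have "computes_within M w (f w) (poly p (length w))" for w
  proof -
    obtain c n where n: "n \<le> poly p (length w)"
      "((q0, (string_tape w, 0) # replicate (k - 1) (string_tape [], 0)), c)
        \<in> {(c, c'). control_step \<delta> c = Some c'} ^^ n"
      and halt: "control_step \<delta> c = None" "fst (last (snd c)) = string_tape (f w)"
      using run[of w] unfolding reaches_def by blast
    obtain j where j: "j < length L" "L ! j = fst c"
      "((0, (string_tape w, 0) # replicate (k - 1) (string_tape [], 0)), (j, snd c))
        \<in> {(c, c'). step M c = Some c'} ^^ n"
      using simulate[OF n(2), of 0] unfolding L_def by auto
    moreover have "init_config M w = (0, (string_tape w, 0) # replicate (k - 1) (string_tape [], 0))"
      by (simp add: init_config_def M_def)
    moreover have "step M (j, snd c) = None"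
      using sim_step[of j "snd c"] halt(1) j(2) by simp
    ultimately show ?thesis unfolding computes_within_def using n(1) halt(2) by metis
  qed
  then show ?thesis using wf unfolding polytime_computable_def by blast
qed

text \<open>The position inside a token of an encoded term.  The argument of \<open>In_index\<close> tells whether the
  index may end here: its most significant digit, which comes last, must not be zero.\<close>

datatype position = Tag0 | Tag1 bool | Tag2 bool bool | In_index bool | In_digit

fun advance :: "position \<Rightarrow> bool \<Rightarrow> position option" where
  "advance Tag0 b = Some (Tag1 b)"
| "advance (Tag1 b1) b = Some (Tag2 b1 b)"
| "advance (Tag2 False b2) b = Some Tag0"
| "advance (Tag2 True False) b = Some (if b then In_index True else Tag0)"
| "advance (Tag2 True True) b = None"
| "advance (In_index e) b = (if b then Some In_digit else if e then Some Tag0 else None)"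
| "advance In_digit b = Some (In_index b)"

text \<open>The number of terms still to be read, updated at the end of a token of arity 0, 1 or 2.\<close>

fun counter_move :: "position \<Rightarrow> bool \<Rightarrow> move" where
  "counter_move (Tag2 False False) b = MLeft"
| "counter_move (Tag2 False True) b = (if b then MRight else MStay)"
| "counter_move (Tag2 True False) b = (if b then MStay else MRight)"
| "counter_move (In_index e) b = (if b then MStay else MLeft)"
| "counter_move p b = MStay"

text \<open>The checking phase without tapes. In a run started with a pending term,
  \<open>nat\<close> never truncates a negative number, since inside a token at least one term is
  pending.\<close>

fun accepts :: "position \<Rightarrow> nat \<Rightarrow> bool list \<Rightarrow> bool" where
  "accepts p n [] \<longleftrightarrow> p = Tag0 \<and> n = 0"
| "accepts p n (b # w) \<longleftrightarrow> \<not> (p = Tag0 \<and> n = 0) \<and>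
     (case advance p b of None \<Rightarrow> False
      | Some p' \<Rightarrow> accepts p' (nat (int n + offset (counter_move p b))) w)"

section \<open>Accepted words are exactly the encoded terms\<close>

lemma accepts_encode_index:
  "e \<or> m \<noteq> 0 \<Longrightarrow> accepts (In_index e) (Suc n) (encode_index m @ u) \<longleftrightarrow> accepts Tag0 n u"
proof (induction m arbitrary: e rule: less_induct)
  case (less m)
  show ?case
  proof (cases "m = 0")
    case True
    then show ?thesis using less.prems by (simp add: encode_index.simps[of 0])
  next
    case False
    then have "odd m \<or> m div 2 \<noteq> 0" by presburger
    then show ?thesis using False less.IH[of "m div 2" "odd m"]
      by (simp add: encode_index.simps[of m] nat_add_distrib)
  qed
qed

text \<open>The arbitrary suffix and counter let the induction pass a binary node: its tag raises
  the counter by one, and each of the two subterms lowers it by one.\<close>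

lemma accepts_encode: "accepts Tag0 (Suc n) (encode t @ u) \<longleftrightarrow> accepts Tag0 n u"
  by (induction t arbitrary: n u) (simp_all add: accepts_encode_index nat_add_distrib)

text \<open>The side condition rules out a leading zero: for \<open>m = 0\<close> and digit 0 the
  number is 0, whose code is the end mark alone.\<close>

lemma encode_index_Cons:
  "b \<or> m \<noteq> 0 \<Longrightarrow> encode_index (2 * m + of_bool b) = True # b # encode_index m"
  by (subst encode_index.simps) auto

lemma accepts_index_imp:
  "accepts (In_index e) (Suc n) w \<Longrightarrow>
    \<exists>m u. w = encode_index m @ u \<and> (e \<or> m \<noteq> 0) \<and> accepts Tag0 n u"
proof (induction w arbitrary: e rule: length_induct)
  case (1 w)
  show ?case
  proof (cases w)
    case Nil
    then show ?thesis using 1 by simp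
  next
    case (Cons b v)
    show ?thesis
    proof (cases b)
      case False
      then have "e" "accepts Tag0 n v" using 1(2) Cons by (auto split: if_splits)
      then show ?thesis
        using Cons False by (intro exI[of _ 0] exI[of _ v]) (simp add: encode_index.simps[of 0])
    next
      case True
      then obtain b' v' where v: "v = b' # v'" using 1(2) Cons by (cases v) (auto split: if_splits)
      then have "accepts (In_index b') (Suc n) v'"
        using 1(2) Cons True by (simp add: nat_add_distrib)
      then obtain m u where "v' = encode_index m @ u" "b' \<or> m \<noteq> 0" "accepts Tag0 n u"
        using 1(1)[rule_format, of v' b'] Cons v by auto
      then show ?thesis
        using Cons True v encode_index_Cons[of b' m]
        by (intro exI[of _ "2 * m + of_bool b'"] exI[of _ u]) auto
    qed
  qed
qed

text \<open>A parser read off the automaton: the three tag bits determine the constructor, and the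
  unread rest after the left argument of a binary node is where the right one starts.\<close>

lemma accepts_Tag0_imp:
  "accepts Tag0 (Suc n) w \<Longrightarrow> \<exists>t u. w = encode t @ u \<and> accepts Tag0 n u"
proof (induction w arbitrary: n rule: length_induct)
  case (1 w)
  have "length w \<ge> 3"
  proof (rule ccontr)
    assume "\<not> ?thesis"
    then have "w = [] \<or> (\<exists>a. w = [a]) \<or> (\<exists>a b. w = [a, b])"
      by (cases w; cases "tl w"; cases "tl (tl w)") auto
    then show False using 1(2) by auto
  qed
  then obtain a b c v where w: "w = a # b # c # v"
    by (metis Suc_le_length_iff numeral_3_eq_3)
  have len: "length v < length w" using w by simp
  consider "\<not> a" "\<not> b" "\<not> c" | "\<not> a" "\<not> b" "c" | "\<not> a" "b" "\<not> c" | "\<not> a" "b" "c"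
    | "a" "\<not> b" "\<not> c" | "a" "\<not> b" "c" | "a" "b" by blast
  then show ?case
  proof cases
    case 1
    then have "accepts Tag0 n v" using "1.prems" w by simp
    then show ?thesis using 1 w by (intro exI[of _ Zero] exI[of _ v]) simp
  next
    case 2
    then have "accepts Tag0 n v" using "1.prems" w by simp
    then show ?thesis using 2 w by (intro exI[of _ One] exI[of _ v]) simp
  next
    case 3
    then have "accepts Tag0 (Suc n) v" using "1.prems" w by (simp add: nat_add_distrib)
    then obtain t u where "v = encode t @ u" "accepts Tag0 n u" using "1.IH" len by blast
    then show ?thesis using 3 w by (intro exI[of _ "Neg t"] exI[of _ u]) simp
  next
    case 4
    then have "accepts Tag0 (Suc (Suc n)) v" using "1.prems" w by (simp add: nat_add_distrib)
    then obtain s u where su: "v = encode s @ u" "accepts Tag0 (Suc n) u" using "1.IH" len by blast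
    moreover from su have "length u < length w" using w by simp
    ultimately obtain t u' where "u = encode t @ u'" "accepts Tag0 n u'" using "1.IH" by blast
    then show ?thesis using 4 w su by (intro exI[of _ "Meet s t"] exI[of _ u']) simp
  next
    case 5
    then have "accepts Tag0 (Suc (Suc n)) v" using "1.prems" w by (simp add: nat_add_distrib)
    then obtain s u where su: "v = encode s @ u" "accepts Tag0 (Suc n) u" using "1.IH" len by blast
    moreover from su have "length u < length w" using w by simp
    ultimately obtain t u' where "u = encode t @ u'" "accepts Tag0 n u'" using "1.IH" by blast
    then show ?thesis using 5 w su by (intro exI[of _ "Join s t"] exI[of _ u']) simp
  next
    case 6
    then have "accepts (In_index True) (Suc n) v" using "1.prems" w by (simp add: nat_add_distrib)
    then obtain m u where "v = encode_index m @ u" "accepts Tag0 n u" using accepts_index_imp by blast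
    then show ?thesis using 6 w by (intro exI[of _ "Var m"] exI[of _ u]) simp
  next
    case 7
    then show ?thesis using "1.prems" w by simp
  qed
qed

lemma accepts_iff: "accepts Tag0 1 w \<longleftrightarrow> w \<in> range encode"
proof
  assume "accepts Tag0 1 w"
  then obtain t u where "w = encode t @ u" "accepts Tag0 0 u" using accepts_Tag0_imp[of 0 w] by auto
  then show "w \<in> range encode" by (cases u) auto
next
  assume "w \<in> range encode"
  then obtain t where "w = encode t @ []" by auto
  then show "accepts Tag0 1 w" using accepts_encode[of 0 t "[]"] by simp
qed

section \<open>Renaming of variables and the copying machine\<close>

primrec rename :: "(nat \<Rightarrow> nat) \<Rightarrow> oterm \<Rightarrow> oterm" where
  "rename f (Var v) = Var (f v)"
| "rename f (Meet s t) = Meet (rename f s) (rename f t)"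
| "rename f (Join s t) = Join (rename f s) (rename f t)"
| "rename f (Neg t) = Neg (rename f t)"
| "rename f Zero = Zero"
| "rename f One = One"

text \<open>Moving the variables of a term to the odd indices prepends the digit 1 to every index.\<close>

definition odd_copy :: "oterm \<Rightarrow> oterm" where
  "odd_copy = rename (\<lambda>v. 2 * v + 1)"

lemma odd_copy_simps [simp]:
  "odd_copy (Var v) = Var (2 * v + 1)"
  "odd_copy (Meet s t) = Meet (odd_copy s) (odd_copy t)"
  "odd_copy (Join s t) = Join (odd_copy s) (odd_copy t)"
  "odd_copy (Neg t) = Neg (odd_copy t)"
  "odd_copy Zero = Zero"
  "odd_copy One = One"
  unfolding odd_copy_def by simp_all

definition fill :: "bool option list \<Rightarrow> bool list \<Rightarrow> bool list" where
  "fill \<tau> w = concat (map (case_option w (\<lambda>b. [b])) \<tau>)"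

text \<open>Tape 0 holds the input and tape 2 the output.  The counter is the head position on tape 1,
  whose only non-blank symbol marks cell 0.  In the template \<open>\<tau>\<close>, \<^const>\<open>None\<close> stands for the encoding
  of the renamed term; the states \<open>Insert1\<close> and \<open>Insert2\<close> prepend the new digit of an index.\<close>

datatype control_state =
    Start
  | Check position
  | Rewind nat
  | Write nat
  | Copy nat position
  | Insert1 nat
  | Insert2 nat

definition bit_symbol :: "bool \<Rightarrow> nat" where
  "bit_symbol b = (if b then 2 else 1)"

text \<open>The start step marks cell 0 of tape 1 and moves right: one term is pending, and the head
  is on the mark exactly when none is. Rejection halts before any bit is output.
  \<open>Rewind\<close> and \<open>Write\<close> carry the next template position, so each
  \<open>None\<close> costs one further pass over the input.\<close>

fun translate :: "bool option list \<Rightarrow> control_state control" where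
  "translate \<tau> Start [a, c, r] = Some (Check Tag0, [(a, MStay), (1, MRight), (r, MStay)])"
| "translate \<tau> (Check p) [a, c, r] =
    (if a = 0 then
       (if p = Tag0 \<and> c = 1 then Some (Rewind 0, [(a, MLeft), (c, MStay), (r, MStay)]) else None)
     else if p = Tag0 \<and> c = 1 then None
     else map_option (\<lambda>p'. (Check p', [(a, MRight), (c, counter_move p (a = 2)), (r, MStay)]))
       (advance p (a = 2)))"
| "translate \<tau> (Rewind i) [a, c, r] =
    (if a = 0 then Some (Write i, [(a, MRight), (c, MStay), (r, MStay)])
     else Some (Rewind i, [(a, MLeft), (c, MStay), (r, MStay)]))"
| "translate \<tau> (Write i) [a, c, r] =
    (if i < length \<tau> then
       (case \<tau> ! i of
          Some b \<Rightarrow> Some (Write (Suc i), [(a, MStay), (c, MStay), (bit_symbol b, MRight)])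
        | None \<Rightarrow> Some (Copy i Tag0, [(a, MStay), (c, MStay), (r, MStay)]))
     else None)"
| "translate \<tau> (Copy i p) [a, c, r] =
    (if a = 0 then Some (Rewind (Suc i), [(a, MLeft), (c, MStay), (r, MStay)])
     else map_option (\<lambda>p'. (if p = Tag2 True False \<and> a = 2 then Insert1 i else Copy i p',
         [(a, MRight), (c, MStay), (a, MRight)]))
       (advance p (a = 2)))"
| "translate \<tau> (Insert1 i) [a, c, r] = Some (Insert2 i, [(a, MStay), (c, MStay), (2, MRight)])"
| "translate \<tau> (Insert2 i) [a, c, r] =
    Some (Copy i (In_index True), [(a, MStay), (c, MStay), (2, MRight)])"
| "translate \<tau> q rs = None"

text \<open>\<open>string_tape [False]\<close> is the counter tape: the bit \<open>False\<close> is
  the symbol 1, here the mark in cell 0.\<close>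

definition conf ::
    "control_state \<Rightarrow> bool list \<Rightarrow> int \<Rightarrow> nat \<Rightarrow> bool list \<Rightarrow> control_state \<times> tape list" where
  "conf q w p n out =
     (q, [(string_tape w, p), (string_tape [False], int n), (string_tape out, int (length out))])"

section \<open>Runs of the machine\<close>

lemma string_tape_upd_same [simp]: "string_tape w p = s \<Longrightarrow> (string_tape w)(p := s) = string_tape w"
  by auto

lemma string_tape_append:
  "(string_tape out)(int (length out) := bit_symbol b) = string_tape (out @ [b])"
  by (auto simp: string_tape_def bit_symbol_def nth_append fun_eq_iff)

lemma string_tape_nth: "k < length w \<Longrightarrow> string_tape w (int k) = bit_symbol (w ! k)"
  by (simp add: string_tape_def bit_symbol_def)

lemma string_tape_outside [simp]:
  "string_tape w (int (length w)) = 0" "string_tape w (- 1) = 0"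
  by (simp_all add: string_tape_def)

lemma marker [simp]:
  "string_tape [False] (int n) = (if n = 0 then 1 else 0)" "string_tape [False] 0 = 1"
  by (simp_all add: string_tape_def)

lemma bit_symbol_simps [simp]: "bit_symbol b \<noteq> 0" "bit_symbol b = 2 \<longleftrightarrow> b" "bit_symbol b < 3"
  by (auto simp: bit_symbol_def)

lemma step_start:
  "control_step (translate \<tau>) (Start, [(string_tape w, 0), (string_tape [], 0), (string_tape [], 0)])
    = Some (conf (Check Tag0) w 0 1 [])"
  by (auto simp: control_step_def conf_def string_tape_def fun_eq_iff)

text \<open>The two conditions on \<open>p\<close> and \<open>n\<close> together make
  \<open>n\<close> positive, so a left move cannot carry the counter head past the mark.\<close>

lemma step_check:
  assumes "k < length w" "\<not> (p = Tag0 \<and> n = 0)" "p = Tag0 \<or> n > 0" "advance p (w ! k) = Some p'"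
  shows "control_step (translate \<tau>) (conf (Check p) w (int k) n out)
    = Some (conf (Check p') w (int (Suc k)) (nat (int n + offset (counter_move p (w ! k)))) out)"
proof -
  have "n > 0" using assms(2,3) by auto
  then have "int n + offset m = int (nat (int n + offset m))" for m by (cases m) auto
  then show ?thesis
    using assms \<open>n > 0\<close> unfolding control_step_def conf_def
    by (simp add: string_tape_nth)
qed

text \<open>One step per bit and one at the blank behind the input. Acceptance steps back onto the
  last bit with the counter at 0; rejection halts with empty output.\<close>

lemma run_check:
  assumes "w = u @ v" "p = Tag0 \<or> n > 0"
  shows "if accepts p n v
    then reaches (translate \<tau>) (Suc (length v))
      (conf (Check p) w (int (length u)) n []) (conf (Rewind 0) w (int (length w) - 1) 0 [])
    else \<exists>c. reaches (translate \<tau>) (Suc (length v)) (conf (Check p) w (int (length u)) n []) c \<and>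
      control_step (translate \<tau>) c = None \<and> fst (last (snd c)) = string_tape []"
  using assms
proof (induction v arbitrary: u p n)
  case Nil
  let ?c = "conf (Check p) w (int (length u)) n []"
  show ?case
  proof (cases "accepts p n []")
    case True
    then have "control_step (translate \<tau>) ?c = Some (conf (Rewind 0) w (int (length w) - 1) 0 [])"
      using Nil by (simp add: control_step_def conf_def)
    from reaches_step[OF this reaches_refl[of _ 0], of 1] show ?thesis
      using True by (simp del: accepts.simps)
  next
    case False
    then have "control_step (translate \<tau>) ?c = None"
      using Nil by (auto simp: control_step_def conf_def)
    moreover have "fst (last (snd ?c)) = string_tape []" by (simp add: conf_def)
    ultimately show ?thesis using False reaches_refl by (simp only: if_False) blast
  qed
next
  case (Cons b v)
  let ?c = "conf (Check p) w (int (length u)) n []"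
  have b: "length u < length w" "w ! length u = b" using Cons.prems by auto
  have out: "fst (last (snd ?c)) = string_tape []" by (simp add: conf_def)
  show ?case
  proof (cases "(p = Tag0 \<and> n = 0) \<or> advance p b = None")
    case True
    then have "control_step (translate \<tau>) ?c = None"
      using b string_tape_nth[OF b(1)] by (auto simp: control_step_def conf_def)
    moreover have "\<not> accepts p n (b # v)" using True by auto
    ultimately show ?thesis using out reaches_refl by (simp only: if_False) blast
  next
    case False
    then obtain p' where p': "advance p b = Some p'" by auto
    let ?n = "nat (int n + offset (counter_move p b))"
    have n: "n > 0" using False Cons.prems(2) by auto
    \<comment> \<open>The counter moves left only at the end of a token, that is when
      \<open>p'\<close> is \<open>Tag0\<close>.\<close>
    have "p' = Tag0 \<or> ?n > 0"
      using n p' by (cases "(p, b)" rule: advance.cases) (auto split: if_splits)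
    moreover have "w = (u @ [b]) @ v" using Cons.prems by simp
    ultimately have IH: "if accepts p' ?n v
      then reaches (translate \<tau>) (Suc (length v))
        (conf (Check p') w (int (length (u @ [b]))) ?n []) (conf (Rewind 0) w (int (length w) - 1) 0 [])
      else \<exists>c. reaches (translate \<tau>) (Suc (length v)) (conf (Check p') w (int (length (u @ [b]))) ?n []) c \<and>
        control_step (translate \<tau>) c = None \<and> fst (last (snd c)) = string_tape []"
      by (intro Cons.IH)
    have step: "control_step (translate \<tau>) ?c = Some (conf (Check p') w (int (length (u @ [b]))) ?n [])"
      using step_check[OF b(1), of p n p' \<tau> "[]"] b(2) p' n False by simp
    have acc: "accepts p n (b # v) \<longleftrightarrow> accepts p' ?n v" using False p' by simp
    show ?thesis
    proof (cases "accepts p' ?n v")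
      case True
      then show ?thesis using IH acc reaches_step[OF step] by simp
    next
      case False
      then show ?thesis using IH acc reaches_step[OF step] by (simp only: if_False) fastforce
    qed
  qed
qed

text \<open>One step for each of the \<open>k\<close> cells and one to turn around at the blank in
  cell \<open>- 1\<close>.\<close>

lemma run_rewind:
  "k \<le> length w \<Longrightarrow> reaches (translate \<tau>) (Suc k)
    (conf (Rewind i) w (int k - 1) n out) (conf (Write i) w 0 n out)"
proof (induction k)
  case 0
  have "control_step (translate \<tau>) (conf (Rewind i) w (int 0 - 1) n out) = Some (conf (Write i) w 0 n out)"
    by (simp add: control_step_def conf_def)
  then show ?case by (rule reaches_step[OF _ reaches_refl[of _ 0]]) simp
next
  case (Suc k)
  have "control_step (translate \<tau>) (conf (Rewind i) w (int (Suc k) - 1) n out)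
    = Some (conf (Rewind i) w (int k - 1) n out)"
    using Suc.prems string_tape_nth[of k w] by (simp add: control_step_def conf_def)
  then show ?case by (rule reaches_step) (use Suc in auto)
qed

lemma step_copy:
  assumes "k < length w" "advance p (w ! k) = Some p'" "\<not> (p = Tag2 True False \<and> w ! k)"
  shows "control_step (translate \<tau>) (conf (Copy i p) w (int k) n out)
    = Some (conf (Copy i p') w (int (Suc k)) n (out @ [w ! k]))"
  using assms string_tape_append[of out "w ! k"] string_tape_nth[of k w]
  by (auto simp: control_step_def conf_def)

lemma run_copy_index:
  "\<lbrakk>w = u @ encode_index m @ v; e \<or> m \<noteq> 0\<rbrakk> \<Longrightarrow> reaches (translate \<tau>) (length (encode_index m))
    (conf (Copy i (In_index e)) w (int (length u)) n out)
    (conf (Copy i Tag0) w (int (length (u @ encode_index m))) n (out @ encode_index m))"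
proof (induction m arbitrary: e u out rule: less_induct)
  case (less m)
  show ?case
  proof (cases "m = 0")
    case True
    then have m: "encode_index m = [False]" by (simp add: encode_index.simps[of 0])
    then have "control_step (translate \<tau>) (conf (Copy i (In_index e)) w (int (length u)) n out)
      = Some (conf (Copy i Tag0) w (int (Suc (length u))) n (out @ [False]))"
      using less.prems True step_copy[of "length u" w "In_index e" Tag0 \<tau> i n out] by simp
    from reaches_step[OF this reaches_refl[of _ 0], of 1] show ?thesis by (simp add: m)
  next
    case False
    let ?b = "odd m" and ?m = "m div 2"
    have m: "encode_index m = True # ?b # encode_index ?m"
      using False by (simp add: encode_index.simps[of m])
    have s1: "control_step (translate \<tau>) (conf (Copy i (In_index e)) w (int (length u)) n out)
      = Some (conf (Copy i In_digit) w (int (Suc (length u))) n (out @ [True]))"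
      using less.prems m step_copy[of "length u" w "In_index e" In_digit \<tau> i n out] by simp
    have s2: "control_step (translate \<tau>) (conf (Copy i In_digit) w (int (Suc (length u))) n (out @ [True]))
      = Some (conf (Copy i (In_index ?b)) w (int (length (u @ [True, ?b]))) n (out @ [True, ?b]))"
      using less.prems m step_copy[of "Suc (length u)" w In_digit "In_index ?b" \<tau> i n "out @ [True]"]
      by (simp add: nth_append)
    have "reaches (translate \<tau>) (length (encode_index ?m))
      (conf (Copy i (In_index ?b)) w (int (length (u @ [True, ?b]))) n (out @ [True, ?b]))
      (conf (Copy i Tag0) w (int (length ((u @ [True, ?b]) @ encode_index ?m))) n
        ((out @ [True, ?b]) @ encode_index ?m))"
    proof (rule less.IH)
      show "?b \<or> ?m \<noteq> 0" using False by presburger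
    qed (use False less.prems m in simp_all)
    then have "reaches (translate \<tau>) (Suc (Suc (length (encode_index ?m))))
      (conf (Copy i (In_index e)) w (int (length u)) n out)
      (conf (Copy i Tag0) w (int (length ((u @ [True, ?b]) @ encode_index ?m))) n
        ((out @ [True, ?b]) @ encode_index ?m))"
      by (intro reaches_step[OF s1 reaches_step[OF s2]]) auto
    then show ?thesis by (simp add: m)
  qed
qed

lemma run_copy_tag:
  assumes "w = u @ [a, b, c] @ v" "advance (Tag2 a b) c = Some p'" "\<not> (a \<and> \<not> b \<and> c)"
  shows "reaches (translate \<tau>) 3 (conf (Copy i Tag0) w (int (length u)) n out)
    (conf (Copy i p') w (int (length (u @ [a, b, c]))) n (out @ [a, b, c]))"
proof -
  have nth: "w ! length u = a" "w ! Suc (length u) = b" "w ! Suc (Suc (length u)) = c"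
    "Suc (Suc (length u)) < length w"
    using assms(1) by (auto simp: nth_append)
  have "control_step (translate \<tau>) (conf (Copy i Tag0) w (int (length u)) n out)
      = Some (conf (Copy i (Tag1 a)) w (int (Suc (length u))) n (out @ [a]))"
    using step_copy[of "length u" w Tag0 "Tag1 a" \<tau> i n out] nth by simp
  moreover have "control_step (translate \<tau>) (conf (Copy i (Tag1 a)) w (int (Suc (length u))) n (out @ [a]))
      = Some (conf (Copy i (Tag2 a b)) w (int (Suc (Suc (length u)))) n (out @ [a, b]))"
    using step_copy[of "Suc (length u)" w "Tag1 a" "Tag2 a b" \<tau> i n "out @ [a]"] nth by simp
  moreover have "control_step (translate \<tau>) (conf (Copy i (Tag2 a b)) w (int (Suc (Suc (length u)))) n (out @ [a, b]))
      = Some (conf (Copy i p') w (int (length (u @ [a, b, c]))) n (out @ [a, b, c]))"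
    using step_copy[of "Suc (Suc (length u))" w "Tag2 a b" p' \<tau> i n "out @ [a, b]"] nth assms(2,3) by simp
  ultimately show ?thesis
    by (intro reaches_step[OF _ reaches_step[OF _ reaches_step[OF _ reaches_refl[of _ 0]]]]) auto
qed

text \<open>Three steps for the tag and two for the inserted pair, a continuation bit and the digit
  1. Copying resumes with the flag \<open>True\<close> because the index in the input may be
  0.\<close>

lemma run_copy_var_tag:
  assumes "w = u @ [True, False, True] @ v"
  shows "reaches (translate \<tau>) 5 (conf (Copy i Tag0) w (int (length u)) n out)
    (conf (Copy i (In_index True)) w (int (length (u @ [True, False, True]))) n
      (out @ [True, False, True, True, True]))"
proof -
  have nth: "w ! length u" "\<not> w ! Suc (length u)" "w ! Suc (Suc (length u))"
    "Suc (Suc (length u)) < length w"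
    using assms by (auto simp: nth_append)
  have s1: "control_step (translate \<tau>) (conf (Copy i Tag0) w (int (length u)) n out)
      = Some (conf (Copy i (Tag1 True)) w (int (Suc (length u))) n (out @ [True]))"
    using step_copy[of "length u" w Tag0 "Tag1 True" \<tau> i n out] nth by simp
  have s2: "control_step (translate \<tau>) (conf (Copy i (Tag1 True)) w (int (Suc (length u))) n (out @ [True]))
      = Some (conf (Copy i (Tag2 True False)) w (int (Suc (Suc (length u)))) n (out @ [True, False]))"
    using step_copy[of "Suc (length u)" w "Tag1 True" "Tag2 True False" \<tau> i n "out @ [True]"] nth by simp
  have s3: "control_step (translate \<tau>) (conf (Copy i (Tag2 True False)) w (int (Suc (Suc (length u)))) n (out @ [True, False]))
      = Some (conf (Insert1 i) w (int (length (u @ [True, False, True]))) n (out @ [True, False, True]))"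
    using string_tape_append[of "out @ [True, False]" True] string_tape_nth[OF nth(4)] nth
    by (simp add: control_step_def conf_def)
  have s4: "control_step (translate \<tau>) (conf (Insert1 i) w q n out')
      = Some (conf (Insert2 i) w q n (out' @ [True]))" for q out'
    using string_tape_append[of out' True] by (simp add: control_step_def conf_def bit_symbol_def)
  have s5: "control_step (translate \<tau>) (conf (Insert2 i) w q n out')
      = Some (conf (Copy i (In_index True)) w q n (out' @ [True]))" for q out'
    using string_tape_append[of out' True] by (simp add: control_step_def conf_def bit_symbol_def)
  have "reaches (translate \<tau>) 5 (conf (Copy i Tag0) w (int (length u)) n out)
    (conf (Copy i (In_index True)) w (int (length (u @ [True, False, True]))) n
      (((out @ [True, False, True]) @ [True]) @ [True]))"
    by (rule reaches_step[OF s1 reaches_step[OF s2 reaches_step[OF s3 reaches_step[OF s4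
          reaches_step[OF s5 reaches_refl[of _ 0] order_refl] order_refl] order_refl] order_refl]]) simp
  then show ?thesis by simp
qed

text \<open>The factor 2 leaves room for the two extra steps at each variable. The automaton is back
  in \<open>Tag0\<close> after every subterm, so the copy can be described locally between arbitrary
  \<open>u\<close> and \<open>v\<close>.\<close>

lemma run_copy:
  "w = u @ encode t @ v \<Longrightarrow> reaches (translate \<tau>) (2 * length (encode t))
    (conf (Copy i Tag0) w (int (length u)) n out)
    (conf (Copy i Tag0) w (int (length (u @ encode t))) n (out @ encode (odd_copy t)))"
proof (induction t arbitrary: u v out)
  case (Var m)
  have idx: "encode_index (2 * m + 1) = True # True # encode_index m"
    using encode_index_Cons[of True m] by simp
  have r: "reaches (translate \<tau>) (length (encode_index m))
    (conf (Copy i (In_index True)) w (int (length (u @ [True, False, True]))) n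
      (out @ [True, False, True, True, True]))
    (conf (Copy i Tag0) w (int (length ((u @ [True, False, True]) @ encode_index m))) n
      ((out @ [True, False, True, True, True]) @ encode_index m))"
    by (rule run_copy_index) (use Var in auto)
  have "reaches (translate \<tau>) (2 * length (encode (Var m)))
    (conf (Copy i Tag0) w (int (length u)) n out)
    (conf (Copy i Tag0) w (int (length ((u @ [True, False, True]) @ encode_index m))) n
      ((out @ [True, False, True, True, True]) @ encode_index m))"
    by (rule reaches_trans[OF run_copy_var_tag r]) (use Var in auto)
  then show ?case using idx by simp
next
  case (Meet s t)
  have r1: "reaches (translate \<tau>) 3 (conf (Copy i Tag0) w (int (length u)) n out)
    (conf (Copy i Tag0) w (int (length (u @ [False, True, True]))) n (out @ [False, True, True]))"
    by (rule run_copy_tag) (use Meet.prems in auto)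
  have r2: "reaches (translate \<tau>) (2 * length (encode s))
    (conf (Copy i Tag0) w (int (length (u @ [False, True, True]))) n (out @ [False, True, True]))
    (conf (Copy i Tag0) w (int (length ((u @ [False, True, True]) @ encode s))) n
      ((out @ [False, True, True]) @ encode (odd_copy s)))"
    by (rule Meet.IH(1)) (use Meet.prems in auto)
  have r3: "reaches (translate \<tau>) (2 * length (encode t))
    (conf (Copy i Tag0) w (int (length ((u @ [False, True, True]) @ encode s))) n
      ((out @ [False, True, True]) @ encode (odd_copy s)))
    (conf (Copy i Tag0) w (int (length (((u @ [False, True, True]) @ encode s) @ encode t))) n
      (((out @ [False, True, True]) @ encode (odd_copy s)) @ encode (odd_copy t)))"
    by (rule Meet.IH(2)) (use Meet.prems in auto)
  have "reaches (translate \<tau>) (2 * length (encode (Meet s t)))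
    (conf (Copy i Tag0) w (int (length u)) n out)
    (conf (Copy i Tag0) w (int (length (((u @ [False, True, True]) @ encode s) @ encode t))) n
      (((out @ [False, True, True]) @ encode (odd_copy s)) @ encode (odd_copy t)))"
    by (rule reaches_trans[OF r1 reaches_trans[OF r2 r3 order_refl]]) simp
  then show ?case by simp
next
  case (Join s t)
  have r1: "reaches (translate \<tau>) 3 (conf (Copy i Tag0) w (int (length u)) n out)
    (conf (Copy i Tag0) w (int (length (u @ [True, False, False]))) n (out @ [True, False, False]))"
    by (rule run_copy_tag) (use Join.prems in auto)
  have r2: "reaches (translate \<tau>) (2 * length (encode s))
    (conf (Copy i Tag0) w (int (length (u @ [True, False, False]))) n (out @ [True, False, False]))
    (conf (Copy i Tag0) w (int (length ((u @ [True, False, False]) @ encode s))) n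
      ((out @ [True, False, False]) @ encode (odd_copy s)))"
    by (rule Join.IH(1)) (use Join.prems in auto)
  have r3: "reaches (translate \<tau>) (2 * length (encode t))
    (conf (Copy i Tag0) w (int (length ((u @ [True, False, False]) @ encode s))) n
      ((out @ [True, False, False]) @ encode (odd_copy s)))
    (conf (Copy i Tag0) w (int (length (((u @ [True, False, False]) @ encode s) @ encode t))) n
      (((out @ [True, False, False]) @ encode (odd_copy s)) @ encode (odd_copy t)))"
    by (rule Join.IH(2)) (use Join.prems in auto)
  have "reaches (translate \<tau>) (2 * length (encode (Join s t)))
    (conf (Copy i Tag0) w (int (length u)) n out)
    (conf (Copy i Tag0) w (int (length (((u @ [True, False, False]) @ encode s) @ encode t))) n
      (((out @ [True, False, False]) @ encode (odd_copy s)) @ encode (odd_copy t)))"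
    by (rule reaches_trans[OF r1 reaches_trans[OF r2 r3 order_refl]]) simp
  then show ?case by simp
next
  case (Neg t)
  have "reaches (translate \<tau>) 3 (conf (Copy i Tag0) w (int (length u)) n out)
    (conf (Copy i Tag0) w (int (length (u @ [False, True, False]))) n (out @ [False, True, False]))"
    by (rule run_copy_tag) (use Neg.prems in auto)
  moreover have "reaches (translate \<tau>) (2 * length (encode t))
    (conf (Copy i Tag0) w (int (length (u @ [False, True, False]))) n (out @ [False, True, False]))
    (conf (Copy i Tag0) w (int (length ((u @ [False, True, False]) @ encode t))) n
      ((out @ [False, True, False]) @ encode (odd_copy t)))"
    by (rule Neg.IH) (use Neg.prems in auto)
  ultimately have "reaches (translate \<tau>) (2 * length (encode (Neg t)))
    (conf (Copy i Tag0) w (int (length u)) n out)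
    (conf (Copy i Tag0) w (int (length ((u @ [False, True, False]) @ encode t))) n
      ((out @ [False, True, False]) @ encode (odd_copy t)))"
    by (rule reaches_trans) simp
  then show ?case by simp
next
  case Zero
  have "reaches (translate \<tau>) 3 (conf (Copy i Tag0) w (int (length u)) n out)
    (conf (Copy i Tag0) w (int (length (u @ [False, False, False]))) n (out @ [False, False, False]))"
    by (rule run_copy_tag) (use Zero in auto)
  from reaches_trans[OF this reaches_refl[of _ 0], of 6] show ?case by simp
next
  case One
  have "reaches (translate \<tau>) 3 (conf (Copy i Tag0) w (int (length u)) n out)
    (conf (Copy i Tag0) w (int (length (u @ [False, False, True]))) n (out @ [False, False, True]))"
    by (rule run_copy_tag) (use One in auto)
  from reaches_trans[OF this reaches_refl[of _ 0], of 6] show ?case by simp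
qed

text \<open>\<open>3 * length w + 3\<close> is the cost of one \<open>None\<close>:
  \<open>2 * length w\<close> for copying, \<open>length w + 1\<close> for rewinding and two changes
  of state. A fixed bit costs one step.\<close>

lemma run_write:
  assumes w: "w = encode t"
  shows "i + k = length \<tau> \<Longrightarrow> reaches (translate \<tau>) (k * (3 * length w + 3))
    (conf (Write i) w 0 n out)
    (conf (Write (length \<tau>)) w 0 n (out @ fill (drop i \<tau>) (encode (odd_copy t))))"
proof (induction k arbitrary: i out)
  case 0
  then show ?case by (simp add: fill_def reaches_refl)
next
  case (Suc k)
  then have i: "i < length \<tau>" by simp
  then have drop: "drop i \<tau> = \<tau> ! i # drop (Suc i) \<tau>" by (rule Cons_nth_drop_Suc[symmetric])
  note IH = Suc.IH[of "Suc i"]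
  show ?case
  proof (cases "\<tau> ! i")
    case (Some b)
    have "control_step (translate \<tau>) (conf (Write i) w 0 n out) = Some (conf (Write (Suc i)) w 0 n (out @ [b]))"
      using i Some string_tape_append[of out b] by (simp add: control_step_def conf_def)
    from reaches_step[OF this IH[of "out @ [b]"], of "Suc k * (3 * length w + 3)"]
    show ?thesis using Suc.prems Some drop by (simp add: fill_def)
  next
    case None
    let ?out = "out @ encode (odd_copy t)"
    have s1: "control_step (translate \<tau>) (conf (Write i) w 0 n out) = Some (conf (Copy i Tag0) w 0 n out)"
      using i None by (simp add: control_step_def conf_def)
    have r1: "reaches (translate \<tau>) (2 * length w) (conf (Copy i Tag0) w 0 n out)
      (conf (Copy i Tag0) w (int (length w)) n ?out)"
      using run_copy[of w "[]" t "[]" \<tau> i n out] w by simp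
    have s2: "control_step (translate \<tau>) (conf (Copy i Tag0) w (int (length w)) n ?out)
      = Some (conf (Rewind (Suc i)) w (int (length w) - 1) n ?out)"
      by (simp add: control_step_def conf_def)
    have r2: "reaches (translate \<tau>) (Suc (length w)) (conf (Rewind (Suc i)) w (int (length w) - 1) n ?out)
      (conf (Write (Suc i)) w 0 n ?out)"
      by (rule run_rewind) simp
    have r3: "reaches (translate \<tau>) (k * (3 * length w + 3)) (conf (Write (Suc i)) w 0 n ?out)
      (conf (Write (length \<tau>)) w 0 n (?out @ fill (drop (Suc i) \<tau>) (encode (odd_copy t))))"
      using IH[of ?out] Suc.prems by simp
    have "reaches (translate \<tau>) (Suc k * (3 * length w + 3)) (conf (Write i) w 0 n out)
      (conf (Write (length \<tau>)) w 0 n (?out @ fill (drop (Suc i) \<tau>) (encode (odd_copy t))))"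
      by (rule reaches_step[OF s1 reaches_trans[OF r1 reaches_step[OF s2 reaches_trans[OF r2 r3 order_refl]
            order_refl] order_refl]]) simp
    then show ?thesis using None drop by (simp add: fill_def)
  qed
qed

lemma finite_positions: "finite (UNIV :: position set)"
proof -
  have "p \<in> {Tag0, In_digit} \<union> range Tag1 \<union> range (\<lambda>(a, b). Tag2 a b) \<union> range In_index" for p
    by (cases p) auto
  then have "UNIV \<subseteq> {Tag0, In_digit} \<union> range Tag1 \<union> range (\<lambda>(a, b). Tag2 a b) \<union> range In_index"
    by blast
  then show ?thesis by (rule finite_subset) simp
qed

lemma polytime_computable_fill:
  assumes enc: "\<And>t. f (encode t) = fill \<tau> (encode (odd_copy t))"
    and other: "\<And>w. w \<notin> range encode \<Longrightarrow> f w = []"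
  shows "polytime_computable f"
proof -
  let ?n = "length \<tau>"
  \<comment> \<open>\<open>Rewind\<close> and \<open>Write\<close> may carry the index
    \<open>?n\<close>, reached after the last template entry; the other indexed states occur only
    while an entry is being processed.\<close>
  define Q where "Q = {Start} \<union> range Check \<union> Rewind ` {..?n} \<union> Write ` {..?n} \<union>
    (\<lambda>(i, p). Copy i p) ` ({..<?n} \<times> UNIV) \<union> Insert1 ` {..<?n} \<union> Insert2 ` {..<?n}"
  \<comment> \<open>One start step, \<open>length w + 1\<close> steps each for checking and
    rewinding, and \<open>?n\<close> times the cost of a template entry.\<close>
  define p where "p = [:3 + 3 * ?n, 2 + 3 * ?n:]"
  show ?thesis
  proof (rule polytime_computable_if_control)
    show "finite Q" unfolding Q_def using finite_positions by auto
    show "Start \<in> Q" unfolding Q_def by simp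
    fix q rs q' as assume q: "q \<in> Q" and \<delta>: "translate \<tau> q rs = Some (q', as)"
    show "q' \<in> Q"
      using \<delta> q by (cases "(\<tau>, q, rs)" rule: translate.cases)
        (auto simp: Q_def image_iff split: if_splits option.splits)
    assume "length rs = 3" "set rs \<subseteq> {..<3}"
    then show "length as = 3 \<and> fst ` set as \<subseteq> {..<3}"
      using \<delta> by (cases "(\<tau>, q, rs)" rule: translate.cases) (auto split: if_splits option.splits)
  next
    fix w
    have init: "(Start, (string_tape w, 0) # replicate (3 - 1) (string_tape [], 0))
      = (Start, [(string_tape w, 0), (string_tape [], 0), (string_tape [], 0)])"
      by (simp add: numeral_2_eq_2)
    show "\<exists>c. reaches (translate \<tau>) (poly p (length w))
        (Start, (string_tape w, 0) # replicate (3 - 1) (string_tape [], 0)) c \<and>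
      control_step (translate \<tau>) c = None \<and> fst (last (snd c)) = string_tape (f w)"
    proof (cases "w \<in> range encode")
      case True
      then obtain t where t: "w = encode t" by blast
      let ?end = "conf (Write ?n) w 0 0 (fill \<tau> (encode (odd_copy t)))"
      have r1: "reaches (translate \<tau>) (Suc (length w)) (conf (Check Tag0) w 0 1 [])
        (conf (Rewind 0) w (int (length w) - 1) 0 [])"
        using run_check[of w "[]" w Tag0 1 \<tau>] True accepts_iff by simp
      have r2: "reaches (translate \<tau>) (Suc (length w)) (conf (Rewind 0) w (int (length w) - 1) 0 [])
        (conf (Write 0) w 0 0 [])"
        by (rule run_rewind) simp
      have r3: "reaches (translate \<tau>) (?n * (3 * length w + 3)) (conf (Write 0) w 0 0 []) ?end"
        using run_write[OF t, of 0 ?n \<tau> 0 "[]"] by simp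
      have "reaches (translate \<tau>) (poly p (length w))
        (Start, (string_tape w, 0) # replicate (3 - 1) (string_tape [], 0)) ?end"
        unfolding init
        by (rule reaches_step[OF step_start reaches_trans[OF r1 reaches_trans[OF r2 r3 order_refl] order_refl]])
          (simp add: p_def algebra_simps)
      moreover have "control_step (translate \<tau>) ?end = None"
        by (simp add: control_step_def conf_def)
      moreover have "fst (last (snd ?end)) = string_tape (f w)"
        by (simp add: conf_def t enc)
      ultimately show ?thesis by blast
    next
      case False
      then obtain c where c: "reaches (translate \<tau>) (Suc (length w)) (conf (Check Tag0) w 0 1 []) c"
        "control_step (translate \<tau>) c = None" "fst (last (snd c)) = string_tape []"
        using run_check[of w "[]" w Tag0 1 \<tau>] accepts_iff by auto
      have "reaches (translate \<tau>) (poly p (length w))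
        (Start, (string_tape w, 0) # replicate (3 - 1) (string_tape [], 0)) c"
        unfolding init by (rule reaches_step[OF step_start c(1)]) (simp add: p_def)
      then show ?thesis using c(2,3) other[OF False] by (intro exI[of _ c]) simp
    qed
  qed simp_all
qed

text \<open>One pattern must serve all terms \<open>t\<close>; in Polish notation the patterns of
  subterms are simply concatenated.\<close>

definition template :: "(oterm \<Rightarrow> oterm) \<Rightarrow> bool" where
  "template T \<longleftrightarrow> (\<exists>\<tau>. \<forall>t. encode (T t) = fill \<tau> (encode t))"

lemma fill_simps:
  "fill (\<tau> @ \<upsilon>) w = fill \<tau> w @ fill \<upsilon> w" "fill (map Some v) w = v" "fill [None] w = w"
  by (simp_all add: fill_def comp_def)

lemma template_id: "template (\<lambda>t. t)"
  unfolding template_def by (rule exI[of _ "[None]"]) (simp add: fill_simps)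

lemma template_const: "template (\<lambda>_. s)"
  unfolding template_def by (rule exI[of _ "map Some (encode s)"]) (simp add: fill_simps)

lemma template_Meet: "\<lbrakk>template S; template T\<rbrakk> \<Longrightarrow> template (\<lambda>t. Meet (S t) (T t))"
proof -
  assume "template S" "template T"
  then obtain \<sigma> \<tau> where "\<forall>t. encode (S t) = fill \<sigma> (encode t)" "\<forall>t. encode (T t) = fill \<tau> (encode t)"
    unfolding template_def by blast
  then have "\<forall>t. encode (Meet (S t) (T t)) = fill (map Some [False, True, True] @ \<sigma> @ \<tau>) (encode t)"
    by (simp only: fill_simps encode.simps simp_thms)
  then show ?thesis unfolding template_def by blast
qed

lemma template_Join: "\<lbrakk>template S; template T\<rbrakk> \<Longrightarrow> template (\<lambda>t. Join (S t) (T t))"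
proof -
  assume "template S" "template T"
  then obtain \<sigma> \<tau> where "\<forall>t. encode (S t) = fill \<sigma> (encode t)" "\<forall>t. encode (T t) = fill \<tau> (encode t)"
    unfolding template_def by blast
  then have "\<forall>t. encode (Join (S t) (T t)) = fill (map Some [True, False, False] @ \<sigma> @ \<tau>) (encode t)"
    by (simp only: fill_simps encode.simps simp_thms)
  then show ?thesis unfolding template_def by blast
qed

lemma template_Meets:
  "(\<And>k. template (T k)) \<Longrightarrow> template (\<lambda>t. Meets (map (\<lambda>k. T k t) ks))"
  unfolding Meets_def by (induction ks) (auto intro: template_const template_Meet)

lemma template_Joins:
  "(\<And>k. template (T k)) \<Longrightarrow> template (\<lambda>t. Joins (map (\<lambda>k. T k t) ks))"
  unfolding Joins_def by (induction ks) (auto intro: template_const template_Join)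

lemma template_h_tilde: "template (\<lambda>t. h_tilde d t y)"
proof -
  \<comment> \<open>The double comprehension of \<open>h_hat\<close> is rewritten over the list of
    index pairs, so that \<open>template_Joins\<close> sees a single family.\<close>
  have "template (\<lambda>t. Joins (map (\<lambda>k. Meet (Join (Meet (Join t (Neg (y (fst k)))) (y (fst k))) (y 0)) (y (snd k)))
    (List.product [1..<d+1] [1..<d+1])))"
    by (intro template_Joins template_Meet template_Join template_id template_const)
  then show ?thesis
    unfolding h_tilde_def h_hat_def
    by (intro template_Meet template_const) (simp add: product_concat_map map_concat comp_def del: upt_Suc)
qed

lemma template_g_tilde: "template (\<lambda>t. g_tilde d t y)"
  unfolding g_tilde_def
  by (intro template_Meets template_Meet template_Join template_id template_const)

lemma oeval_rename: "oeval L \<rho> (rename f t) = oeval L (\<rho> \<circ> f) t"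
  by (induction t) auto

text \<open>Halving indices turns a valuation of \<open>t\<close> into one of its copy with the same
  value; in the other direction a valuation is read at the odd indices.\<close>

lemma satisfiable_odd_copy:
  "weakly_satisfiable L (odd_copy t) \<longleftrightarrow> weakly_satisfiable L t"
  "strongly_satisfiable L (odd_copy t) \<longleftrightarrow> strongly_satisfiable L t"
proof -
  have half: "oeval L (\<lambda>v. \<rho> (v div 2)) (odd_copy t) = oeval L \<rho> t" for \<rho>
    unfolding odd_copy_def oeval_rename by (simp add: comp_def)
  have double: "oeval L \<rho> (odd_copy t) = oeval L (\<lambda>v. \<rho> (2 * v + 1)) t" for \<rho>
    unfolding odd_copy_def oeval_rename by (simp add: comp_def)
  show "weakly_satisfiable L (odd_copy t) \<longleftrightarrow> weakly_satisfiable L t"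
    unfolding weakly_satisfiable_def using half double by metis
  show "strongly_satisfiable L (odd_copy t) \<longleftrightarrow> strongly_satisfiable L t"
    unfolding strongly_satisfiable_def using half double by metis
qed

lemma odd_vars_odd_copy: "v \<in> vars (odd_copy t) \<Longrightarrow> odd v"
  by (induction t) auto

text \<open>Words that encode no term are sent to the empty word, which encodes none either, so
  membership fails on both sides.\<close>

lemma polytime_reducible_template:
  assumes "template T" and "A = encode ` {t. P t}" "B = encode ` {t. R t}"
    and "\<And>t. P t \<longleftrightarrow> R (T (odd_copy t))"
  shows "polytime_reducible A B"
proof -
  obtain \<tau> where \<tau>: "\<And>t. encode (T t) = fill \<tau> (encode t)"
    using assms(1) unfolding template_def by blast
  define f where "f w = (if w \<in> range encode then encode (T (odd_copy (the_inv encode w))) else [])" for w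
  have f: "f (encode t) = encode (T (odd_copy t))" for t
    unfolding f_def by (simp add: the_inv_f_f[OF inj_encode])
  have "polytime_computable f"
    by (rule polytime_computable_fill[of f \<tau>]) (simp_all add: f \<tau>, simp add: f_def)
  moreover have "w \<in> A \<longleftrightarrow> f w \<in> B" for w
  proof (cases "w \<in> range encode")
    case True
    then obtain t where "w = encode t" by blast
    then show ?thesis using assms(2-4) f inj_encode by (auto simp: inj_image_mem_iff)
  next
    case False
    have "[] \<noteq> encode t" for t by (cases t) auto
    then have "f w \<notin> B" using False assms(3) unfolding f_def by auto
    then show ?thesis using False assms(2) by auto
  qed
  ultimately show ?thesis unfolding polytime_reducible_def by blast
qed

section \<open>The reductions\<close>

lemma polytime_reductions:
  assumes d: "d \<ge> 1" and L: "modular_ortholattice L" and h: "has_height L d"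
    and a: "orthogonal_diamond L d a"
  shows "polytime_reducible (sat_weak L) (SAT_strong L)" "polytime_reducible (SAT_strong L) (sat_weak L)"
proof -
  let ?y = "\<lambda>i. Var (2 * i)"
  have y: "inj_on (\<lambda>i. 2 * i) {0..d}" "(\<lambda>i. 2 * i) ` {0..d} \<inter> vars (odd_copy t) = {}" for t
    by (auto intro: inj_onI dest: odd_vars_odd_copy)
  note equiv = satisfiability_equivalences[OF d L h a y, unfolded satisfiable_odd_copy]
  show "polytime_reducible (sat_weak L) (SAT_strong L)"
    by (rule polytime_reducible_template[OF template_h_tilde[of d ?y] sat_weak_def SAT_strong_def equiv(1)])
  show "polytime_reducible (SAT_strong L) (sat_weak L)"
    by (rule polytime_reducible_template[OF template_g_tilde[of d ?y] SAT_strong_def sat_weak_def equiv(2)])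
qed

theorem theorem5p1:
  shows
    "(\<forall>(d::nat) (L :: 'a ortholattice) (t :: oterm) (y :: nat \<Rightarrow> nat).
        d \<ge> 1 \<and> modular_ortholattice L \<and> has_height L d \<and>
        (\<exists>a. orthogonal_diamond L d a) \<and>
        inj_on y {0..d} \<and> y ` {0..d} \<inter> vars t = {} \<longrightarrow>
        (weakly_satisfiable L t \<longleftrightarrow>
           strongly_satisfiable L (h_tilde d t (\<lambda>i. Var (y i)))) \<and>
        (strongly_satisfiable L t \<longleftrightarrow>
           weakly_satisfiable L (g_tilde d t (\<lambda>i. Var (y i))))) \<and>
     (\<forall>(F :: complex set) (H :: 'v unitary).
        unitary_space F H \<and> finite_dim F H \<and> carrier H \<noteq> {\<zero>\<^bsub>H\<^esub>} \<longrightarrow>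
        polytime_reducible (sat_weak (subspace_lattice F H)) (SAT_strong (subspace_lattice F H)) \<and>
        polytime_reducible (SAT_strong (subspace_lattice F H)) (sat_weak (subspace_lattice F H)))"
proof (intro conjI[of "\<forall>d. _ d"] allI impI)
  fix d :: nat and L :: "'a ortholattice" and t and y :: "nat \<Rightarrow> nat"
  assume "d \<ge> 1 \<and> modular_ortholattice L \<and> has_height L d \<and> (\<exists>a. orthogonal_diamond L d a) \<and>
    inj_on y {0..d} \<and> y ` {0..d} \<inter> vars t = {}"
  then obtain a where "d \<ge> 1" "modular_ortholattice L" "has_height L d" "orthogonal_diamond L d a"
    "inj_on y {0..d}" "y ` {0..d} \<inter> vars t = {}" by blast
  from satisfiability_equivalences[OF this]
  show "(weakly_satisfiable L t \<longleftrightarrow> strongly_satisfiable L (h_tilde d t (\<lambda>i. Var (y i)))) \<and>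
    (strongly_satisfiable L t \<longleftrightarrow> weakly_satisfiable L (g_tilde d t (\<lambda>i. Var (y i))))"
    by (rule conjI)
next
  fix F and H :: "'v unitary"
  assume "unitary_space F H \<and> finite_dim F H \<and> carrier H \<noteq> {\<zero>\<^bsub>H\<^esub>}"
  then have H: "unitary_space F H" and fin: "finite_dim F H" and nz: "carrier H \<noteq> {\<zero>\<^bsub>H\<^esub>}"
    by simp_all
  \<comment> \<open>\<open>d\<close> is a constant of the fixed space: it is built into the
    templates and not computed from the input.\<close>
  obtain d a where da: "d \<ge> 1" "has_height (subspace_lattice F H) d"
    "orthogonal_diamond (subspace_lattice F H) d a"
    by (rule unitary_space.subspace_lattice_diamond[OF H fin nz])
  from polytime_reductions[OF da(1) unitary_space.modular_ortholattice_subspace_lattice[OF H fin] da(2,3)]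
  show "polytime_reducible (sat_weak (subspace_lattice F H)) (SAT_strong (subspace_lattice F H)) \<and>
    polytime_reducible (SAT_strong (subspace_lattice F H)) (sat_weak (subspace_lattice F H))"
    by (rule conjI)
qed

end
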